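(* Let $s,t\ge1$ and $a,b\in\mathbb R\cup\{\infty\}$. Let $s',t'\ge1$ be the constants determined by the relations $st=s't'$ and $s+s'=1+st$. Then $$F_a^sF_b^t\mu=F_b^{s'}F_a^{t'}\mu\in\mathcal M(\mathbb R\setminus\{a,b\})\qquad\text{for all }\mu\in\mathcal M(\mathbb R\setminus\{a,b\}).$$
   Context: $\hat{\mathbb R}=\mathbb R\cup\{\infty\}$, viewed inside the Riemann sphere $\hat{\mathbb C}$. For Borel $K\subset\hat{\mathbb R}$, $\mathcal M(K)$ is the set of Borel probability measures on $\hat{\mathbb C}$ vanishing outside $K$. For a Möbius transformation $T$, $T_*\mu(E)=\mu(T^{-1}(E))$. For $\mu\in\mathcal M(\mathbb R)$ and $t\ge1$, $\mu^{\boxplus t}$ is the fractional free additive convolution power, determined by $R_{\mu^{\boxplus t}}=tR_\mu$, where $R_\mu(z)=G_\mu^{\langle-1\rangle}(z)-\frac1z$ and $G_\mu(z)=\int\frac{1}{z-x}\,d\mu(x)$. Then $F^t\mu\in\mathcal M(\mathbb R)$ is the pushforward of $\mu^{\boxplus t}$ under $x\mapsto x/t$. For $\mu=r\delta_\infty+(1-r)\nu\in\mathcal M(\hat{\mathbb R})$ with $\nu\in\mathcal M(\mathbb R)$, $0\le r\le1$, set $F^t\mu=tr\,\delta_\infty+(1-tr)F^{\frac{t-tr}{1-tr}}\nu$ if $tr<1$ and $F^t\mu=\delta_\infty$ if $tr\ge1$. For $a\in\hat{\mathbb R}$, $F_a^t\mu:=T^{-1}_*F^tT_*\mu$, where $T(z)=\frac1{z-a}$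 if $a\in\mathbb R$ and $T(z)=z$ if $a=\infty$. *)

theory Defs
  imports "HOL-Probability.Probability"
begin

section \<open>The Riemann sphere and the measure classes\<close>

text \<open>
  The Riemann sphere is the one-point compactification of the complex plane: \<open>Some z\<close> is the
  finite point \<open>z\<close> and \<open>None\<close> is \<open>\<infinity>\<close>.
\<close>

type_synonym sphere = "complex option"

definition sphere_borel :: "sphere measure" where
  "sphere_borel = sigma UNIV {U. openin (Alexandroff_compactification (euclidean :: complex topology)) U}"

definition real_line :: "sphere set" where
  "real_line = Some ` \<real>"

definition ext_real_line :: "sphere set" where
  "ext_real_line = insert None real_line"

text \<open>
  \<open>prob_on K\<close> is \<open>\<M>(K)\<close>. It is meant for Borel sets \<open>K\<close>, where the last condition says that the
  complement of \<open>K\<close> has measure zero; for such sets see \<open>prob_on_iff\<close> below.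
\<close>

definition prob_on :: "sphere set \<Rightarrow> sphere measure set" where
  "prob_on K = {\<mu>. sets \<mu> = sets sphere_borel \<and> prob_space \<mu> \<and> (AE x in \<mu>. x \<in> K)}"

definition delta_inf :: "sphere measure" where
  "delta_inf = return sphere_borel None"

text \<open>The convex combination \<open>p M + (1 - p) N\<close>, for \<open>0 \<le> p \<le> 1\<close>.\<close>

definition mixture :: "real \<Rightarrow> 'a measure \<Rightarrow> 'a measure \<Rightarrow> 'a measure" where
  "mixture p M N = measure_of (space M) (sets M)
     (\<lambda>A. ennreal p * emeasure M A + ennreal (1 - p) * emeasure N A)"


section \<open>Free convolution powers\<close>

text \<open>For measures on the real line the value of the integrand at \<open>\<infinity>\<close> is immaterial.\<close>

definition cauchy_transform :: "sphere measure \<Rightarrow> complex \<Rightarrow> complex" where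
  "cauchy_transform \<mu> z = (LINT x|\<mu>. (case x of None \<Rightarrow> 0 | Some w \<Rightarrow> 1 / (z - w)))"

definition stolz :: "real \<Rightarrow> real \<Rightarrow> complex set" where
  "stolz \<alpha> \<beta> = {z. \<beta> < Im z \<and> \<bar>Re z\<bar> < \<alpha> * Im z}"

text \<open>
  For measures with unbounded support the inverse of the Cauchy transform is taken, following
  Bercovici and Voiculescu, on a truncated cone \<open>stolz \<alpha> \<beta>\<close>: for every \<open>\<alpha> > 0\<close> the Cauchy transform
  is injective on this cone once \<open>\<beta>\<close> is large. The choice of \<open>\<alpha>\<close> does not influence the germ of the
  inverse at \<open>0\<close>; we take \<open>\<alpha> = 1\<close>. As the cones \<open>stolz 1 \<beta>\<close> are nested, the point selected below does
  not depend on \<open>\<beta>\<close>.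
\<close>

definition cauchy_inverse :: "sphere measure \<Rightarrow> complex \<Rightarrow> complex" where
  "cauchy_inverse \<mu> w = (THE z. \<exists>\<beta>>0. inj_on (cauchy_transform \<mu>) (stolz 1 \<beta>) \<and>
     z \<in> stolz 1 \<beta> \<and> cauchy_transform \<mu> z = w)"

definition R_transform :: "sphere measure \<Rightarrow> complex \<Rightarrow> complex" where
  "R_transform \<mu> w = cauchy_inverse \<mu> w - 1 / w"

text \<open>
  The identity of R-transforms is required near \<open>0\<close> in the region where \<open>1 / w\<close> lies in a cone of
  smaller aperture. As the Cauchy transform is asymptotic to \<open>1 / z\<close> non-tangentially at \<open>\<infinity>\<close>, that
  region is contained in the domain of both inverses once \<open>\<beta>\<close> is large.
\<close>

definition free_power :: "sphere measure \<Rightarrow> real \<Rightarrow> sphere measure" where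
  "free_power \<mu> t = (THE \<nu>. \<nu> \<in> prob_on real_line \<and>
     (\<exists>\<beta>>0. \<forall>w. 1 / w \<in> stolz (1 / 2) \<beta> \<longrightarrow>
        R_transform \<nu> w = complex_of_real t * R_transform \<mu> w))"


section \<open>The flows\<close>

text \<open>\<open>F_real\<close> is \<open>F\<close> on measures on the real line, and \<open>F_inf\<close> its extension to \<open>ext_real_line\<close>.\<close>

definition F_real :: "real \<Rightarrow> sphere measure \<Rightarrow> sphere measure" where
  "F_real t \<mu> = distr (free_power \<mu> t) sphere_borel (map_option (\<lambda>x. x / complex_of_real t))"

text \<open>
  In the decomposition \<open>\<mu> = r \<delta>\<^sub>\<infinity> + (1 - r) \<nu>\<close> the number \<open>r\<close> is the mass of \<open>\<infinity>\<close> and, if \<open>r < 1\<close>,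
  the measure \<open>\<nu>\<close> is \<open>\<mu>\<close> conditioned on the complement of \<open>\<infinity>\<close>; see \<open>mixture_delta_inf_iff\<close>.
\<close>

definition F_inf :: "real \<Rightarrow> sphere measure \<Rightarrow> sphere measure" where
  "F_inf t \<mu> =
     (let r = measure \<mu> {None}; \<nu> = uniform_measure \<mu> (- {None})
      in if t * r < 1
         then mixture (t * r) delta_inf (F_real ((t - t * r) / (1 - t * r)) \<nu>)
         else delta_inf)"

fun moebius_to_inf :: "sphere \<Rightarrow> sphere \<Rightarrow> sphere" where
  "moebius_to_inf None z = z"
| "moebius_to_inf (Some a) None = Some 0"
| "moebius_to_inf (Some a) (Some z) = (if z = a then None else Some (1 / (z - a)))"

definition F_at :: "sphere \<Rightarrow> real \<Rightarrow> sphere measure \<Rightarrow> sphere measure" where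
  "F_at a t \<mu> =
     distr (F_inf t (distr \<mu> sphere_borel (moebius_to_inf a))) sphere_borel (inv (moebius_to_inf a))"


section \<open>Sanity checks\<close>

lemma space_sphere_borel [simp]: "space sphere_borel = UNIV"
  by (simp add: sphere_borel_def space_measure_of_conv)

lemma sets_sphere_borel:
  "sets sphere_borel = sigma_sets UNIV {U. openin (Alexandroff_compactification euclidean) U}"
  by (simp add: sphere_borel_def)

lemma sets_sphere_borel_iff: "A \<in> sets sphere_borel \<longleftrightarrow> Some -` A \<in> sets borel"
proof
  have "Some \<in> borel \<rightarrow>\<^sub>M sphere_borel"
    unfolding sphere_borel_def
  proof (rule measurable_measure_of)
    fix U :: "sphere set" assume "U \<in> {U. openin (Alexandroff_compactification euclidean) U}"
    then consider V where "open V" "U = Some ` V" | C where "compact C" "U = insert None (Some ` (UNIV - C))"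
      by (auto simp: openin_Alexandroff_compactification)
    then have "open (Some -` U)"
    proof cases
      case (1 V)
      then show ?thesis by (simp add: inj_vimage_image_eq)
    next
      case (2 C)
      then have "Some -` U = - C" by auto
      then show ?thesis using 2 by (simp add: open_Compl compact_imp_closed)
    qed
    then show "Some -` U \<inter> space borel \<in> sets borel" by simp
  qed auto
  then show "A \<in> sets sphere_borel \<Longrightarrow> Some -` A \<in> sets borel"
    by (auto dest: measurable_sets)
next
  have opn: "Some ` U \<in> sets sphere_borel" if "open U" for U :: "complex set"
    unfolding sets_sphere_borel
    by (rule sigma_sets.Basic) (use that in simp)
  have Some_im: "Some ` B \<in> sets sphere_borel" if "B \<in> sets borel" for B :: "complex set"
  proof -
    from that have "B \<in> sigma_sets UNIV {S. open S}" by (simp add: borel_def)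
    then show ?thesis
    proof induction
      case (Compl C)
      have "Some ` (UNIV - C) = range Some - Some ` C" by auto
      with sets.Diff[OF opn[OF open_UNIV] Compl.IH] show ?case by simp
    next
      case (Union C)
      then show ?case by (auto simp: image_UN)
    qed (auto intro: opn)
  qed
  have "{None} = space sphere_borel - range (Some :: complex \<Rightarrow> _)"
    by (simp add: set_eq_iff notin_range_Some)
  then have None: "{None} \<in> sets sphere_borel"
    using sets.compl_sets[OF opn[OF open_UNIV]] by simp
  assume "Some -` A \<in> sets borel"
  then have "Some ` (Some -` A) \<in> sets sphere_borel" by (rule Some_im)
  then have meas: "(if None \<in> A then {None} else {}) \<union> Some ` (Some -` A) \<in> sets sphere_borel"
    using None by (intro sets.Un) auto
  have "(if None \<in> A then {None} else {}) \<union> Some ` (Some -` A) = A"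
  proof (rule set_eqI)
    show "x \<in> (if None \<in> A then {None} else {}) \<union> Some ` (Some -` A) \<longleftrightarrow> x \<in> A" for x
      by (cases x) auto
  qed
  with meas show "A \<in> sets sphere_borel" by (simp only:)
qed

lemma real_line_measurable: "real_line - {a, b} \<in> sets sphere_borel"
proof -
  have "Some -` (real_line - {a, b}) = \<real> - Some -` {a} - Some -` {b}"
    by (auto simp: real_line_def)
  moreover have "Some -` {c} \<in> sets borel" for c :: sphere
    by (cases c) (auto simp: vimage_def)
  moreover have "(\<real> :: complex set) \<in> sets borel"
    by (simp add: borel_closed closed_complex_Reals)
  ultimately show ?thesis by (simp add: sets_sphere_borel_iff sets.Diff)
qed

lemma prob_on_iff:
  assumes "K \<in> sets sphere_borel"
  shows "\<mu> \<in> prob_on K \<longleftrightarrow>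
    sets \<mu> = sets sphere_borel \<and> prob_space \<mu> \<and> emeasure \<mu> (- K) = 0"
proof -
  have "(AE x in \<mu>. x \<in> K) \<longleftrightarrow> emeasure \<mu> (- K) = 0" if "sets \<mu> = sets sphere_borel"
  proof -
    have "space \<mu> = UNIV" using sets_eq_imp_space_eq[OF that] by simp
    then show ?thesis
      using assms that by (subst AE_iff_measurable[where N = "- K"])
        (auto simp: Compl_eq_Diff_UNIV intro: sets.compl_sets simp flip: space_sphere_borel)
  qed
  then show ?thesis by (auto simp: prob_on_def)
qed

lemma emeasure_mixture:
  assumes "sets M = sets N" "A \<in> sets M"
  shows "emeasure (mixture p M N) A = ennreal p * emeasure M A + ennreal (1 - p) * emeasure N A"
proof -
  let ?f = "\<lambda>A. ennreal p * emeasure M A + ennreal (1 - p) * emeasure N A"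
  have "positive (sets M) ?f" by (simp add: positive_def)
  moreover have "countably_additive (sets M) ?f"
  proof (rule countably_additiveI)
    fix B :: "nat \<Rightarrow> _" assume B: "range B \<subseteq> sets M" "disjoint_family B"
    then show "(\<Sum>i. ?f (B i)) = ?f (\<Union>i. B i)"
      using assms(1) by (simp add: suminf_add[symmetric] suminf_emeasure)
  qed
  ultimately show ?thesis
    unfolding mixture_def
    using emeasure_measure_of_sigma[OF sets.sigma_algebra_axioms, of M ?f] assms(2) by simp
qed

lemma sets_mixture [simp]: "sets (mixture p M N) = sets M"
  and space_mixture [simp]: "space (mixture p M N) = space M"
  by (simp_all add: mixture_def)

lemma mixture_delta_inf_iff:
  assumes \<mu>: "\<mu> \<in> prob_on ext_real_line" and \<nu>: "\<nu> \<in> prob_on real_line" and r: "0 \<le> r" "r < 1"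
  shows "\<mu> = mixture r delta_inf \<nu> \<longleftrightarrow>
    r = measure \<mu> {None} \<and> \<nu> = uniform_measure \<mu> (- {None})"
proof -
  interpret M: prob_space \<mu> using \<mu> by (simp add: prob_on_def)
  interpret N: prob_space \<nu> using \<nu> by (simp add: prob_on_def)
  have sets: "sets \<mu> = sets sphere_borel" "sets \<nu> = sets sphere_borel"
    "sets delta_inf = sets sphere_borel"
    using \<mu> \<nu> by (auto simp: prob_on_def delta_inf_def)
  have space: "space \<mu> = UNIV"
    using sets_eq_imp_space_eq[OF sets(1)] by simp
  have "Some -` {None} = ({} :: complex set)" "Some -` (- {None}) = (UNIV :: complex set)" by auto
  then have None: "{None} \<in> sets sphere_borel" "- {None} \<in> sets sphere_borel"
    by (simp_all add: sets_sphere_borel_iff)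
  have "real_line \<in> sets sphere_borel"
    using real_line_measurable[of None None] by (simp add: real_line_def image_iff)
  then have "emeasure \<nu> (- real_line) = 0"
    using \<nu> by (simp add: prob_on_iff)
  then have \<nu>0: "emeasure \<nu> {None} = 0"
  proof -
    have "- real_line \<in> sets \<nu>"
      using sets.compl_sets[OF \<open>real_line \<in> sets sphere_borel\<close>] sets
      by (simp add: Compl_eq_Diff_UNIV)
    moreover have "{None} \<subseteq> - real_line" by (auto simp: real_line_def)
    ultimately show ?thesis
      using emeasure_mono[of "{None}" "- real_line" \<nu>] \<open>emeasure \<nu> (- real_line) = 0\<close> by simp
  qed
  have mix: "emeasure (mixture r delta_inf \<nu>) A
      = ennreal r * indicator A None + ennreal (1 - r) * emeasure \<nu> A"
    if "A \<in> sets sphere_borel" for A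
    using that sets by (simp add: emeasure_mixture) (simp add: delta_inf_def)
  have compl: "emeasure \<mu> (- {None}) = ennreal (1 - measure \<mu> {None})"
    using M.prob_compl[of "{None}"] None sets space
    by (simp add: M.emeasure_eq_measure Compl_eq_Diff_UNIV)
  show ?thesis
  proof
    assume eq: "\<mu> = mixture r delta_inf \<nu>"
    have "emeasure \<mu> {None} = ennreal r"
      by (subst eq) (simp add: mix None \<nu>0)
    then have req: "r = measure \<mu> {None}"
      using r by (simp add: measure_def)
    have "\<nu> = uniform_measure \<mu> (- {None})"
    proof (rule measure_eqI)
      fix A assume A: "A \<in> sets \<nu>"
      have I: "- {None} \<inter> A \<in> sets sphere_borel" using A None sets by (auto intro: sets.Int)
      have "emeasure \<nu> A = emeasure \<nu> (- {None} \<inter> A)"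
      proof (rule emeasure_eq_AE)
        have "AE x in \<nu>. x \<in> real_line" using \<nu> by (simp add: prob_on_def)
        then show "AE x in \<nu>. (x \<in> A) = (x \<in> - {None} \<inter> A)"
          by eventually_elim (auto simp: real_line_def)
      qed (use A I sets in auto)
      moreover have "emeasure \<mu> (- {None} \<inter> A) = ennreal (1 - r) * emeasure \<nu> (- {None} \<inter> A)"
        by (subst eq) (simp add: mix I)
      ultimately have "emeasure \<mu> (- {None} \<inter> A) = ennreal (1 - r) * emeasure \<nu> A" by simp
      moreover have "emeasure (uniform_measure \<mu> (- {None})) A
          = emeasure \<mu> (- {None} \<inter> A) / ennreal (1 - r)"
        using A None sets compl req by simp
      ultimately show "emeasure \<nu> A = emeasure (uniform_measure \<mu> (- {None})) A"
        using r by (simp add: N.emeasure_eq_measure divide_ennreal flip: ennreal_mult)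
    qed (use sets in simp)
    with req show "r = measure \<mu> {None} \<and> \<nu> = uniform_measure \<mu> (- {None})" by blast
  next
    assume *: "r = measure \<mu> {None} \<and> \<nu> = uniform_measure \<mu> (- {None})"
    show "\<mu> = mixture r delta_inf \<nu>"
    proof (rule measure_eqI)
      fix A assume "A \<in> sets \<mu>"
      then have A: "A \<in> sets sphere_borel" by (simp add: sets)
      have I: "- {None} \<inter> A \<in> sets sphere_borel" "{None} \<inter> A \<in> sets sphere_borel"
        using A None by (auto intro: sets.Int)
      have "emeasure \<nu> A = emeasure \<mu> (- {None} \<inter> A) / ennreal (1 - r)"
        using * A None sets compl by simp
      then have "ennreal (1 - r) * emeasure \<nu> A = emeasure \<mu> (- {None} \<inter> A)"
        using r by (simp add: M.emeasure_eq_measure divide_ennreal flip: ennreal_mult)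
      moreover have "ennreal r * indicator A None = emeasure \<mu> ({None} \<inter> A)"
        using * by (auto simp: M.emeasure_eq_measure split: split_indicator)
      moreover have "emeasure \<mu> A = emeasure \<mu> ({None} \<inter> A) + emeasure \<mu> (- {None} \<inter> A)"
        using I sets by (subst plus_emeasure) (auto intro: arg_cong[where f = "emeasure \<mu>"])
      ultimately show "emeasure \<mu> A = emeasure (mixture r delta_inf \<nu>) A"
        by (simp add: mix A)
    qed (use sets in simp)
  qed
qed

lemma bij_moebius_to_inf: "bij (moebius_to_inf a)"
proof (cases a)
  case None
  then have "moebius_to_inf a = id" by auto
  then show ?thesis by (metis bij_id)
next
  case (Some c)
  have "inj (moebius_to_inf (Some c))"
  proof (rule injI)
    fix x y assume "moebius_to_inf (Some c) x = moebius_to_inf (Some c) y"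
    then show "x = y" by (cases x; cases y) (auto split: if_splits)
  qed
  moreover have "y \<in> range (moebius_to_inf (Some c))" for y
  proof (cases y)
    case None
    then show ?thesis by (intro image_eqI[of _ _ "Some c"]) auto
  next
    case (Some w)
    then show ?thesis
      by (intro image_eqI[of _ _ "if w = 0 then None else Some (c + 1 / w)"]) auto
  qed
  ultimately show ?thesis using Some by (auto simp: bij_def)
qed

lemma measurable_moebius_to_inf: "moebius_to_inf a \<in> sphere_borel \<rightarrow>\<^sub>M sphere_borel"
proof (cases a)
  case None
  then have "moebius_to_inf a = (\<lambda>x. x)" by auto
  then show ?thesis by simp
next
  case (Some c)
  show ?thesis
  proof (rule measurableI)
    fix A assume "A \<in> sets sphere_borel"
    then have [measurable]: "Some -` A \<in> sets borel" by (simp add: sets_sphere_borel_iff)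
    have "Some -` (moebius_to_inf a -` A) =
        (if None \<in> A then {c} else {}) \<union> {z. z \<noteq> c \<and> 1 / (z - c) \<in> Some -` A}"
      by (auto simp: Some split: if_splits)
    also have "\<dots> \<in> sets borel" by measurable
    finally show "moebius_to_inf a -` A \<inter> space sphere_borel \<in> sets sphere_borel"
      by (simp add: sets_sphere_borel_iff)
  qed simp
qed

lemma dual_times:
  fixes s t :: real
  assumes "s \<ge> 1" "t \<ge> 1"
  shows "\<exists>!(s', t'). s' \<ge> 1 \<and> t' \<ge> 1 \<and> s * t = s' * t' \<and> s + s' = 1 + s * t"
proof -
  define u where "u = 1 + s * t - s"
  have u: "u \<ge> 1" "u \<le> s * t"
    using assms mult_left_mono[of 1 t s] by (auto simp: u_def)
  then have "u * (s * t / u) = s * t" "s * t / u \<ge> 1" by simp_all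
  moreover have "s + u = 1 + s * t" by (simp add: u_def)
  moreover have "x = u \<and> y = s * t / u" if "s * t = x * y" "s + x = 1 + s * t" for x y
  proof
    show "x = u" using that by (simp add: u_def)
    then show "y = s * t / u" using that u by simp
  qed
  ultimately show ?thesis using u
    by (intro ex1I[of _ "(u, s * t / u)"]) auto
qed

end

theory Submission
  imports Defs "HOL-Complex_Analysis.Complex_Analysis" "HOL-Real_Asymp.Real_Asymp"
begin

text \<open>
  Write \<open>G\<close> for the Cauchy transform of a measure on the line and \<open>F = 1 / G\<close>. The theorem becomes
  transparent in terms of \<open>k(z) = z - F(z)\<close>, the conformal barycentre of the measure as seen from \<open>z\<close>. By
  subordination, the flow for the time \<open>t\<close> with base point infinity takes \<open>M\<close> to the measure \<open>N\<close> such
  that for every \<open>z\<close> in the upper half-plane there is a point \<open>W\<close> of the upper half-plane with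
  \<open>k\<^sub>M(W) = k\<^sub>N(z) = k\<close> and \<open>W - k = t (z - k)\<close>. So \<open>W\<close> is the image of \<open>z\<close> under the hyperbolic
  transformation with the fixed points \<open>k\<close> and infinity and the multiplier \<open>t\<close>. The barycentre is Moebius
  covariant (\<open>barycentre_Moebius\<close>). Therefore the flow with base point \<open>a\<close> has the same description,
  with \<open>a\<close> in the place of infinity. In the coordinate \<open>1 / (z - k)\<close> this transformation is a dilation by
  the factor \<open>1 / t\<close> whose centre depends on \<open>a\<close> and \<open>k\<close> only.

  A composition of two flows does not change \<open>k\<close> and composes the two dilations. The relations
  between \<open>s\<close>, \<open>t\<close>, \<open>s'\<close>, \<open>t'\<close> say precisely that the dilations with the centres of \<open>a\<close> and \<open>b\<close>
  compose to the same affine map in both orders. The points \<open>W\<close> are unique, so that the barycentre of \<open>N\<close>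
  at \<open>z\<close> is known as soon as one suitable \<open>W\<close> in the upper half-plane is exhibited. For the composition in
  the other order such a point exists by a convexity argument (\<open>dilated_point_exists\<close>). This gives equal
  barycentres (\<open>subordinate_commute\<close>), hence equal Cauchy transforms, and the measures agree by Stieltjes
  inversion (\<open>cauchy_unique\<close>). The compositions are defined and stay in the same class because the flows
  create no new atoms (\<open>flow_creates_no_atom\<close>).

  The analytic part is the existence of the fractional free convolution power with its subordination
  function. For \<open>0 \<le> c < 1\<close> the equation \<open>w - c F(w) = z\<close> has at most one solution in the upper half-plane, by the Pick
  inequality for \<open>F\<close>. It has one for every \<open>z\<close>, because the set of solvable \<open>z\<close> is open and closed
  (\<open>subordination_exists\<close>). The composition of \<open>G\<close> with the solution is again a Cauchy transform, by the
  Herglotz representation on the disc, carried over to the half-plane (\<open>cauchy_transform_criterion\<close>). An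
  analysis of \<open>G\<close> on cones near infinity identifies the resulting measure with the one that is defined by
  R-transforms (\<open>free_power_on_sphere\<close>).
\<close>

section \<open>Differentiation under the integral and the Cauchy--Schwarz inequality\<close>

lemma norm_integral_le_integral:
  fixes f :: "'a \<Rightarrow> 'b::{banach, second_countable_topology}"
  assumes "integrable M f" "integrable M g" "\<And>x. norm (f x) \<le> g x"
  shows "norm (LINT x|M. f x) \<le> (LINT x|M. g x)"
  using assms by (intro order_trans[OF integral_norm_bound] integral_mono) auto

text \<open>
  A remainder that is quadratic uniformly in the integration variable survives integration. The Cauchy
  kernel and the arc tangent of \<open>(b - x) / y\<close> have such remainders as functions of \<open>z\<close> and of \<open>b\<close>.
\<close>

lemma (in prob_space) has_field_derivative_integral_quadratic:
  fixes f :: "'b::{real_normed_field, banach, second_countable_topology} \<Rightarrow> 'a \<Rightarrow> 'b"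
  assumes e: "0 < e" and f: "\<And>z. dist z w < e \<Longrightarrow> integrable M (f z)" and f': "integrable M f'"
    and rem: "\<And>z x. dist z w < e \<Longrightarrow> norm (f z x - f w x - f' x * (z - w)) \<le> C * norm (z - w) ^ 2"
  shows "((\<lambda>z. LINT x|M. f z x) has_field_derivative (LINT x|M. f' x)) (at w)"
proof -
  have quad: "norm ((LINT x|M. f z x) - (LINT x|M. f w x) - (LINT x|M. f' x) * (z - w)) \<le> C * norm (z - w) ^ 2"
    if z: "dist z w < e" for z
  proof -
    have fw: "integrable M (f w)" using f[of w] e by simp
    have "(LINT x|M. f z x) - (LINT x|M. f w x) - (LINT x|M. f' x) * (z - w)
        = (LINT x|M. f z x - f w x - f' x * (z - w))"
      using f[OF z] fw f' by simp
    also have "norm \<dots> \<le> (LINT x|M. C * norm (z - w) ^ 2)"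
      using f[OF z] fw f' rem[OF z] by (intro norm_integral_le_integral) auto
    also have "\<dots> = C * norm (z - w) ^ 2" by (simp add: prob_space)
    finally show ?thesis .
  qed
  have C: "0 \<le> C * norm (z - w)" if "dist z w < e" "z \<noteq> w" for z
  proof -
    have "0 \<le> C * norm (z - w) ^ 2" using order_trans[OF norm_ge_zero quad[OF that(1)]] .
    then show ?thesis using that by (auto simp: zero_le_mult_iff)
  qed
  show ?thesis
    unfolding has_field_derivative_iff
  proof (rule Lim_transform_bound[where g="\<lambda>z. C * norm (z - w)", THEN Lim_null[THEN iffD2]], goal_cases)
    case 1
    have "\<forall>\<^sub>F z in at w. dist z w < e \<and> z \<noteq> w"
      using e by (auto simp: eventually_at)
    then show ?case
    proof eventually_elim
      case (elim z)
      then have nz: "norm (z - w) > 0" by auto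
      have "((LINT x|M. f z x) - (LINT x|M. f w x)) / (z - w) - (LINT x|M. f' x)
        = ((LINT x|M. f z x) - (LINT x|M. f w x) - (LINT x|M. f' x) * (z - w)) / (z - w)"
        using elim by (simp add: field_simps)
      then have "norm (((LINT x|M. f z x) - (LINT x|M. f w x)) / (z - w) - (LINT x|M. f' x))
         \<le> C * norm (z - w) ^ 2 / norm (z - w)"
        using quad[of z] elim nz by (simp add: norm_divide divide_right_mono)
      also have "\<dots> = C * norm (z - w)" using nz by (simp add: power2_eq_square)
      finally show ?case using C[of z] elim by simp
    qed
  next
    case 2
    have "((\<lambda>z. C * norm (z - w)) \<longlongrightarrow> C * norm (w - w)) (at w)" by (intro tendsto_intros)
    then show ?case by simp
  qed
qed

lemma (in finite_measure) integrable_bounded: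
  fixes f :: "'a \<Rightarrow> 'b::{banach,second_countable_topology}"
  shows "f \<in> borel_measurable M \<Longrightarrow> (\<And>x. norm (f x) \<le> B) \<Longrightarrow> integrable M f"
  by (rule integrable_const_bound[where B=B]) auto

lemma Cauchy_Schwarz_integral:
  fixes f g :: "'a \<Rightarrow> complex"
  assumes f: "integrable M (\<lambda>x. norm (f x) ^ 2)" and g: "integrable M (\<lambda>x. norm (g x) ^ 2)"
    and [measurable]: "f \<in> borel_measurable M" "g \<in> borel_measurable M"
  shows "norm (LINT x|M. f x * g x) ^ 2 \<le> (LINT x|M. norm (f x) ^ 2) * (LINT x|M. norm (g x) ^ 2)"
proof -
  have bd: "norm (f x) * norm (g x) \<le> norm (f x) ^ 2 + norm (g x) ^ 2" for x
    using sum_squares_bound[of "norm (f x)" "norm (g x)"]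
      mult_nonneg_nonneg[of "norm (f x)" "norm (g x)"] norm_ge_zero[of "f x"] norm_ge_zero[of "g x"]
    by linarith
  have fg: "integrable M (\<lambda>x. norm (f x) * norm (g x))"
    by (rule Bochner_Integration.integrable_bound[OF Bochner_Integration.integrable_add[OF f g]])
       (use bd in auto)
  have "ennreal ((LINT x|M. norm (f x) * norm (g x)) ^ 2) = (\<integral>\<^sup>+x. ennreal (norm (f x)) * ennreal (norm (g x)) \<partial>M)\<^sup>2"
    using fg by (simp add: nn_integral_eq_integral ennreal_power flip: ennreal_mult)
  also have "\<dots> \<le> (\<integral>\<^sup>+x. ennreal (norm (f x)) ^ 2 \<partial>M) * (\<integral>\<^sup>+x. ennreal (norm (g x)) ^ 2 \<partial>M)"
    by (intro Cauchy_Schwarz_nn_integral) auto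
  also have "\<dots> = ennreal ((LINT x|M. norm (f x) ^ 2) * (LINT x|M. norm (g x) ^ 2))"
    using f g by (simp add: nn_integral_eq_integral ennreal_mult ennreal_power)
  finally have *: "(LINT x|M. norm (f x) * norm (g x)) ^ 2 \<le> (LINT x|M. norm (f x) ^ 2) * (LINT x|M. norm (g x) ^ 2)"
    by (subst (asm) ennreal_le_iff) auto
  have "norm (LINT x|M. f x * g x) \<le> (LINT x|M. norm (f x) * norm (g x))"
    using integral_norm_bound[of M "\<lambda>x. f x * g x"] by (simp add: norm_mult)
  then have "norm (LINT x|M. f x * g x) ^ 2 \<le> (LINT x|M. norm (f x) * norm (g x)) ^ 2"
    by (intro power_mono) auto
  with * show ?thesis by linarith
qed


section \<open>The Cauchy transform of a measure on the real line\<close>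

abbreviation upper :: "complex set" where
  "upper \<equiv> {z. 0 < Im z}"

definition cauchy :: "real measure \<Rightarrow> complex \<Rightarrow> complex" where
  "cauchy M z = (LINT x|M. 1 / (z - complex_of_real x))"

text \<open>The reciprocal Cauchy transform, a self-map of the upper half-plane.\<close>

definition recip :: "real measure \<Rightarrow> complex \<Rightarrow> complex" where
  "recip M z = 1 / cauchy M z"

text \<open>The Poisson integral of \<open>M\<close>, up to the factor \<open>Im z / \<pi>\<close>.\<close>

definition poisson :: "real measure \<Rightarrow> complex \<Rightarrow> real" where
  "poisson M z = (LINT x|M. 1 / norm (z - complex_of_real x) ^ 2)"

lemma open_upper: "open upper" by (rule open_halfspace_Im_gt)

lemma connected_upper: "connected upper"
  by (rule convex_connected, rule convex_halfspace_Im_gt)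

lemma Im_le_norm_diff_of_real: "\<bar>Im z\<bar> \<le> norm (z - complex_of_real x)"
  using abs_Im_le_cmod[of "z - complex_of_real x"] by simp

lemma diff_of_real_nonzero: "Im z \<noteq> 0 \<Longrightarrow> z - complex_of_real x \<noteq> 0"
  by (metis Im_complex_of_real eq_iff_diff_eq_0)

lemma norm_kernel_le: "Im z \<noteq> 0 \<Longrightarrow> norm (1 / (z - complex_of_real x)) \<le> 1 / \<bar>Im z\<bar>"
  using Im_le_norm_diff_of_real[of z x]
  by (simp add: norm_divide frac_le)

context real_distribution
begin

lemma integrable_kernel: "Im z \<noteq> 0 \<Longrightarrow> integrable M (\<lambda>x. 1 / (z - complex_of_real x))"
  by (rule integrable_bounded[OF _ norm_kernel_le]) auto

lemma integrable_kernel_product: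
  assumes "Im z \<noteq> 0" "Im w \<noteq> 0"
  shows "integrable M (\<lambda>x. 1 / (z - complex_of_real x) * (1 / (w - complex_of_real x)))"
proof (rule integrable_bounded)
  show "norm (1 / (z - complex_of_real x) * (1 / (w - complex_of_real x))) \<le> 1 / \<bar>Im z\<bar> * (1 / \<bar>Im w\<bar>)" for x
    unfolding norm_mult using norm_kernel_le[OF assms(1)] norm_kernel_le[OF assms(2)]
    by (intro mult_mono) auto
qed auto

lemma integrable_poisson: "Im z \<noteq> 0 \<Longrightarrow> integrable M (\<lambda>x. 1 / norm (z - complex_of_real x) ^ 2)"
proof (rule integrable_bounded)
  assume z: "Im z \<noteq> 0"
  show "norm (1 / norm (z - complex_of_real x) ^ 2) \<le> (1 / \<bar>Im z\<bar>) ^ 2" for x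
    using power_mono[OF norm_kernel_le[OF z, of x], of 2] by (simp add: power_divide norm_divide)
qed auto

lemma poisson_pos: "Im z \<noteq> 0 \<Longrightarrow> 0 < poisson M z"
  unfolding poisson_def
  using integral_less_AE_space[of "\<lambda>x. 0" "\<lambda>x. 1 / norm (z - complex_of_real x) ^ 2"]
    integrable_poisson[of z] emeasure_space_1 diff_of_real_nonzero[of z]
  by simp

lemma Im_cauchy: "Im z \<noteq> 0 \<Longrightarrow> Im (cauchy M z) = - Im z * poisson M z"
proof -
  assume z: "Im z \<noteq> 0"
  have "Im (cauchy M z) = (LINT x|M. Im (1 / (z - complex_of_real x)))"
    unfolding cauchy_def using integrable_kernel[OF z] by (rule integral_Im[symmetric])
  also have "\<dots> = (LINT x|M. - Im z * (1 / norm (z - complex_of_real x) ^ 2))"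
    by (intro Bochner_Integration.integral_cong) (auto simp: Im_divide cmod_power2)
  finally show ?thesis by (simp only: integral_mult_right_zero poisson_def)
qed

lemma cauchy_nonzero: "Im z \<noteq> 0 \<Longrightarrow> cauchy M z \<noteq> 0"
  using Im_cauchy[of z] poisson_pos[of z] by auto

lemma cauchy_cnj: "cauchy M (cnj z) = cnj (cauchy M z)"
proof -
  have "cauchy M (cnj z) = (LINT x|M. cnj (1 / (z - complex_of_real x)))"
    unfolding cauchy_def by (intro Bochner_Integration.integral_cong) auto
  then show ?thesis by (simp only: Bochner_Integration.integral_cnj cauchy_def)
qed

lemma cauchy_diff:
  assumes "Im z \<noteq> 0" "Im w \<noteq> 0"
  shows "cauchy M z - cauchy M w
    = (w - z) * (LINT x|M. 1 / (z - complex_of_real x) * (1 / (w - complex_of_real x)))"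
proof -
  have "cauchy M z - cauchy M w = (LINT x|M. 1 / (z - complex_of_real x) - 1 / (w - complex_of_real x))"
    unfolding cauchy_def using integrable_kernel assms by simp
  also have "\<dots> = (LINT x|M. (w - z) * (1 / (z - complex_of_real x) * (1 / (w - complex_of_real x))))"
    using diff_of_real_nonzero[OF assms(1)] diff_of_real_nonzero[OF assms(2)]
    by (intro Bochner_Integration.integral_cong) (auto simp: divide_simps)
  finally show ?thesis by (simp only: integral_mult_right_zero)
qed

lemma norm_kernel_product_le:
  assumes "Im z \<noteq> 0" "Im w \<noteq> 0"
  shows "norm (LINT x|M. 1 / (z - complex_of_real x) * (1 / (w - complex_of_real x))) ^ 2
    \<le> poisson M z * poisson M w"
  using Cauchy_Schwarz_integral[of M "\<lambda>x. 1 / (z - complex_of_real x)" "\<lambda>x. 1 / (w - complex_of_real x)"]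
    integrable_poisson assms
  by (simp only: poisson_def norm_divide power_divide norm_one power_one) simp

lemma norm_cauchy_le:
  assumes "Im z \<noteq> 0"
  shows "norm (cauchy M z) ^ 2 \<le> poisson M z"
  using Cauchy_Schwarz_integral[of M "\<lambda>x. 1 / (z - complex_of_real x)" "\<lambda>x. 1"]
    integrable_poisson assms
  by (simp add: poisson_def norm_divide power_divide cauchy_def prob_space[simplified])

lemma has_field_derivative_cauchy:
  assumes z: "Im z \<noteq> 0"
  shows "(cauchy M has_field_derivative (LINT x|M. - ((1 / (z - complex_of_real x)) ^ 2))) (at z)"
  unfolding cauchy_def
proof (rule has_field_derivative_integral_quadratic)
  define e where "e = \<bar>Im z\<bar> / 2"
  show "0 < e" using z by (simp add: e_def)
  have Im_u: "e \<le> \<bar>Im u\<bar>" if "dist u z < e" for u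
    using abs_Im_le_cmod[of "u - z"] that by (simp add: dist_norm e_def)
  then show "integrable M (\<lambda>x. 1 / (u - complex_of_real x))" if "dist u z < e" for u
    using that \<open>0 < e\<close> by (intro integrable_kernel) force
  show "integrable M (\<lambda>x. - ((1 / (z - complex_of_real x)) ^ 2))"
    using integrable_kernel_product[OF z z] unfolding power2_eq_square by simp
  fix u x assume u: "dist u z < e"
  let ?a = "u - complex_of_real x" and ?b = "z - complex_of_real x"
  have nz: "?a \<noteq> 0" "?b \<noteq> 0" using Im_u[OF u] \<open>0 < e\<close> z by (auto intro!: diff_of_real_nonzero)
  have na: "norm (1 / ?a) \<le> 1 / e"
  proof -
    have "norm (1 / ?a) \<le> 1 / \<bar>Im u\<bar>" using Im_u[OF u] \<open>0 < e\<close> by (intro norm_kernel_le) auto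
    also have "\<dots> \<le> 1 / e" using Im_u[OF u] \<open>0 < e\<close> by (intro frac_le) auto
    finally show ?thesis .
  qed
  have nb: "norm (1 / ?b) ^ 2 \<le> (1 / \<bar>Im z\<bar>) ^ 2"
    using norm_kernel_le[OF z] by (intro power_mono) auto
  have "1 / ?a - 1 / ?b - - ((1 / ?b) ^ 2) * (u - z) = (u - z) ^ 2 * ((1 / ?a) * (1 / ?b) ^ 2)"
    using nz by (simp add: divide_simps) (simp add: algebra_simps power2_eq_square power3_eq_cube)
  also have "norm \<dots> = norm (u - z) ^ 2 * (norm (1 / ?a) * norm (1 / ?b) ^ 2)"
    by (simp only: norm_mult norm_power)
  also have "\<dots> \<le> norm (u - z) ^ 2 * (1 / e * (1 / \<bar>Im z\<bar>) ^ 2)"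
    using na nb \<open>0 < e\<close> by (intro mult_left_mono mult_mono) auto
  finally show "norm (1 / ?a - 1 / ?b - - ((1 / ?b) ^ 2) * (u - z)) \<le> (1 / e * (1 / \<bar>Im z\<bar>) ^ 2) * norm (u - z) ^ 2"
    by (simp add: mult.commute)
qed

lemma holomorphic_cauchy: "cauchy M holomorphic_on upper"
  unfolding holomorphic_on_def field_differentiable_def
  using has_field_derivative_cauchy by (metis mem_Collect_eq less_numeral_extra(3) has_field_derivative_at_within)

lemma holomorphic_recip: "recip M holomorphic_on upper"
  unfolding recip_def using cauchy_nonzero by (intro holomorphic_intros holomorphic_cauchy) auto

lemma Im_recip: "Im z \<noteq> 0 \<Longrightarrow> Im (recip M z) = Im z * poisson M z / norm (cauchy M z) ^ 2"
  by (simp add: recip_def Im_divide cmod_power2 Im_cauchy)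

lemma Im_recip_ge:
  assumes "0 < Im z"
  shows "Im z \<le> Im (recip M z)"
proof -
  have "Im z * 1 \<le> Im z * (poisson M z / norm (cauchy M z) ^ 2)"
    using norm_cauchy_le[of z] cauchy_nonzero[of z] assms by (intro mult_left_mono) (auto simp: divide_simps)
  then show ?thesis using assms by (simp add: Im_recip)
qed

text \<open>
  This is the Schwarz--Pick inequality for the self-map \<open>recip M\<close> of the upper half-plane. In terms of
  the Cauchy transform it is the Cauchy--Schwarz inequality for the kernels at \<open>z\<close> and \<open>w\<close>.
\<close>

lemma recip_pick:
  assumes z: "0 < Im z" and w: "0 < Im w"
  shows "norm (recip M z - recip M w) ^ 2
    \<le> norm (z - w) ^ 2 * (Im (recip M z) / Im z * (Im (recip M w) / Im w))"
proof -
  have nz: "Im z \<noteq> 0" "Im w \<noteq> 0" using z w by auto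
  define I where "I = (LINT x|M. 1 / (z - complex_of_real x) * (1 / (w - complex_of_real x)))"
  have "recip M z - recip M w = (z - w) * I / (cauchy M z * cauchy M w)"
    using cauchy_diff[OF nz, folded I_def] cauchy_nonzero nz
    by (simp add: recip_def field_simps)
  then have "norm (recip M z - recip M w) ^ 2
      = norm (z - w) ^ 2 * (norm I ^ 2 / (norm (cauchy M z) ^ 2 * norm (cauchy M w) ^ 2))"
    by (simp add: norm_mult norm_divide power_mult_distrib power_divide)
  also have "\<dots> \<le> norm (z - w) ^ 2 * (poisson M z * poisson M w / (norm (cauchy M z) ^ 2 * norm (cauchy M w) ^ 2))"
    using norm_kernel_product_le[OF nz, folded I_def] by (intro mult_left_mono divide_right_mono) auto
  finally show ?thesis using z w by (simp add: Im_recip field_simps)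
qed

end

section \<open>Subordination\<close>

context real_distribution
begin

text \<open>
  The free convolution power rests on the equation \<open>w - c F(w) = z\<close> with \<open>0 \<le> c < 1\<close>, to be solved for
  \<open>w\<close> in the upper half-plane. A solution satisfies \<open>c Im F(w) / Im w = 1 - Im z / Im w < 1\<close>, so the
  Pick inequality makes \<open>c F\<close> a strict contraction between two solutions. This gives uniqueness, and
  more: the solution is a locally Lipschitz function of \<open>z\<close>.
\<close>

lemma subordination_stable:
  assumes w: "0 < Im w\<^sub>1" "0 < Im w\<^sub>2" and c: "0 \<le> c"
    and z: "w\<^sub>1 - of_real c * recip M w\<^sub>1 = z\<^sub>1" "w\<^sub>2 - of_real c * recip M w\<^sub>2 = z\<^sub>2"
    and Im_z: "0 < Im z\<^sub>1" "0 < Im z\<^sub>2"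
  shows "norm (w\<^sub>1 - w\<^sub>2) * Im z\<^sub>1 \<le> 2 * norm (z\<^sub>1 - z\<^sub>2) * Im w\<^sub>1"
proof -
  \<comment> \<open>The squares of the factors by which the Pick inequality contracts; below, the geometric mean of
    \<open>A\<close> and \<open>B\<close> is replaced by the arithmetic mean.\<close>
  define A where "A = c * (Im (recip M w\<^sub>1) / Im w\<^sub>1)"
  define B where "B = c * (Im (recip M w\<^sub>2) / Im w\<^sub>2)"
  have A: "A = 1 - Im z\<^sub>1 / Im w\<^sub>1" and B: "B = 1 - Im z\<^sub>2 / Im w\<^sub>2"
    using w arg_cong[OF z(1), of Im] arg_cong[OF z(2), of Im] by (simp_all add: A_def B_def field_simps)
  have AB0: "0 \<le> A" "0 \<le> B"
    unfolding A_def B_def using Im_recip_ge[of w\<^sub>1] Im_recip_ge[of w\<^sub>2] w c by auto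
  let ?d = "norm (w\<^sub>1 - w\<^sub>2)"
  have "(c * norm (recip M w\<^sub>1 - recip M w\<^sub>2)) ^ 2 \<le> ?d ^ 2 * (A * B)"
    using mult_left_mono[OF recip_pick[OF w], of "c ^ 2"]
    by (simp add: A_def B_def power_mult_distrib power2_eq_square mult_ac)
  also have "\<dots> \<le> (?d * ((A + B) / 2)) ^ 2"
  proof -
    have "A * B \<le> ((A + B) / 2) ^ 2"
      using zero_le_power2[of "A - B"] by (simp add: power2_eq_square field_simps)
    then show ?thesis unfolding power_mult_distrib by (intro mult_left_mono) auto
  qed
  finally have 1: "c * norm (recip M w\<^sub>1 - recip M w\<^sub>2) \<le> ?d * ((A + B) / 2)"
    using AB0 by (intro power2_le_imp_le[of "c * _"]) auto
  have "w\<^sub>1 - w\<^sub>2 = (z\<^sub>1 - z\<^sub>2) + of_real c * (recip M w\<^sub>1 - recip M w\<^sub>2)"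
    using z by (auto simp: algebra_simps)
  then have "?d \<le> norm (z\<^sub>1 - z\<^sub>2) + norm (of_real c * (recip M w\<^sub>1 - recip M w\<^sub>2))"
    using norm_triangle_ineq by metis
  also have "\<dots> = norm (z\<^sub>1 - z\<^sub>2) + c * norm (recip M w\<^sub>1 - recip M w\<^sub>2)"
    using c by (simp add: norm_mult)
  finally have "?d * (1 - (A + B) / 2) \<le> norm (z\<^sub>1 - z\<^sub>2)"
    using 1 by (simp only: right_diff_distrib)
  moreover have "?d * (Im z\<^sub>1 / (2 * Im w\<^sub>1)) \<le> ?d * (1 - (A + B) / 2)"
  proof (intro mult_left_mono)
    have "0 \<le> Im z\<^sub>2 / Im w\<^sub>2" using w Im_z by auto
    then show "Im z\<^sub>1 / (2 * Im w\<^sub>1) \<le> 1 - (A + B) / 2"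
      unfolding A B by (simp add: field_simps)
  qed auto
  ultimately have "?d * (Im z\<^sub>1 / (2 * Im w\<^sub>1)) \<le> norm (z\<^sub>1 - z\<^sub>2)" by linarith
  then show ?thesis using w by (simp add: field_simps)
qed

lemma subordination_unique:
  assumes "0 < Im w\<^sub>1" "0 < Im w\<^sub>2" "0 \<le> c" "0 < Im z"
    and "w\<^sub>1 - of_real c * recip M w\<^sub>1 = z" "w\<^sub>2 - of_real c * recip M w\<^sub>2 = z"
  shows "w\<^sub>1 = w\<^sub>2"
proof -
  have "norm (w\<^sub>1 - w\<^sub>2) * Im z \<le> 0"
    using subordination_stable[of w\<^sub>1 w\<^sub>2 c z z] assms by simp
  then show ?thesis using assms(4) by (auto simp: mult_le_0_iff)
qed

text \<open>
  The set of all \<open>z\<close> for which the equation is solvable is open, because holomorphic maps are open, and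
  closed in the half-plane, because \<open>subordination_stable\<close> keeps the solutions bounded. The point \<open>w\<^sub>0\<close>
  shows that it is not empty.
\<close>

lemma subordination_exists:
  assumes c: "0 \<le> c" and w\<^sub>0: "0 < Im w\<^sub>0" "0 < Im (w\<^sub>0 - of_real c * recip M w\<^sub>0)"
  obtains \<Omega> where "\<Omega> holomorphic_on upper" "\<And>z. 0 < Im z \<Longrightarrow> 0 < Im (\<Omega> z)"
    "\<And>z. 0 < Im z \<Longrightarrow> \<Omega> z - of_real c * recip M (\<Omega> z) = z"
proof -
  define H where "H w = w - of_real c * recip M w" for w
  define D where "D = upper \<inter> H -` upper"
  have holH: "H holomorphic_on upper"
    unfolding H_def by (intro holomorphic_intros holomorphic_recip)
  then have contH: "continuous_on upper H" by (rule holomorphic_on_imp_continuous_on)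
  then have openD: "open D"
    unfolding D_def using open_upper by (metis continuous_on_open_vimage Int_commute)
  have holD: "H holomorphic_on D" using holH by (rule holomorphic_on_subset) (auto simp: D_def)
  have injD: "inj_on H D"
  proof (rule inj_onI)
    fix x y assume "x \<in> D" "y \<in> D" "H x = H y"
    then show "x = y"
      unfolding D_def using subordination_unique[of x y c "H y", folded H_def] c by blast
  qed
  have "open (H ` D)" by (rule open_mapping_thm3[OF holD openD injD])
  then have opn: "openin (top_of_set upper) (H ` D)"
    by (auto simp: D_def openin_open_eq[OF open_upper])
  have cls: "closedin (top_of_set upper) (H ` D)"
    unfolding closedin_closed
  proof (intro exI conjI)
    show "H ` D = upper \<inter> closure (H ` D)"
    proof (intro equalityI subsetI)
      fix l assume "l \<in> upper \<inter> closure (H ` D)"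
      then obtain x where "0 < Im l" "\<forall>n. x n \<in> H ` D" "x \<longlonglongrightarrow> l"
        by (auto simp: closure_sequential)
      then have l: "0 < Im l" and xl: "x \<longlonglongrightarrow> l" and "\<forall>n. \<exists>w\<in>D. x n = H w" by auto
      then obtain w where w: "\<And>n. w n \<in> D" "\<And>n. x n = H (w n)" by metis
      have Im_w: "0 < Im (w n)" and Im_x: "0 < Im (x n)" for n using w[of n] by (auto simp: D_def)
      have Im_le: "Im (x n) \<le> Im (w n)" for n
        using Im_recip_ge[OF Im_w, of n] Im_w[of n] c by (auto simp: w(2) H_def)
      obtain K where K: "\<And>n. norm (x n) \<le> K"
        using convergent_imp_Bseq[of x] xl by (auto simp: convergent_def Bseq_def)
      have "norm (w n) \<le> norm (w 0) + 4 * K * Im (w 0) / Im (x 0)" for n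
      proof -
        have "norm (w 0 - w n) * Im (x 0) \<le> 2 * norm (x 0 - x n) * Im (w 0)"
          using subordination_stable[of "w 0" "w n" c "x 0" "x n"] Im_w Im_x c w(2) by (simp add: H_def)
        also have "\<dots> \<le> 2 * (2 * K) * Im (w 0)"
          using norm_triangle_ineq4[of "x 0" "x n"] K[of 0] K[of n] Im_w[of 0]
          by (intro mult_right_mono mult_left_mono) auto
        finally have "norm (w 0 - w n) \<le> 4 * K * Im (w 0) / Im (x 0)"
          using Im_x[of 0] by (simp add: field_simps)
        moreover have "norm (w n) \<le> norm (w 0) + norm (w 0 - w n)"
          using norm_triangle_ineq4[of "w 0" "w 0 - w n"] by simp
        ultimately show ?thesis by linarith
      qed
      then have "bounded (range w)" by (auto simp: bounded_iff)
      then obtain w' r where r: "strict_mono r" "(w \<circ> r) \<longlonglongrightarrow> w'"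
        using bounded_imp_convergent_subsequence by blast
      have xr: "(\<lambda>n. x (r n)) \<longlonglongrightarrow> l"
        using LIMSEQ_subseq_LIMSEQ[OF xl r(1)] by (simp add: o_def)
      have "Im l \<le> Im w'"
        using tendsto_Im[OF xr] tendsto_Im[OF r(2)] Im_le
        by (intro LIMSEQ_le) (auto simp: o_def)
      then have w': "0 < Im w'" using l by simp
      have "isCont H w'"
        using contH open_upper w' by (simp add: continuous_on_eq_continuous_at)
      then have "(\<lambda>n. H (w (r n))) \<longlonglongrightarrow> H w'"
        using isCont_tendsto_compose r(2) by (auto simp: o_def)
      then have "H w' = l" using xr w(2) by (simp add: LIMSEQ_unique)
      then show "l \<in> H ` D" using w' l by (auto simp: D_def)
    qed (use closure_subset[of "H ` D"] in \<open>auto simp: D_def\<close>)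
  qed simp
  have "H w\<^sub>0 \<in> H ` D" using w\<^sub>0 by (auto simp: D_def H_def)
  then have HD: "H ` D = upper"
    using connected_upper[unfolded connected_clopen] opn cls by blast
  obtain \<Omega> where "\<Omega> holomorphic_on H ` D" "\<And>w. w \<in> D \<Longrightarrow> \<Omega> (H w) = w"
    using holomorphic_has_inverse[OF holD openD injD] by metis
  note \<Omega> = this[unfolded HD]
  show thesis
  proof (rule that)
    fix z assume "0 < Im z"
    then obtain w where "w \<in> D" "z = H w" using HD by blast
    then show "0 < Im (\<Omega> z)" "\<Omega> z - of_real c * recip M (\<Omega> z) = z"
      using \<Omega>(2)[of w] by (auto simp: D_def) (simp_all add: H_def)
  qed (fact \<Omega>(1))
qed

section \<open>Non-tangential asymptotics at infinity\<close>

lemma integral_min_tendsto_0: "((\<lambda>\<beta>. LINT x|M. min 1 (\<bar>x\<bar> / \<beta>)) \<longlongrightarrow> 0) at_top"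
proof -
  have "((\<lambda>\<beta>. LINT x|M. min 1 (\<bar>x\<bar> / \<beta>)) \<longlongrightarrow> (LINT x|M. 0)) at_top"
  proof (rule integral_dominated_convergence_at_top[where w="\<lambda>_. 1"])
    show "\<forall>\<^sub>F \<beta> in at_top. AE x in M. norm (min 1 (\<bar>x\<bar> / \<beta>)) \<le> 1"
      using eventually_gt_at_top[of 0] by eventually_elim auto
    show "AE x in M. ((\<lambda>\<beta>. min 1 (\<bar>x\<bar> / \<beta>)) \<longlongrightarrow> 0) at_top"
    proof (rule AE_I2)
      fix x :: real
      have "((\<lambda>\<beta>. \<bar>x\<bar> / \<beta>) \<longlongrightarrow> 0) at_top"
        by (intro tendsto_divide_0[OF tendsto_const] filterlim_at_top_imp_at_infinity filterlim_ident)
      from tendsto_min[OF tendsto_const[of 1] this]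
      show "((\<lambda>\<beta>. min 1 (\<bar>x\<bar> / \<beta>)) \<longlongrightarrow> 0) at_top" by simp
    qed
  qed auto
  then show ?thesis by simp
qed

text \<open>
  On a cone \<open>norm z \<le> C * Im z\<close> the quotient \<open>z / (z - x)\<close> is bounded by \<open>C\<close>, and it differs from \<open>1\<close> by
  at most \<open>\<bar>x\<bar> / Im z\<close>. Hence a product of two such quotients has an integral close to \<open>1\<close> high up in
  the cone. For one quotient this gives \<open>z G(z) \<approx> 1\<close>, for two it gives the injectivity of \<open>G\<close>.
\<close>

lemma cone_kernel_product:
  assumes \<epsilon>: "0 < \<epsilon>"
  obtains \<beta>\<^sub>0 where "0 < \<beta>\<^sub>0"
    "\<And>z w. \<lbrakk>\<beta>\<^sub>0 < Im z; \<beta>\<^sub>0 < Im w; norm z \<le> C * Im z; norm w \<le> C * Im w\<rbrakk> \<Longrightarrow>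
      norm ((LINT x|M. z / (z - complex_of_real x) * (w / (w - complex_of_real x))) - 1) \<le> \<epsilon>"
    "\<And>z. \<lbrakk>\<beta>\<^sub>0 < Im z; norm z \<le> C * Im z\<rbrakk> \<Longrightarrow> norm (z * cauchy M z - 1) \<le> \<epsilon>"
proof -
  define K where "K = (1 + \<bar>C\<bar>) ^ 2"
  have K: "0 < K" by (auto simp: K_def)
  have "\<forall>\<^sub>F \<beta> in at_top. (LINT x|M. min 1 (\<bar>x\<bar> / \<beta>)) < \<epsilon> / K"
    using integral_min_tendsto_0 \<epsilon> K by (intro order_tendstoD) auto
  moreover have "\<forall>\<^sub>F \<beta> in at_top. (0::real) < \<beta>" by (rule eventually_gt_at_top)
  ultimately have "\<forall>\<^sub>F \<beta> in at_top. (LINT x|M. min 1 (\<bar>x\<bar> / \<beta>)) < \<epsilon> / K \<and> 0 < \<beta>"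
    by eventually_elim auto
  then obtain \<beta>\<^sub>0 where \<beta>: "(LINT x|M. min 1 (\<bar>x\<bar> / \<beta>\<^sub>0)) < \<epsilon> / K" "0 < \<beta>\<^sub>0"
    unfolding eventually_at_top_linorder by blast
  let ?m = "\<lambda>x. min 1 (\<bar>x\<bar> / \<beta>\<^sub>0)"
  let ?q = "\<lambda>z x. z / (z - complex_of_real x)"
  have int_m: "integrable M ?m"
    using \<beta>(2) by (intro integrable_bounded[where B=1]) auto
  have bound: "(LINT x|M. K * ?m x) \<le> \<epsilon>"
    using \<beta>(1) K by (simp add: field_simps)
  have q: "norm (?q z x) \<le> \<bar>C\<bar>" "norm (?q z x - 1) \<le> (1 + \<bar>C\<bar>) * ?m x"
    if z: "\<beta>\<^sub>0 < Im z" "norm z \<le> C * Im z" for z x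
  proof -
    have Im_z: "0 < Im z" using z \<beta> by simp
    have nz: "z - complex_of_real x \<noteq> 0" using Im_z by (intro diff_of_real_nonzero) auto
    have le: "Im z \<le> norm (z - complex_of_real x)" using Im_le_norm_diff_of_real[of z x] by simp
    have "norm (?q z x) \<le> (C * Im z) / Im z"
      unfolding norm_divide using z le Im_z order_trans[OF norm_ge_zero z(2)] by (intro frac_le) auto
    then show 1: "norm (?q z x) \<le> \<bar>C\<bar>" using Im_z by simp
    have "?q z x - 1 = complex_of_real x / (z - complex_of_real x)" using nz by (simp add: field_simps)
    then have "norm (?q z x - 1) = \<bar>x\<bar> / norm (z - complex_of_real x)" by (simp add: norm_divide)
    also have "\<dots> \<le> \<bar>x\<bar> / \<beta>\<^sub>0" using le z \<beta> by (intro frac_le) auto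
    finally have "norm (?q z x - 1) \<le> \<bar>x\<bar> / \<beta>\<^sub>0" .
    moreover have "\<bar>x\<bar> / \<beta>\<^sub>0 \<le> (1 + \<bar>C\<bar>) * (\<bar>x\<bar> / \<beta>\<^sub>0)"
      using \<beta> mult_right_mono[of 1 "1 + \<bar>C\<bar>" "\<bar>x\<bar> / \<beta>\<^sub>0"] by simp
    moreover have "norm (?q z x - 1) \<le> 1 + \<bar>C\<bar>"
      using norm_triangle_ineq4[of "?q z x" 1] 1 by simp
    ultimately show "norm (?q z x - 1) \<le> (1 + \<bar>C\<bar>) * ?m x"
      by (auto simp: min_def)
  qed
  show thesis
  proof (rule that[OF \<beta>(2)])
    fix z w assume zw: "\<beta>\<^sub>0 < Im z" "\<beta>\<^sub>0 < Im w" "norm z \<le> C * Im z" "norm w \<le> C * Im w"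
    have int: "integrable M (\<lambda>x. ?q z x * ?q w x)"
    proof (rule integrable_bounded)
      show "norm (?q z x * ?q w x) \<le> \<bar>C\<bar> * \<bar>C\<bar>" for x
        unfolding norm_mult by (intro mult_mono q(1) zw) auto
    qed auto
    have "(LINT x|M. ?q z x * ?q w x) - 1 = (LINT x|M. ?q z x * ?q w x - 1)"
      using int prob_space by simp
    also have "norm \<dots> \<le> (LINT x|M. K * ?m x)"
    proof (rule norm_integral_le_integral)
      fix x
      have "?q z x * ?q w x - 1 = ?q z x * (?q w x - 1) + (?q z x - 1)" by (simp add: algebra_simps)
      then have "norm (?q z x * ?q w x - 1) \<le> norm (?q z x) * norm (?q w x - 1) + norm (?q z x - 1)"
        by (metis norm_triangle_ineq norm_mult)
      also have "\<dots> \<le> \<bar>C\<bar> * ((1 + \<bar>C\<bar>) * ?m x) + (1 + \<bar>C\<bar>) * ?m x"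
        using q[OF zw(1,3), of x] q[OF zw(2,4), of x] by (intro add_mono mult_mono) auto
      also have "\<dots> = K * ?m x" by (simp add: K_def power2_eq_square algebra_simps)
      finally show "norm (?q z x * ?q w x - 1) \<le> K * ?m x" .
    qed (use int int_m in auto)
    finally show "norm ((LINT x|M. ?q z x * ?q w x) - 1) \<le> \<epsilon>" using bound by linarith
  next
    fix z assume z: "\<beta>\<^sub>0 < Im z" "norm z \<le> C * Im z"
    have int: "integrable M (?q z)"
      using q(1)[OF z] by (intro integrable_bounded[where B="\<bar>C\<bar>"]) auto
    have "z * cauchy M z = (LINT x|M. z * (1 / (z - complex_of_real x)))"
      by (simp only: cauchy_def integral_mult_right_zero)
    then have "z * cauchy M z - 1 = (LINT x|M. ?q z x - 1)"
      using int prob_space by simp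
    also have "norm \<dots> \<le> (LINT x|M. K * ?m x)"
    proof (rule norm_integral_le_integral)
      fix x
      have "(1 + \<bar>C\<bar>) * ?m x \<le> K * ?m x"
        using \<beta> by (intro mult_right_mono) (auto simp: K_def power2_eq_square algebra_simps)
      then show "norm (?q z x - 1) \<le> K * ?m x" using q(2)[OF z, of x] by linarith
    qed (use int int_m in auto)
    finally show "norm (z * cauchy M z - 1) \<le> \<epsilon>" using bound by linarith
  qed
qed

lemma cone_recip:
  assumes "0 < \<epsilon>"
  obtains \<beta>\<^sub>0 where "0 < \<beta>\<^sub>0"
    "\<And>z. \<lbrakk>\<beta>\<^sub>0 < Im z; norm z \<le> C * Im z\<rbrakk> \<Longrightarrow> norm (recip M z - z) \<le> \<epsilon> * norm z"
proof -
  define \<delta> where "\<delta> = min (1/2) (\<epsilon> / 2)"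
  have \<delta>: "0 < \<delta>" "\<delta> \<le> 1/2" "2 * \<delta> \<le> \<epsilon>" using assms by (auto simp: \<delta>_def)
  obtain \<beta>\<^sub>0 where \<beta>: "0 < \<beta>\<^sub>0" "\<And>z. \<lbrakk>\<beta>\<^sub>0 < Im z; norm z \<le> C * Im z\<rbrakk> \<Longrightarrow> norm (z * cauchy M z - 1) \<le> \<delta>"
    using cone_kernel_product[OF \<delta>(1)] by metis
  show thesis
  proof (rule that[OF \<beta>(1)])
    fix z assume z: "\<beta>\<^sub>0 < Im z" "norm z \<le> C * Im z"
    let ?u = "z * cauchy M z"
    have u: "norm (?u - 1) \<le> \<delta>" by (rule \<beta>(2)[OF z])
    have nz: "cauchy M z \<noteq> 0" using z \<beta>(1) by (intro cauchy_nonzero) auto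
    have "1 - norm ?u \<le> norm (?u - 1)" using norm_triangle_ineq2[of 1 ?u] by (simp add: norm_minus_commute)
    then have half: "1/2 \<le> norm ?u" using u \<delta> by linarith
    have u0: "?u \<noteq> 0" using half by auto
    have "recip M z - z = - z * (?u - 1) / ?u" using nz u0 by (simp add: recip_def field_simps)
    then have "norm (recip M z - z) = norm z * (norm (?u - 1) / norm ?u)"
      by (simp add: norm_mult norm_divide)
    also have "\<dots> \<le> norm z * (\<delta> / (1/2))"
      using u half \<delta> by (intro mult_left_mono frac_le) auto
    also have "\<dots> \<le> norm z * \<epsilon>" using \<delta> by (intro mult_left_mono) auto
    finally show "norm (recip M z - z) \<le> \<epsilon> * norm z" by (simp add: mult.commute)
  qed
qed

end

section \<open>A measure on the line is determined by its Cauchy transform\<close>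

lemma arctan_remainder:
  fixes u v :: real
  shows "\<bar>arctan u - arctan v - (u - v) / (1 + v\<^sup>2)\<bar> \<le> (u - v)\<^sup>2"
proof -
  have "\<exists>\<xi>. \<bar>\<xi> - v\<bar> \<le> \<bar>u - v\<bar> \<and> arctan u - arctan v = (u - v) * inverse (1 + \<xi>\<^sup>2)"
  proof (cases u v rule: linorder_cases)
    case less
    from MVT2[OF less DERIV_arctan] obtain \<xi> where "u < \<xi>" "\<xi> < v"
      "arctan v - arctan u = (v - u) * inverse (1 + \<xi>\<^sup>2)" by blast
    then show ?thesis by (intro exI[of _ \<xi>]) (auto simp: algebra_simps)
  next
    case greater
    from MVT2[OF greater DERIV_arctan] obtain \<xi> where "v < \<xi>" "\<xi> < u"
      "arctan u - arctan v = (u - v) * inverse (1 + \<xi>\<^sup>2)" by blast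
    then show ?thesis by (intro exI[of _ \<xi>]) auto
  qed auto
  then obtain \<xi> where \<xi>: "\<bar>\<xi> - v\<bar> \<le> \<bar>u - v\<bar>" "arctan u - arctan v = (u - v) * inverse (1 + \<xi>\<^sup>2)"
    by blast
  let ?P = "(1 + \<xi>\<^sup>2) * (1 + v\<^sup>2)"
  have pos: "0 < 1 + \<xi>\<^sup>2" "0 < 1 + v\<^sup>2" by (auto intro: add_pos_nonneg)
  then have P: "0 < ?P" by (rule mult_pos_pos)
  have "\<bar>\<xi> + v\<bar> \<le> ?P"
  proof -
    have a: "2 * \<bar>\<xi>\<bar> \<le> 1 + \<xi>\<^sup>2" "2 * \<bar>v\<bar> \<le> 1 + v\<^sup>2"
      using sum_squares_bound[of 1 "\<bar>\<xi>\<bar>"] sum_squares_bound[of 1 "\<bar>v\<bar>"] by auto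
    have "?P = 1 + \<xi>\<^sup>2 + v\<^sup>2 + \<xi>\<^sup>2 * v\<^sup>2" by (simp add: algebra_simps)
    moreover have "0 \<le> \<xi>\<^sup>2 * v\<^sup>2" by simp
    moreover have "\<bar>\<xi> + v\<bar> \<le> \<bar>\<xi>\<bar> + \<bar>v\<bar>" by (rule abs_triangle_ineq)
    ultimately show ?thesis using a zero_le_power2[of \<xi>] zero_le_power2[of v] by linarith
  qed
  have "inverse (1 + \<xi>\<^sup>2) - 1 / (1 + v\<^sup>2) = (v - \<xi>) * ((\<xi> + v) / ?P)"
    using pos by (simp add: divide_simps) (simp add: algebra_simps power2_eq_square)
  then have "\<bar>inverse (1 + \<xi>\<^sup>2) - 1 / (1 + v\<^sup>2)\<bar> = \<bar>v - \<xi>\<bar> * (\<bar>\<xi> + v\<bar> / ?P)"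
    using abs_of_pos[OF P] by (simp only: abs_mult[of "v - \<xi>"] abs_divide)
  also have "\<dots> \<le> \<bar>u - v\<bar> * 1"
    using \<xi>(1) P \<open>\<bar>\<xi> + v\<bar> \<le> ?P\<close> by (intro mult_mono) auto
  finally have "\<bar>u - v\<bar> * \<bar>inverse (1 + \<xi>\<^sup>2) - 1 / (1 + v\<^sup>2)\<bar> \<le> \<bar>u - v\<bar> * \<bar>u - v\<bar>"
    by (intro mult_left_mono) auto
  moreover have "arctan u - arctan v - (u - v) / (1 + v\<^sup>2) = (u - v) * (inverse (1 + \<xi>\<^sup>2) - 1 / (1 + v\<^sup>2))"
    using \<xi>(2) by (simp add: algebra_simps)
  ultimately show ?thesis by (simp only: abs_mult) (simp add: power2_eq_square)
qed

lemma abs_arctan_le: "\<bar>arctan x\<bar> \<le> pi / 2"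
  using arctan_bounded[of x] unfolding abs_le_iff by linarith

lemma tendsto_arctan_scaled: "(\<lambda>n. arctan (c * real (Suc n))) \<longlonglongrightarrow> pi / 2 * sgn c"
proof (cases c "0::real" rule: linorder_cases)
  case less
  have "filterlim (\<lambda>n. c * real (Suc n)) at_bot sequentially"
    using less by real_asymp
  then show ?thesis using less
    by (auto intro: filterlim_compose[OF tendsto_arctan_at_bot])
next
  case greater
  have "filterlim (\<lambda>n. c * real (Suc n)) at_top sequentially"
    using greater by real_asymp
  then show ?thesis using greater
    by (auto intro: filterlim_compose[OF tendsto_arctan_at_top])
qed auto

context real_distribution
begin

text \<open>
  The function \<open>- Im (cauchy M (b + \<i> y))\<close> of \<open>b\<close> is the density of the convolution of \<open>M\<close> with a Cauchy
  law of scale \<open>y\<close>, up to a factor. Its primitive is the integral of an arc tangent, which tends to a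
  multiple of the integral of a sign as \<open>y\<close> tends to \<open>0\<close>.
\<close>

definition smoothed_cdf :: "real \<Rightarrow> real \<Rightarrow> real" where
  "smoothed_cdf y b = (LINT x|M. arctan ((b - x) / y))"

lemma has_field_derivative_smoothed_cdf:
  assumes y: "0 < y"
  shows "(smoothed_cdf y has_field_derivative - Im (cauchy M (Complex b y))) (at b)"
proof -
  have d: "1 / norm (Complex b y - complex_of_real x) ^ 2 = 1 / (y\<^sup>2 + (b - x)\<^sup>2)" for x
    by (simp add: cmod_power2 add.commute)
  have "((\<lambda>b. LINT x|M. arctan ((b - x) / y)) has_field_derivative
      (LINT x|M. y * (1 / norm (Complex b y - complex_of_real x) ^ 2))) (at b)"
  proof (rule has_field_derivative_integral_quadratic)
    show "(0::real) < 1" by simp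
    show "integrable M (\<lambda>x. arctan ((z - x) / y))" for z
      using abs_arctan_le by (intro integrable_bounded[where B="pi / 2"]) auto
    show "integrable M (\<lambda>x. y * (1 / norm (Complex b y - complex_of_real x) ^ 2))"
      using y by (intro integrable_mult_right integrable_poisson) auto
    fix z x
    let ?u = "(z - x) / y" and ?v = "(b - x) / y"
    have "?u - ?v = (z - b) / y" using y by (simp add: field_simps)
    moreover have "y * (1 / norm (Complex b y - complex_of_real x) ^ 2) * (z - b) = (?u - ?v) / (1 + ?v\<^sup>2)"
    proof -
      have "0 < y\<^sup>2 + (b - x)\<^sup>2" using y by (intro add_pos_nonneg) auto
      moreover have "1 + ?v\<^sup>2 = (y\<^sup>2 + (b - x)\<^sup>2) / y\<^sup>2" using y by (simp add: field_simps)
      ultimately show ?thesis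
        unfolding d \<open>?u - ?v = (z - b) / y\<close> using y by (simp add: power2_eq_square)
    qed
    ultimately show "norm (arctan ?u - arctan ?v - y * (1 / norm (Complex b y - complex_of_real x) ^ 2) * (z - b))
        \<le> 1 / y\<^sup>2 * norm (z - b) ^ 2"
      using arctan_remainder[of ?u ?v] by (simp add: power_divide)
  qed
  moreover have "(LINT x|M. y * (1 / norm (Complex b y - complex_of_real x) ^ 2)) = - Im (cauchy M (Complex b y))"
    using y by (simp only: integral_mult_right_zero) (simp add: Im_cauchy poisson_def)
  ultimately show ?thesis by (simp add: smoothed_cdf_def[abs_def])
qed

lemma smoothed_cdf_at_bot:
  assumes y: "0 < y"
  shows "(\<lambda>n. smoothed_cdf y (- real n)) \<longlonglongrightarrow> - (pi / 2)"
proof -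
  have "(\<lambda>n. smoothed_cdf y (- real n)) \<longlonglongrightarrow> (LINT x|M. - (pi / 2))"
    unfolding smoothed_cdf_def
  proof (rule integral_dominated_convergence[where w="\<lambda>_. pi / 2"])
    show "AE x in M. (\<lambda>n. arctan ((- real n - x) / y)) \<longlonglongrightarrow> - (pi / 2)"
    proof (rule AE_I2)
      fix x
      have "filterlim (\<lambda>n. (- real n - x) / y) at_bot sequentially" using y by real_asymp
      then show "(\<lambda>n. arctan ((- real n - x) / y)) \<longlonglongrightarrow> - (pi / 2)"
        by (rule filterlim_compose[OF tendsto_arctan_at_bot, simplified])
    qed
  qed (use abs_arctan_le in auto)
  then show ?thesis using prob_space by simp
qed

lemma smoothed_cdf_limit:
  "(\<lambda>n. smoothed_cdf (1 / real (Suc n)) b) \<longlonglongrightarrow> pi / 2 * (LINT x|M. sgn (b - x))"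
proof -
  have "(\<lambda>n. smoothed_cdf (1 / real (Suc n)) b) \<longlonglongrightarrow> (LINT x|M. pi / 2 * sgn (b - x))"
    unfolding smoothed_cdf_def
  proof (rule integral_dominated_convergence[where w="\<lambda>_. pi / 2"])
    show "AE x in M. (\<lambda>n. arctan ((b - x) / (1 / real (Suc n)))) \<longlonglongrightarrow> pi / 2 * sgn (b - x)"
      using tendsto_arctan_scaled by (simp del: of_nat_Suc)
  qed (use abs_arctan_le in auto)
  then show ?thesis by (simp only: integral_mult_right_zero)
qed

lemma sgn_integral_limit:
  "(\<lambda>n. LINT x|M. sgn (b + 1 / real (Suc n) - x)) \<longlonglongrightarrow> 2 * cdf M b - 1"
proof -
  have "(\<lambda>n. LINT x|M. sgn (b + 1 / real (Suc n) - x)) \<longlonglongrightarrow> (LINT x|M. 2 * indicator {..b} x - 1)"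
  proof (rule integral_dominated_convergence[where w="\<lambda>_. 1"])
    show "AE x in M. (\<lambda>n. sgn (b + 1 / real (Suc n) - x)) \<longlonglongrightarrow> 2 * indicator {..b} x - 1"
    proof (rule AE_I2)
      fix x
      have lim: "(\<lambda>n. b + 1 / real (Suc n) - x) \<longlonglongrightarrow> b - x" by real_asymp
      show "(\<lambda>n. sgn (b + 1 / real (Suc n) - x)) \<longlonglongrightarrow> 2 * indicator {..b} x - 1"
      proof (cases "x \<le> b")
        case True
        then have "0 < b + 1 / real (Suc n) - x" for n
          using divide_pos_pos[of 1 "real (Suc n)"] by linarith
        then show ?thesis using True by simp
      next
        case False
        then have "\<forall>\<^sub>F n in sequentially. b + 1 / real (Suc n) - x < 0"
          using order_tendstoD(2)[OF lim, of 0] by simp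
        then have "\<forall>\<^sub>F n in sequentially. sgn (b + 1 / real (Suc n) - x) = - 1"
          by eventually_elim simp
        then show ?thesis using False by (simp add: tendsto_eventually)
      qed
    qed
  qed (auto simp: sgn_real_def)
  also have "(LINT x|M. 2 * indicator {..b} x - 1) = 2 * cdf M b - 1"
    using prob_space by (subst Bochner_Integration.integral_diff) (auto simp: cdf_def less_top[symmetric])
  finally show ?thesis .
qed

end

text \<open>
  Equal Cauchy transforms give the smoothed distribution functions the same derivative. They also have
  the same limit at \<open>- \<infinity>\<close>, so they agree, and so do the limits as the smoothing disappears.
\<close>

theorem cauchy_unique:
  assumes M: "real_distribution M" and N: "real_distribution N"
    and eq: "\<And>z. 0 < Im z \<Longrightarrow> cauchy M z = cauchy N z"
  shows "M = N"
proof -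
  interpret M: real_distribution M by fact
  interpret N: real_distribution N by fact
  have smoothed: "M.smoothed_cdf y b = N.smoothed_cdf y b" if y: "0 < y" for y b
  proof -
    define D where "D b = M.smoothed_cdf y b - N.smoothed_cdf y b" for b
    have "(D has_field_derivative 0) (at b)" for b
      unfolding D_def
      using DERIV_diff[OF M.has_field_derivative_smoothed_cdf[OF y, of b] N.has_field_derivative_smoothed_cdf[OF y, of b]]
        eq[of "Complex b y"] y by simp
    then have const: "D b = D b'" for b b' by (intro DERIV_isconst_all) auto
    have "(\<lambda>n. D (- real n)) \<longlonglongrightarrow> - (pi / 2) - - (pi / 2)"
      unfolding D_def by (intro tendsto_diff M.smoothed_cdf_at_bot N.smoothed_cdf_at_bot y)
    moreover have "(\<lambda>n. D (- real n)) = (\<lambda>n. D b)" using const by auto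
    ultimately have "D b = 0" by (simp add: LIMSEQ_const_iff)
    then show ?thesis by (simp add: D_def)
  qed
  have sgn: "(LINT x|M. sgn (b - x)) = (LINT x|N. sgn (b - x))" for b
  proof -
    have "pi / 2 * (LINT x|M. sgn (b - x)) = pi / 2 * (LINT x|N. sgn (b - x))"
    proof (rule LIMSEQ_unique[OF M.smoothed_cdf_limit])
      have "(\<lambda>n. M.smoothed_cdf (1 / real (Suc n)) b) = (\<lambda>n. N.smoothed_cdf (1 / real (Suc n)) b)"
        using smoothed by auto
      then show "(\<lambda>n. M.smoothed_cdf (1 / real (Suc n)) b) \<longlonglongrightarrow> pi / 2 * (LINT x|N. sgn (b - x))"
        using N.smoothed_cdf_limit[of b] by simp
    qed
    then show ?thesis by simp
  qed
  have "cdf M b = cdf N b" for b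
    using LIMSEQ_unique[OF M.sgn_integral_limit N.sgn_integral_limit[of b, folded sgn]] by simp
  then show ?thesis using cdf_unique[OF M N] by blast
qed

section \<open>The Herglotz representation on the disc\<close>

definition unit_circle :: "real \<Rightarrow> complex" where
  "unit_circle t = exp (2 * of_real pi * \<i> * of_real t)"

lemma norm_unit_circle [simp]: "norm (unit_circle t) = 1"
  by (simp add: unit_circle_def)

lemma unit_circle_nonzero [simp]: "unit_circle t \<noteq> 0"
  by (simp add: unit_circle_def)

lemma unit_circle_cnj: "unit_circle t * cnj (unit_circle t) = 1"
  by (simp add: complex_norm_square[symmetric])

lemma continuous_on_unit_circle [continuous_intros]:
  "continuous_on A f \<Longrightarrow> continuous_on A (\<lambda>t. unit_circle (f t))"
  unfolding unit_circle_def by (intro continuous_intros)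

lemma measurable_unit_circle [measurable]: "unit_circle \<in> borel_measurable borel"
  by (intro borel_measurable_continuous_onI continuous_intros)

lemma unit_circle_diff_nonzero: "norm w < 1 \<Longrightarrow> unit_circle t - w \<noteq> 0"
  using norm_unit_circle[of t] by auto

lemma Cauchy_integral_unit_circle:
  assumes "continuous_on (cball 0 1) f" "f holomorphic_on ball 0 1" and w: "norm w < 1"
  shows "((\<lambda>t. f (unit_circle t) * (unit_circle t / (unit_circle t - w))) has_integral f w) {0..1}"
proof -
  have int: "((\<lambda>u. f u / (u - w)) has_contour_integral (2 * of_real pi * \<i> * f w)) (circlepath 0 1)"
    using assms by (intro Cauchy_integral_circlepath) auto
  have path: "circlepath 0 1 t = unit_circle t" for t
    by (simp add: circlepath unit_circle_def)
  have vd: "vector_derivative (circlepath 0 1) (at t within {0..1}) = 2 * of_real pi * \<i> * unit_circle t"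
    if "t \<in> {0..1}" for t
    using that by (simp add: vector_derivative_circlepath01 unit_circle_def)
  have "((\<lambda>t. f (unit_circle t) / (unit_circle t - w) * (2 * of_real pi * \<i> * unit_circle t))
      has_integral (2 * of_real pi * \<i> * f w)) {0..1}"
    by (rule has_integral_eq[rotated, OF int[unfolded has_contour_integral_def]]) (simp only: path vd)
  then have "((\<lambda>t. 1 / (2 * of_real pi * \<i>) *
        (f (unit_circle t) / (unit_circle t - w) * (2 * of_real pi * \<i> * unit_circle t)))
      has_integral 1 / (2 * of_real pi * \<i>) * (2 * of_real pi * \<i> * f w)) {0..1}"
    by (rule has_integral_mult_right)
  then show ?thesis by (simp add: field_simps)
qed

text \<open>
  The Schwarz formula. It is the Cauchy formula for \<open>f\<close>, together with the same integral for the
  conjugate of \<open>f\<close>, which only sees the value of \<open>f\<close> at the centre.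
\<close>

lemma Schwarz_integral_unit_circle:
  assumes f: "continuous_on (cball 0 1) f" "f holomorphic_on ball 0 1" and w: "norm w < 1"
  shows "((\<lambda>t. of_real (Re (f (unit_circle t))) * ((unit_circle t + w) / (unit_circle t - w)))
    has_integral f w - \<i> * of_real (Im (f 0))) {0..1}"
proof -
  let ?e = unit_circle
  have 1: "((\<lambda>t. f (?e t) * (?e t / (?e t - w))) has_integral f w) {0..1}"
    using Cauchy_integral_unit_circle[OF f w] .
  have 0: "((\<lambda>t. f (?e t)) has_integral f 0) {0..1}"
    using Cauchy_integral_unit_circle[OF f, of 0] by simp
  have nz: "1 - cnj w * u \<noteq> 0" if "norm u \<le> 1" for u
  proof
    assume "1 - cnj w * u = 0"
    then have "norm w * norm u = 1" by (metis complex_mod_cnj eq_iff_diff_eq_0 norm_mult norm_one)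
    moreover have "norm w * norm u \<le> norm w" using that by (simp add: mult_left_le)
    ultimately show False using w by simp
  qed
  have "continuous_on (cball 0 1) (\<lambda>u. f u / (1 - cnj w * u))"
    using nz by (intro continuous_intros f) auto
  moreover have "(\<lambda>u. f u / (1 - cnj w * u)) holomorphic_on ball 0 1"
  proof (intro holomorphic_intros f)
    show "1 - cnj w * u \<noteq> 0" if "u \<in> ball 0 1" for u using that by (intro nz) simp
  qed
  ultimately have "((\<lambda>t. f (?e t) / (1 - cnj w * ?e t)) has_integral f 0) {0..1}"
    using Cauchy_integral_unit_circle[of "\<lambda>u. f u / (1 - cnj w * u)" 0] by simp
  then have "(cnj \<circ> (\<lambda>t. f (?e t) / (1 - cnj w * ?e t)) has_integral cnj (f 0)) {0..1}"
    by (simp only: has_integral_cnj)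
  then have 2: "((\<lambda>t. cnj (f (?e t)) * (?e t / (?e t - w))) has_integral cnj (f 0)) {0..1}"
  proof (rule has_integral_eq[rotated])
    fix t
    have "?e t - w = ?e t * (1 - w * cnj (?e t))"
      using unit_circle_cnj[of t] by (simp add: algebra_simps)
    then have "?e t / (?e t - w) = 1 / (1 - w * cnj (?e t))" by simp
    then show "(cnj \<circ> (\<lambda>t. f (?e t) / (1 - cnj w * ?e t))) t = cnj (f (?e t)) * (?e t / (?e t - w))"
      by simp
  qed
  have 3: "((\<lambda>t. (f (?e t) + cnj (f (?e t))) / 2) has_integral (f 0 + cnj (f 0)) / 2) {0..1}"
    using has_integral_divide[OF has_integral_add[OF 0 has_integral_cnj[THEN iffD2, OF 0]], of 2]
    by (simp add: o_def)
  have "((\<lambda>t. f (?e t) * (?e t / (?e t - w)) + cnj (f (?e t)) * (?e t / (?e t - w))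
      - (f (?e t) + cnj (f (?e t))) / 2) has_integral f w + cnj (f 0) - (f 0 + cnj (f 0)) / 2) {0..1}"
    by (intro has_integral_add has_integral_diff 1 2 3)
  moreover have "f (?e t) * (?e t / (?e t - w)) + cnj (f (?e t)) * (?e t / (?e t - w))
      - (f (?e t) + cnj (f (?e t))) / 2 = of_real (Re (f (?e t))) * ((?e t + w) / (?e t - w))" for t
  proof -
    have 1: "f (?e t) + cnj (f (?e t)) = 2 * of_real (Re (f (?e t)))" by (simp add: complex_add_cnj)
    have 2: "(?e t + w) / (?e t - w) = 2 * (?e t / (?e t - w)) - 1"
      using unit_circle_diff_nonzero[OF w, of t] by (simp add: field_simps)
    have 3: "a * q + b * q - (a + b) / 2 = (a + b) / 2 * (2 * q - 1)" for a b q :: complex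
      by (simp add: field_simps)
    show ?thesis by (subst 3, subst 1, subst 2) simp
  qed
  moreover have "f w + cnj (f 0) - (f 0 + cnj (f 0)) / 2 = f w - \<i> * of_real (Im (f 0))"
    by (simp add: complex_eq_iff)
  ultimately show ?thesis by simp
qed

lemma norm_Schwarz_kernel_le:
  assumes w: "norm w < 1"
  shows "norm ((unit_circle t + w) / (unit_circle t - w)) \<le> 2 / (1 - norm w)"
proof -
  have "norm (unit_circle t + w) \<le> 2" using norm_triangle_ineq[of "unit_circle t" w] w by simp
  moreover have "1 - norm w \<le> norm (unit_circle t - w)" using norm_triangle_ineq2[of "unit_circle t" w] by simp
  ultimately show ?thesis unfolding norm_divide using w by (intro frac_le) auto
qed

text \<open>
  On the circles of radius \<open>\<rho> < 1\<close> the representing measure has the normalised real part of \<open>h\<close> as its density.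
  Parametrised by the unit interval these measures are tight, so Helly's theorem yields a limit.
\<close>

lemma Herglotz_disc:
  assumes h: "h holomorphic_on ball 0 1" and Re_h: "\<And>w. norm w < 1 \<Longrightarrow> 0 \<le> Re (h w)" and Re_h0: "0 < Re (h 0)"
  obtains m where "real_distribution m"
    "\<And>w. norm w < 1 \<Longrightarrow> h w = of_real (Re (h 0)) * (LINT t|m. (unit_circle t + w) / (unit_circle t - w)) + \<i> * of_real (Im (h 0))"
proof -
  let ?K = "\<lambda>w t. (unit_circle t + w) / (unit_circle t - w)"
  define \<rho> where "\<rho> n = 1 - 1 / real (n + 2)" for n :: nat
  have \<rho>: "0 < \<rho> n" "\<rho> n < 1" for n by (auto simp: \<rho>_def)
  have \<rho>_lim: "\<rho> \<longlonglongrightarrow> 1" unfolding \<rho>_def by real_asymp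
  define d where "d n t = indicator {0..1} t * (Re (h (of_real (\<rho> n) * unit_circle t)) / Re (h 0))" for n t
  have in_ball: "norm (of_real (\<rho> n) * u) < 1" if "norm u \<le> 1" for n and u :: complex
  proof -
    have "norm (of_real (\<rho> n) * u) = \<rho> n * norm u" using \<rho>[of n] by (simp add: norm_mult)
    also have "\<dots> \<le> \<rho> n * 1" using that \<rho>[of n] by (intro mult_left_mono) auto
    finally show ?thesis using \<rho>(2)[of n] by simp
  qed
  have cont_h: "continuous_on A (\<lambda>u. h (of_real (\<rho> n) * u))" if "A \<subseteq> cball 0 1" for n A
    using that in_ball
    by (intro continuous_on_compose2[OF holomorphic_on_imp_continuous_on[OF h]] continuous_intros) auto
  have hol_h: "(\<lambda>u. h (of_real (\<rho> n) * u)) holomorphic_on ball 0 1" for n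
    using in_ball by (intro holomorphic_on_compose_gen[OF _ h, unfolded o_def] holomorphic_intros) auto
  have cont_d: "continuous_on {0..1} (\<lambda>t. Re (h (of_real (\<rho> n) * unit_circle t)) / Re (h 0))" for n
    using Re_h0
    by (intro continuous_intros continuous_on_compose2[OF cont_h[OF order_refl]]) auto
  have meas_d [measurable]: "d n \<in> borel_measurable borel" for n
    unfolding d_def[abs_def] using borel_measurable_continuous_on_indicator[OF _ cont_d[of n]] by simp
  have d_nonneg: "0 \<le> d n t" for n t
    using Re_h[OF in_ball] Re_h0 by (auto simp: d_def indicator_def)
  define m where "m n = density lborel (\<lambda>t. ennreal (d n t))" for n
  have sets_m [measurable_cong, simp]: "sets (m n) = sets borel" for n by (simp add: m_def)
  have int_d: "integrable lborel (\<lambda>t. d n t *\<^sub>R ?K w t)"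
    "(LINT t|lborel. d n t *\<^sub>R ?K w t) = (h (of_real (\<rho> n) * w) - \<i> * of_real (Im (h 0))) / of_real (Re (h 0))"
    if w: "norm w < 1" for n w
  proof -
    let ?F = "\<lambda>t. (Re (h (of_real (\<rho> n) * unit_circle t)) / Re (h 0)) *\<^sub>R ?K w t"
    have contF: "continuous_on {0..1} ?F"
      using unit_circle_diff_nonzero[OF w] by (intro continuous_intros cont_d) auto
    have eq: "d n t *\<^sub>R ?K w t = indicator {0..1} t *\<^sub>R ?F t" for t
      by (simp add: d_def)
    have setint: "set_integrable lborel {0..1} ?F"
      unfolding set_integrable_def by (rule borel_integrable_compact[OF _ contF]) auto
    then show "integrable lborel (\<lambda>t. d n t *\<^sub>R ?K w t)"
      unfolding eq by (simp add: set_integrable_def)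
    have "(?F has_integral (h (of_real (\<rho> n) * w) - \<i> * of_real (Im (h (of_real (\<rho> n) * 0)))) / of_real (Re (h 0))) {0..1}"
      using has_integral_divide[OF Schwarz_integral_unit_circle[OF cont_h[OF order_refl] hol_h w, of n], of "of_real (Re (h 0))"]
      by (simp add: scaleR_conv_of_real mult_ac)
    moreover have "(LINT t:{0..1}|lborel. ?F t) = integral {0..1} ?F"
      using set_borel_integral_eq_integral[OF setint] by simp
    ultimately show "(LINT t|lborel. d n t *\<^sub>R ?K w t) = (h (of_real (\<rho> n) * w) - \<i> * of_real (Im (h 0))) / of_real (Re (h 0))"
      unfolding eq by (simp add: set_lebesgue_integral_def integral_unique)
  qed
  have int_m: "(LINT t|m n. ?K w t) = (h (of_real (\<rho> n) * w) - \<i> * of_real (Im (h 0))) / of_real (Re (h 0))"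
    if w: "norm w < 1" for n w
  proof -
    have "(LINT t|m n. ?K w t) = (LINT t|lborel. d n t *\<^sub>R ?K w t)"
      unfolding m_def using d_nonneg by (subst integral_density) auto
    then show ?thesis using int_d(2)[OF w] by simp
  qed
  have K0: "d n t *\<^sub>R ?K 0 t = complex_of_real (d n t)" for n t by (simp add: scaleR_conv_of_real)
  have total: "(\<integral>\<^sup>+t. ennreal (d n t) \<partial>lborel) = 1" for n
  proof -
    have c: "integrable lborel (\<lambda>t. complex_of_real (d n t))"
      "(LINT t|lborel. complex_of_real (d n t)) = 1"
      using int_d[of 0 n] Re_h0 unfolding K0 by (auto simp: complex_eq_iff)
    have i: "integrable lborel (d n)"
      using integrable_Re[OF c(1)] by simp
    then have "complex_of_real (LINT t|lborel. d n t) = 1"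
      using c by (simp only: integral_complex_of_real)
    then have "(LINT t|lborel. d n t) = 1" by (metis of_real_eq_1_iff)
    then show ?thesis using i d_nonneg by (subst nn_integral_eq_integral) auto
  qed
  have dist_m: "real_distribution (m n)" for n
  proof -
    have "emeasure (m n) (space (m n)) = 1"
      using total[of n] by (simp add: m_def emeasure_density)
    then interpret prob_space "m n" by (rule prob_spaceI)
    show ?thesis by unfold_locales simp
  qed
  have "tight m"
    unfolding tight_def
  proof (intro conjI allI impI exI)
    show "real_distribution (m n)" for n by (rule dist_m)
    fix \<epsilon> :: real assume "0 < \<epsilon>"
    show "(-1::real) < 1" by simp
    fix n
    interpret real_distribution "m n" by (rule dist_m)
    have "emeasure (m n) {-1<..1} = (\<integral>\<^sup>+t. ennreal (d n t) * indicator {-1<..1} t \<partial>lborel)"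
      by (simp add: m_def emeasure_density)
    also have "\<dots> = (\<integral>\<^sup>+t. ennreal (d n t) \<partial>lborel)"
      by (intro nn_integral_cong) (auto simp: d_def indicator_def)
    finally have "measure (m n) {-1<..1} = 1" using total by (simp add: measure_def)
    then show "1 - \<epsilon> < measure (m n) {-1<..1}" using \<open>0 < \<epsilon>\<close> by simp
  qed
  then obtain r m' where r: "strict_mono r" and m': "real_distribution m'"
    and conv: "weak_conv_m (m \<circ> id \<circ> r) m'"
    using tight_imp_convergent_subsubsequence[of m id] strict_mono_id by metis
  show thesis
  proof (rule that[OF m'])
    fix w :: complex assume w: "norm w < 1"
    have "(\<lambda>n. integral\<^sup>L ((m \<circ> id \<circ> r) n) (?K w)) \<longlonglongrightarrow> integral\<^sup>L m' (?K w)"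
    proof (rule weak_conv_imp_integral_bdd_continuous_conv[OF _ m' conv])
      show "real_distribution ((m \<circ> id \<circ> r) n)" for n using dist_m by simp
      show "isCont (?K w) t" for t
      proof -
        have "continuous_on UNIV (?K w)"
          using unit_circle_diff_nonzero[OF w] by (intro continuous_intros) auto
        then show ?thesis by (simp add: continuous_on_eq_continuous_at)
      qed
      show "norm (?K w t) \<le> 2 / (1 - norm w)" for t by (rule norm_Schwarz_kernel_le[OF w])
    qed
    then have 1: "(\<lambda>n. (h (of_real (\<rho> (r n)) * w) - \<i> * of_real (Im (h 0))) / of_real (Re (h 0))) \<longlonglongrightarrow> integral\<^sup>L m' (?K w)"
      using int_m[OF w] by simp
    have "(\<lambda>n. \<rho> (r n)) \<longlonglongrightarrow> 1"
      using LIMSEQ_subseq_LIMSEQ[OF \<rho>_lim r] by (simp add: o_def)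
    then have lim: "(\<lambda>n. of_real (\<rho> (r n)) * w) \<longlonglongrightarrow> of_real 1 * w"
      by (intro tendsto_intros)
    have "isCont h w"
      using holomorphic_on_imp_continuous_on[OF h] w by (simp add: continuous_on_eq_continuous_at)
    then have "(\<lambda>n. h (of_real (\<rho> (r n)) * w)) \<longlonglongrightarrow> h w"
      using isCont_tendsto_compose[of w h] lim by simp
    then have 2: "(\<lambda>n. (h (of_real (\<rho> (r n)) * w) - \<i> * of_real (Im (h 0))) / of_real (Re (h 0)))
        \<longlonglongrightarrow> (h w - \<i> * of_real (Im (h 0))) / of_real (Re (h 0))"
      using Re_h0 by (intro tendsto_intros) auto
    have "integral\<^sup>L m' (?K w) = (h w - \<i> * of_real (Im (h 0))) / of_real (Re (h 0))"
      by (rule LIMSEQ_unique[OF 1 2])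
    then show "h w = of_real (Re (h 0)) * integral\<^sup>L m' (?K w) + \<i> * of_real (Im (h 0))"
      using Re_h0 by (simp add: field_simps)
  qed
qed

section \<open>Recognising Cauchy transforms\<close>

text \<open>
  The Cayley transform \<open>w \<mapsto> \<i> (1 + w) / (1 - w)\<close> maps the disc to the upper half-plane and the circle to
  the extended line. At the point \<open>1\<close> of the circle, which corresponds to infinity, \<open>line_point\<close> has the
  default value \<open>0\<close>.
\<close>

definition line_point :: "real \<Rightarrow> real" where
  "line_point t = Re (\<i> * (1 + unit_circle t) / (1 - unit_circle t))"

lemma measurable_line_point [measurable]: "line_point \<in> borel_measurable borel"
  unfolding line_point_def[abs_def] by measurable

lemma line_point:
  assumes "unit_circle t \<noteq> 1"
  shows "of_real (line_point t) = \<i> * (1 + unit_circle t) / (1 - unit_circle t)"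
proof -
  let ?e = "unit_circle t" and ?v = "\<i> * (1 + unit_circle t) / (1 - unit_circle t)"
  have nz: "1 - ?e \<noteq> 0" "?e - 1 \<noteq> 0" using assms by auto
  have "cnj ?e = 1 / ?e" using unit_circle_cnj[of t] by (simp add: field_simps)
  then have "cnj ?v = - \<i> * ((1 + 1 / ?e) / (1 - 1 / ?e))" by simp
  also have "(1 + 1 / ?e) / (1 - 1 / ?e) = (?e + 1) / (?e - 1)"
    using nz by (simp add: divide_simps)
  also have "- \<i> * ((?e + 1) / (?e - 1)) = ?v" using nz by (simp add: divide_simps) (simp add: algebra_simps)
  finally have "Im ?v = 0" by (simp only: complex_is_Real_iff[symmetric] Reals_cnj_iff)
  then show ?thesis by (simp add: line_point_def complex_eq_iff)
qed

definition disc_point :: "complex \<Rightarrow> complex" where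
  "disc_point z = (z - \<i>) / (z + \<i>)"

lemma plus_i_nonzero: "0 < Im z \<Longrightarrow> z + \<i> \<noteq> 0"
  by (auto simp: complex_eq_iff)

lemma norm_disc_point:
  assumes "0 < Im z"
  shows "norm (disc_point z) < 1"
proof -
  have "norm (z - \<i>) ^ 2 < norm (z + \<i>) ^ 2"
    unfolding cmod_power2 using assms by (simp add: power2_eq_square algebra_simps)
  then have "norm (z - \<i>) < norm (z + \<i>)" by (rule power2_less_imp_less) simp
  then show ?thesis using plus_i_nonzero[OF assms] by (simp add: disc_point_def norm_divide)
qed

lemma Cayley_disc_point:
  assumes "0 < Im z"
  shows "\<i> * (1 + disc_point z) / (1 - disc_point z) = z"
proof -
  have "1 + disc_point z = 2 * z / (z + \<i>)" "1 - disc_point z = 2 * \<i> / (z + \<i>)"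
    using plus_i_nonzero[OF assms] by (simp_all add: disc_point_def field_simps)
  then show ?thesis using plus_i_nonzero[OF assms] by simp
qed

lemma Im_Cayley:
  assumes "norm w < 1"
  shows "0 < Im (\<i> * (1 + w) / (1 - w))"
proof -
  have nz: "1 - w \<noteq> 0" using assms by auto
  have "Im (\<i> * (1 + w) / (1 - w)) = (1 - norm w ^ 2) / norm (1 - w) ^ 2"
    by (simp add: Im_divide cmod_power2) (simp add: power2_eq_square algebra_simps)
  moreover have "norm w ^ 2 < 1" using assms by (simp add: power_less_one_iff)
  ultimately show ?thesis using nz by simp
qed

text \<open>
  In the coordinates of the half-plane the Schwarz kernel becomes \<open>\<i> (1 + x z) / (z - x)\<close>, and the
  point at infinity of the line contributes the kernel \<open>- \<i> z\<close>. Splitting off the term \<open>\<i> x\<close>, which does not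
  depend on \<open>z\<close>, leaves a multiple of the Cauchy kernel.
\<close>

lemma Schwarz_kernel_line:
  assumes z: "0 < Im z"
  defines "K \<equiv> \<lambda>t. (unit_circle t + disc_point z) / (unit_circle t - disc_point z)"
  shows "unit_circle t = 1 \<Longrightarrow> K t = - \<i> * z"
    and "unit_circle t \<noteq> 1 \<Longrightarrow> K t = \<i> * (of_real (1 + (line_point t)\<^sup>2) / (z - of_real (line_point t)) + of_real (line_point t))"
proof -
  have nz: "z + \<i> \<noteq> 0" "disc_point z \<noteq> 1"
    using plus_i_nonzero[OF z] norm_disc_point[OF z] by auto
  show "K t = - \<i> * z" if "unit_circle t = 1"
  proof -
    have "\<i> * K t = z" using Cayley_disc_point[OF z] by (simp add: K_def that)
    then show ?thesis by (metis mult.assoc mult_minus_left i_squared mult_1 minus_minus)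
  qed
  assume e: "unit_circle t \<noteq> 1"
  define x where "x = complex_of_real (line_point t)"
  let ?e = "unit_circle t" and ?w = "disc_point z"
  have zx: "z - x \<noteq> 0" unfolding x_def using z by (intro diff_of_real_nonzero) auto
  have ew: "?e - ?w \<noteq> 0" by (rule unit_circle_diff_nonzero[OF norm_disc_point[OF z]])
  have nz1: "1 - ?e \<noteq> 0" "1 - ?w \<noteq> 0" using e nz by auto
  have x: "x = \<i> * (1 + ?e) / (1 - ?e)" unfolding x_def by (rule line_point[OF e])
  have z': "z = \<i> * (1 + ?w) / (1 - ?w)" by (rule Cayley_disc_point[OF z, symmetric])
  have "z - x = 2 * \<i> * (?w - ?e) / ((1 - ?w) * (1 - ?e))"
    by (subst z', subst x) (use nz1 in \<open>simp add: field_simps\<close>)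
  moreover have "1 + x * z = - 2 * (?e + ?w) / ((1 - ?w) * (1 - ?e))"
    by (subst z', subst x) (use nz1 in \<open>simp add: divide_simps; simp add: algebra_simps\<close>)
  ultimately have "\<i> * ((1 + x * z) / (z - x)) = \<i> * (- 2 * (?e + ?w) / (2 * \<i> * (?w - ?e)))"
    using nz1 by simp
  also have "\<dots> = K t" using ew unfolding K_def by (simp add: field_simps)
  finally have "K t = \<i> * ((1 + x * z) / (z - x))" ..
  also have "(1 + x * z) / (z - x) = (1 + x\<^sup>2) / (z - x) + x"
    using zx by (simp add: field_simps power2_eq_square)
  finally show "K t = \<i> * (of_real (1 + (line_point t)\<^sup>2) / (z - of_real (line_point t)) + of_real (line_point t))"
    by (simp add: x_def)
qed

text \<open>
  A holomorphic map of the upper into the lower half-plane is a Herglotz integral over the extended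
  line. The normalisation at \<open>\<i> \<infinity>\<close> bounds \<open>- y Im g(\<i> y)\<close>. Hence infinity has no mass, and after
  multiplication by \<open>1 + x\<^sup>2\<close> the Herglotz measure has the total mass \<open>1\<close>.
\<close>

theorem cauchy_transform_criterion:
  assumes g: "g holomorphic_on upper" and Im_g: "\<And>z. 0 < Im z \<Longrightarrow> Im (g z) < 0"
    and lim: "((\<lambda>y. \<i> * of_real y * g (\<i> * of_real y)) \<longlongrightarrow> 1) at_top"
  obtains N where "real_distribution N" "\<And>z. 0 < Im z \<Longrightarrow> cauchy N z = g z"
proof -
  define c where "c w = \<i> * (1 + w) / (1 - w)" for w :: complex
  define h where "h w = \<i> * g (c w)" for w
  have c_in: "0 < Im (c w)" if "norm w < 1" for w using Im_Cayley[OF that] by (simp add: c_def)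
  have hol_c: "c holomorphic_on ball 0 1"
    unfolding c_def by (intro holomorphic_intros) auto
  have hol_h: "h holomorphic_on ball 0 1"
    unfolding h_def using c_in
    by (intro holomorphic_intros holomorphic_on_compose_gen[OF hol_c g, unfolded o_def]) auto
  have Re_h: "0 < Re (h w)" if "norm w < 1" for w using Im_g[OF c_in[OF that]] by (simp add: h_def)
  define p where "p = Re (h 0)"
  have p: "0 < p" using Re_h[of 0] by (simp add: p_def)
  have nonneg: "0 \<le> Re (h w)" if "norm w < 1" for w using Re_h[OF that] by simp
  obtain m where m: "real_distribution m" and rep: "\<And>w. norm w < 1 \<Longrightarrow>
      h w = of_real p * (LINT t|m. (unit_circle t + w) / (unit_circle t - w)) + \<i> * of_real (Im (h 0))"
    using Herglotz_disc[OF hol_h nonneg p[unfolded p_def], folded p_def] by blast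
  interpret m: real_distribution m by (rule m)
  define J where "J = {t. unit_circle t = 1}"
  have [measurable]: "J \<in> sets borel" unfolding J_def by measurable
  define K where "K z t = (unit_circle t + disc_point z) / (unit_circle t - disc_point z)" for z t
  have [measurable]: "K z \<in> borel_measurable borel" for z unfolding K_def[abs_def] by measurable
  have int_K: "integrable m (K z)" if "0 < Im z" for z
    using norm_Schwarz_kernel_le[OF norm_disc_point[OF that]]
    by (intro m.integrable_bounded) (auto simp: K_def)
  have g_rep: "g z = - \<i> * of_real p * (LINT t|m. K z t) + of_real (Im (h 0))" if z: "0 < Im z" for z
  proof -
    have "h (disc_point z) = \<i> * g z" using Cayley_disc_point[OF z] by (simp add: h_def c_def)
    then have "g z = - \<i> * h (disc_point z)" by simp
    also have "\<dots> = - \<i> * of_real p * (LINT t|m. K z t) + of_real (Im (h 0))"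
      unfolding rep[OF norm_disc_point[OF z]] K_def by (simp add: algebra_simps)
    finally show ?thesis .
  qed
  \<comment> \<open>This is \<open>y\<close> times the real part of the kernel at \<open>\<i> y\<close>. Outside \<open>J\<close> it increases to \<open>1 + x\<^sup>2\<close> with \<open>y\<close>,
    and on \<open>J\<close> it is unbounded in \<open>y\<close>.\<close>
  define k where "k y t = (if t \<in> J then y\<^sup>2 else y\<^sup>2 * (1 + (line_point t)\<^sup>2) / ((line_point t)\<^sup>2 + y\<^sup>2))" for y t
  have Re_K: "y * Re (K (\<i> * of_real y) t) = k y t" if y: "0 < y" for y t
  proof (cases "t \<in> J")
    case True
    then show ?thesis using Schwarz_kernel_line(1)[of "\<i> * of_real y" t] y
      by (simp add: K_def k_def J_def power2_eq_square)
  next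
    case False
    let ?x = "line_point t"
    have "0 < ?x\<^sup>2 + y\<^sup>2" using y by (intro add_nonneg_pos) auto
    have "K (\<i> * of_real y) t = \<i> * (of_real (1 + ?x\<^sup>2) / (\<i> * of_real y - of_real ?x) + of_real ?x)"
      using Schwarz_kernel_line(2)[of "\<i> * of_real y" t] y False by (simp add: K_def J_def)
    then have "Re (K (\<i> * of_real y) t) = - Im (of_real (1 + ?x\<^sup>2) / (\<i> * of_real y - of_real ?x))"
      by simp
    also have "\<dots> = (1 + ?x\<^sup>2) * y / (?x\<^sup>2 + y\<^sup>2)" by (simp add: Im_divide power2_eq_square)
    finally show ?thesis using False by (simp add: k_def power2_eq_square)
  qed
  have int_k: "integrable m (k y)" and int_k_eq: "(LINT t|m. k y t) = - y * Im (g (\<i> * of_real y)) / p"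
    if y: "0 < y" for y
  proof -
    have i: "integrable m (\<lambda>t. Re (K (\<i> * of_real y) t))"
      using int_K[of "\<i> * of_real y"] y by (intro integrable_Re) auto
    from integrable_mult_right[of y, OF i] show "integrable m (k y)"
      unfolding Re_K[OF y] .
    have "(LINT t|m. k y t) = y * (LINT t|m. Re (K (\<i> * of_real y) t))"
      using Re_K[OF y] by (simp flip: integral_mult_right_zero)
    also have "(LINT t|m. Re (K (\<i> * of_real y) t)) = Re (LINT t|m. K (\<i> * of_real y) t)"
      using int_K[of "\<i> * of_real y"] y by (intro integral_Re) auto
    also have "\<dots> = - Im (g (\<i> * of_real y)) / p"
      using g_rep[of "\<i> * of_real y"] y p by simp
    finally show "(LINT t|m. k y t) = - y * Im (g (\<i> * of_real y)) / p" by simp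
  qed
  have lim_k: "((\<lambda>y. - y * Im (g (\<i> * of_real y)) / p) \<longlongrightarrow> 1 / p) at_top"
    using tendsto_divide[OF tendsto_Re[OF lim] tendsto_const[of p]] p by simp
  have "measure m J = 0"
  proof (rule ccontr)
    assume "measure m J \<noteq> 0"
    then have pos: "0 < measure m J" by (simp add: zero_less_measure_iff)
    have le: "y\<^sup>2 * measure m J \<le> - y * Im (g (\<i> * of_real y)) / p" if y: "0 < y" for y
    proof -
      have "y\<^sup>2 * measure m J = (LINT t|m. y\<^sup>2 * indicator J t)" by simp
      also have "\<dots> \<le> (LINT t|m. k y t)"
      proof (rule integral_mono)
        show "integrable m (\<lambda>t. y\<^sup>2 * indicator J t :: real)"
          by (intro m.integrable_bounded[where B="y\<^sup>2"]) (auto simp: indicator_def)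
        show "integrable m (k y)" by (rule int_k[OF y])
      qed (auto simp: k_def indicator_def)
      finally show ?thesis using int_k_eq[OF y] by simp
    qed
    have "\<forall>\<^sub>F y in at_top. - y * Im (g (\<i> * of_real y)) / p < 1 / p + 1"
      using lim_k by (rule order_tendstoD) auto
    moreover have "\<forall>\<^sub>F y in at_top. 1 / p + 1 < y\<^sup>2 * measure m J"
      using pos by real_asymp
    moreover have "\<forall>\<^sub>F y in at_top. (0::real) < y" by (rule eventually_gt_at_top)
    ultimately have "\<forall>\<^sub>F y::real in at_top. False"
      by eventually_elim (use le in force)
    then show False by simp
  qed
  then have AE_J: "AE t in m. t \<notin> J"
    by (intro AE_not_in) (auto simp: null_sets_def m.emeasure_eq_measure)
  have 1: "integrable m (\<lambda>t. 1 + (line_point t)\<^sup>2)" "(LINT t|m. 1 + (line_point t)\<^sup>2) = 1 / p"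
  proof -
    let ?f = "\<lambda>n t. k (real (Suc n)) t"
    have mono: "AE t in m. mono (\<lambda>n. ?f n t)"
      using AE_J
    proof eventually_elim
      case (elim t)
      let ?x = "line_point t"
      show ?case
      proof (intro monoI)
        fix i j :: nat assume "i \<le> j"
        let ?a = "(real (Suc i))\<^sup>2" and ?b = "(real (Suc j))\<^sup>2"
        have ab: "0 < ?a" "?a \<le> ?b" using \<open>i \<le> j\<close> by (auto intro!: power_mono simp del: of_nat_Suc)
        then have pos: "0 < ?x\<^sup>2 + ?a" "0 < ?x\<^sup>2 + ?b" by (auto intro: add_nonneg_pos simp del: of_nat_Suc)
        have "?a / (?x\<^sup>2 + ?a) \<le> ?b / (?x\<^sup>2 + ?b)"
          using ab pos mult_left_mono[OF ab(2), of "?x\<^sup>2"] by (simp add: divide_simps del: of_nat_Suc) (simp add: algebra_simps del: of_nat_Suc)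
        then have "(1 + ?x\<^sup>2) * (?a / (?x\<^sup>2 + ?a)) \<le> (1 + ?x\<^sup>2) * (?b / (?x\<^sup>2 + ?b))"
          by (intro mult_left_mono) auto
        then show "?f i t \<le> ?f j t" using elim by (simp add: k_def mult.commute del: of_nat_Suc)
      qed
    qed
    have pos: "AE t in m. 0 \<le> ?f n t" for n by (simp add: k_def)
    have limf: "AE t in m. (\<lambda>n. ?f n t) \<longlonglongrightarrow> 1 + (line_point t)\<^sup>2"
      using AE_J
    proof eventually_elim
      case (elim t)
      have "(\<lambda>n. (real (Suc n))\<^sup>2 * (1 + x) / (x + (real (Suc n))\<^sup>2)) \<longlonglongrightarrow> 1 + x" for x :: real
        by real_asymp
      from this[of "(line_point t)\<^sup>2"] show ?case using elim by (simp add: k_def del: of_nat_Suc)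
    qed
    have ilim: "(\<lambda>n. LINT t|m. ?f n t) \<longlonglongrightarrow> 1 / p"
    proof -
      have "filterlim (\<lambda>n. real (Suc n)) at_top sequentially" by real_asymp
      from filterlim_compose[OF lim_k this] show ?thesis
        using int_k_eq by (simp del: of_nat_Suc)
    qed
    have int: "integrable m (?f n)" for n by (rule int_k) simp
    have meas: "(\<lambda>t. 1 + (line_point t)\<^sup>2) \<in> borel_measurable m" by measurable
    show "integrable m (\<lambda>t. 1 + (line_point t)\<^sup>2)" "(LINT t|m. 1 + (line_point t)\<^sup>2) = 1 / p"
      using integral_monotone_convergence_nonneg[OF int mono pos limf ilim meas] by auto
  qed
  define D where "D = density m (\<lambda>t. ennreal (p * (1 + (line_point t)\<^sup>2)))"
  define N where "N = distr D borel line_point"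
  have [measurable_cong, simp]: "sets D = sets borel" by (simp add: D_def)
  have dens: "0 \<le> p * (1 + (line_point t)\<^sup>2)" for t using p by (intro mult_nonneg_nonneg) auto
  have "real_distribution N"
  proof -
    have "emeasure N (space N) = (\<integral>\<^sup>+t. ennreal (p * (1 + (line_point t)\<^sup>2)) \<partial>m)"
      by (simp add: N_def D_def emeasure_distr emeasure_density)
    also have "\<dots> = ennreal (LINT t|m. p * (1 + (line_point t)\<^sup>2))"
      using 1(1) dens by (intro nn_integral_eq_integral) (auto simp del: distrib_left)
    also have "\<dots> = 1" using 1(2) p by (simp only: integral_mult_right_zero) simp
    finally have "prob_space N" by (rule prob_spaceI)
    then show ?thesis by (simp add: real_distribution_def real_distribution_axioms_def N_def)
  qed
  then interpret N: real_distribution N .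
  have int_x: "integrable m (\<lambda>t. complex_of_real (line_point t))"
  proof (rule Bochner_Integration.integrable_bound[OF 1(1)])
    show "AE t in m. norm (complex_of_real (line_point t)) \<le> norm (1 + (line_point t)\<^sup>2)"
    proof (rule AE_I2)
      fix t
      have "2 * \<bar>line_point t\<bar> \<le> 1 + (line_point t)\<^sup>2"
        using sum_squares_bound[of 1 "\<bar>line_point t\<bar>"] by simp
      then show "norm (complex_of_real (line_point t)) \<le> norm (1 + (line_point t)\<^sup>2)" by simp
    qed
  qed simp
  have cauchy_N: "cauchy N z = of_real p * (LINT t|m. of_real (1 + (line_point t)\<^sup>2) / (z - of_real (line_point t)))" for z
  proof -
    have "cauchy N z = (LINT t|D. 1 / (z - complex_of_real (line_point t)))"
      unfolding cauchy_def N_def by (subst integral_distr) auto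
    also have "\<dots> = (LINT t|m. (p * (1 + (line_point t)\<^sup>2)) *\<^sub>R (1 / (z - complex_of_real (line_point t))))"
      unfolding D_def using dens by (subst integral_density) auto
    also have "\<dots> = (LINT t|m. of_real p * (of_real (1 + (line_point t)\<^sup>2) / (z - complex_of_real (line_point t))))"
      by (intro Bochner_Integration.integral_cong) (auto simp: scaleR_conv_of_real)
    finally show ?thesis by (simp only: integral_mult_right_zero)
  qed
  define \<kappa> where "\<kappa> = of_real p * (LINT t|m. complex_of_real (line_point t)) + of_real (Im (h 0))"
  have g_eq: "g z = cauchy N z + \<kappa>" if z: "0 < Im z" for z
  proof -
    let ?q = "\<lambda>t. of_real (1 + (line_point t)\<^sup>2) / (z - complex_of_real (line_point t))"
    have int_q: "integrable m ?q"
    proof (rule Bochner_Integration.integrable_bound[OF integrable_mult_right[OF 1(1), of "1 / \<bar>Im z\<bar>"]])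
      show "AE t in m. norm (?q t) \<le> norm (1 / \<bar>Im z\<bar> * (1 + (line_point t)\<^sup>2))"
      proof (rule AE_I2)
        fix t
        have "norm (?q t) = (1 + (line_point t)\<^sup>2) * norm (1 / (z - complex_of_real (line_point t)))"
          by (simp add: norm_divide del: of_real_add)
        also have "\<dots> \<le> (1 + (line_point t)\<^sup>2) * (1 / \<bar>Im z\<bar>)"
          using z by (intro mult_left_mono norm_kernel_le) auto
        finally show "norm (?q t) \<le> norm (1 / \<bar>Im z\<bar> * (1 + (line_point t)\<^sup>2))"
          by (simp add: mult.commute abs_mult)
      qed
    qed simp
    have "(LINT t|m. K z t) = (LINT t|m. \<i> * (?q t + complex_of_real (line_point t)))"
      using AE_J Schwarz_kernel_line(2)[OF z]
      by (intro integral_cong_AE) (auto simp: K_def J_def elim!: eventually_mono)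
    also have "\<dots> = \<i> * ((LINT t|m. ?q t) + (LINT t|m. complex_of_real (line_point t)))"
      by (simp only: integral_mult_right_zero Bochner_Integration.integral_add[OF int_q int_x])
    finally show ?thesis
      unfolding g_rep[OF z] cauchy_N \<kappa>_def by (simp only:) (simp add: algebra_simps)
  qed
  have "\<kappa> = 0"
  proof -
    have inv: "((\<lambda>y. 1 / complex_of_real y) \<longlongrightarrow> 0) at_top"
      by (rule tendsto_norm_zero_cancel) (simp add: norm_divide, real_asymp)
    have "((\<lambda>y. \<i> * of_real y * g (\<i> * of_real y) * (- \<i> * (1 / of_real y))) \<longlongrightarrow> 1 * (- \<i> * 0)) at_top"
      by (intro tendsto_intros lim inv)
    moreover have "\<forall>\<^sub>F y in at_top. \<i> * of_real y * g (\<i> * of_real y) * (- \<i> * (1 / of_real y)) = g (\<i> * of_real y)"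
      using eventually_gt_at_top[of "0::real"] by eventually_elim (simp, simp add: complex_eq_iff)
    ultimately have "((\<lambda>y. g (\<i> * of_real y)) \<longlongrightarrow> 1 * (- \<i> * 0)) at_top"
      by (rule Lim_transform_eventually)
    then have "((\<lambda>y. g (\<i> * of_real y)) \<longlongrightarrow> 0) at_top" by simp
    moreover have "((\<lambda>y. cauchy N (\<i> * of_real y)) \<longlongrightarrow> 0) at_top"
    proof (rule Lim_null_comparison)
      show "\<forall>\<^sub>F y in at_top. norm (cauchy N (\<i> * of_real y)) \<le> 1 / y"
        using eventually_gt_at_top[of 0]
      proof eventually_elim
        case (elim y)
        have "norm (cauchy N (\<i> * of_real y)) \<le> (LINT x|N. 1 / y)"
          unfolding cauchy_def using elim N.integrable_kernel[of "\<i> * of_real y"] norm_kernel_le[of "\<i> * of_real y"]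
          by (intro norm_integral_le_integral) auto
        then show ?case using N.prob_space by simp
      qed
      show "((\<lambda>y. 1 / y) \<longlongrightarrow> (0::real)) at_top" by real_asymp
    qed
    ultimately have "((\<lambda>y. g (\<i> * of_real y) - cauchy N (\<i> * of_real y)) \<longlongrightarrow> 0 - 0) at_top"
      by (rule tendsto_diff)
    moreover have "\<forall>\<^sub>F y in at_top. g (\<i> * of_real y) - cauchy N (\<i> * of_real y) = \<kappa>"
      using eventually_gt_at_top[of "0::real"] by eventually_elim (simp add: g_eq)
    ultimately have "((\<lambda>y::real. \<kappa>) \<longlongrightarrow> 0 - 0) at_top" by (rule Lim_transform_eventually)
    then show ?thesis by (simp add: tendsto_const_iff)
  qed
  then show thesis using that[OF \<open>real_distribution N\<close>] g_eq by simp
qed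

section \<open>Free convolution powers on the line\<close>

context real_distribution
begin

lemma tendsto_mult_cauchy:
  fixes f :: "real \<Rightarrow> complex"
  assumes f: "\<And>\<epsilon>. 0 < \<epsilon> \<Longrightarrow> \<forall>\<^sub>F y in at_top. norm (f y - \<i> * of_real y) \<le> \<epsilon> * y"
  shows "((\<lambda>y. \<i> * of_real y * cauchy M (f y)) \<longlongrightarrow> 1) at_top"
proof -
  have pos: "\<forall>\<^sub>F y in at_top. (0::real) < y" by (rule eventually_gt_at_top)
  have 1: "((\<lambda>y. f y * cauchy M (f y)) \<longlongrightarrow> 1) at_top"
  proof (rule tendstoI)
    fix e :: real assume "0 < e"
    obtain \<beta> where \<beta>: "0 < \<beta>"
      "\<And>z. \<lbrakk>\<beta> < Im z; norm z \<le> 2 * Im z\<rbrakk> \<Longrightarrow> norm (z * cauchy M z - 1) \<le> e / 2"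
      using cone_kernel_product[of "e / 2" 2] \<open>0 < e\<close> by (metis half_gt_zero)
    have "\<forall>\<^sub>F y in at_top. norm (f y - \<i> * of_real y) \<le> 1/4 * y" by (rule f) simp
    moreover have "\<forall>\<^sub>F y in at_top. 2 * \<beta> < y" by (rule eventually_gt_at_top)
    ultimately show "\<forall>\<^sub>F y in at_top. dist (f y * cauchy M (f y)) 1 < e"
    proof eventually_elim
      case (elim y)
      have "\<bar>Im (f y) - y\<bar> \<le> 1/4 * y"
        using abs_Im_le_cmod[of "f y - \<i> * of_real y"] elim(1) by simp
      then have Im: "3/4 * y \<le> Im (f y)" by linarith
      have "norm (f y) \<le> norm (\<i> * of_real y) + norm (f y - \<i> * of_real y)"
        using norm_triangle_ineq[of "\<i> * of_real y" "f y - \<i> * of_real y"] by simp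
      also have "\<dots> \<le> y + 1/4 * y" using elim \<beta>(1) by (simp add: norm_mult)
      also have "\<dots> \<le> 2 * Im (f y)" using Im elim \<beta>(1) by linarith
      finally have "norm (f y * cauchy M (f y) - 1) \<le> e / 2"
        using Im elim \<beta>(1) by (intro \<beta>(2)) auto
      then show ?case using \<open>0 < e\<close> by (simp add: dist_norm)
    qed
  qed
  have 2: "((\<lambda>y. f y / (\<i> * of_real y)) \<longlongrightarrow> 1) at_top"
  proof (rule tendstoI)
    fix e :: real assume "0 < e"
    then have "\<forall>\<^sub>F y in at_top. norm (f y - \<i> * of_real y) \<le> e / 2 * y" by (intro f) simp
    then show "\<forall>\<^sub>F y in at_top. dist (f y / (\<i> * of_real y)) 1 < e"
      using pos
    proof eventually_elim
      case (elim y)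
      have "norm (f y / (\<i> * of_real y) - 1) = norm ((f y - \<i> * of_real y) / (\<i> * of_real y))"
        using elim by (simp add: diff_divide_distrib)
      also have "\<dots> = norm (f y - \<i> * of_real y) / y" using elim by (simp add: norm_divide norm_mult)
      also have "\<dots> \<le> e / 2" using elim by (simp add: field_simps)
      finally show ?case using \<open>0 < e\<close> by (simp add: dist_norm)
    qed
  qed
  have ev: "\<forall>\<^sub>F y in at_top. f y \<noteq> 0"
    using order_tendstoD(1)[OF tendsto_norm[OF 2], of 0] by (simp, elim eventually_mono) auto
  have "((\<lambda>y. f y * cauchy M (f y) / (f y / (\<i> * of_real y))) \<longlongrightarrow> 1 / 1) at_top"
    by (intro tendsto_divide 1 2) simp
  moreover have "\<forall>\<^sub>F y in at_top. f y * cauchy M (f y) / (f y / (\<i> * of_real y)) = \<i> * of_real y * cauchy M (f y)"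
    using ev pos by eventually_elim (simp add: field_simps)
  ultimately show ?thesis using tendsto_cong by force
qed

text \<open>
  If \<open>\<omega>(z) = z / t + (1 - 1/t) F\<^sub>N(z)\<close>, then \<open>F\<^sub>N(z) = F\<^sub>M(\<omega>(z))\<close> says that the inverses of \<open>F\<^sub>M\<close> and \<open>F\<^sub>N\<close>
  at \<open>1 / w\<close> differ from \<open>1 / w\<close> by \<open>R\<^sub>M(w)\<close> and \<open>t R\<^sub>M(w)\<close>. So \<open>\<omega>(z)\<close> has to be the point that
  subordination attaches to \<open>z / t\<close>. Conversely, subordination defines the candidate \<open>G\<^sub>M \<circ> \<omega>\<close>, and since
  \<open>\<omega>(\<i> y)\<close> is asymptotic to \<open>\<i> y\<close>, this is a Cauchy transform.
\<close>

theorem free_power_on_line: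
  assumes t: "1 \<le> t"
  obtains N \<omega> where "real_distribution N"
    "\<And>z. 0 < Im z \<Longrightarrow> 0 < Im (\<omega> z)"
    "\<And>z. 0 < Im z \<Longrightarrow> \<omega> z - of_real (1 - 1 / t) * recip M (\<omega> z) = z / of_real t"
    "\<And>z. 0 < Im z \<Longrightarrow> cauchy N z = cauchy M (\<omega> z)"
proof -
  define c where "c = 1 - 1 / t"
  have c: "0 \<le> c" "c \<le> 1" using t by (auto simp: c_def)
  have near: "norm (recip M (\<i> * of_real y) - \<i> * of_real y) \<le> \<delta> * y
      \<Longrightarrow> norm (\<i> * of_real y - of_real c * recip M (\<i> * of_real y) - \<i> * of_real (y / t)) \<le> \<delta> * y" for \<delta> y
  proof -
    assume le: "norm (recip M (\<i> * of_real y) - \<i> * of_real y) \<le> \<delta> * y"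
    have "\<i> * of_real y - of_real c * recip M (\<i> * of_real y) - \<i> * of_real (y / t)
        = - of_real c * (recip M (\<i> * of_real y) - \<i> * of_real y)"
      using t by (simp add: c_def field_simps)
    then have "norm (\<i> * of_real y - of_real c * recip M (\<i> * of_real y) - \<i> * of_real (y / t))
        = c * norm (recip M (\<i> * of_real y) - \<i> * of_real y)"
      using c by (simp add: norm_mult)
    also have "\<dots> \<le> 1 * norm (recip M (\<i> * of_real y) - \<i> * of_real y)"
      using c by (intro mult_right_mono) auto
    finally show ?thesis using le by simp
  qed
  have asymp: "\<forall>\<^sub>F y in at_top. norm (recip M (\<i> * of_real y) - \<i> * of_real y) \<le> \<delta> * y" if \<delta>: "0 < \<delta>" for \<delta>
  proof -
    obtain \<beta> where \<beta>: "0 < \<beta>" "\<And>z. \<lbrakk>\<beta> < Im z; norm z \<le> 1 * Im z\<rbrakk> \<Longrightarrow> norm (recip M z - z) \<le> \<delta> * norm z"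
      using cone_recip[OF \<delta>, of 1] by metis
    then have "norm (recip M (\<i> * of_real y) - \<i> * of_real y) \<le> \<delta> * y" if "\<beta> < y" for y
      using \<beta>(2)[of "\<i> * of_real y"] \<beta>(1) that by (simp add: norm_mult)
    then show ?thesis by (rule eventually_mono[OF eventually_gt_at_top])
  qed
  have Im_near: "y / (2 * t) \<le> Im (\<i> * of_real y - of_real c * recip M (\<i> * of_real y))"
    if "0 < y" "\<delta> \<le> 1 / (2 * t)" "norm (recip M (\<i> * of_real y) - \<i> * of_real y) \<le> \<delta> * y" for y \<delta>
  proof -
    have "\<bar>Im (\<i> * of_real y - of_real c * recip M (\<i> * of_real y)) - y / t\<bar> \<le> \<delta> * y"
      using near[OF that(3)] abs_Im_le_cmod[of "\<i> * of_real y - of_real c * recip M (\<i> * of_real y) - \<i> * of_real (y / t)"]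
      by simp
    moreover have "\<delta> * y \<le> 1 / (2 * t) * y" using that by (intro mult_right_mono) auto
    moreover have "1 / (2 * t) * y = y / (2 * t)" "y / t = y / (2 * t) + y / (2 * t)" using t by (auto simp: field_simps)
    ultimately show ?thesis by linarith
  qed
  obtain \<Omega> where hol: "\<Omega> holomorphic_on upper" and \<Omega>: "\<And>z. 0 < Im z \<Longrightarrow> 0 < Im (\<Omega> z)"
    "\<And>z. 0 < Im z \<Longrightarrow> \<Omega> z - of_real c * recip M (\<Omega> z) = z"
  proof -
    have "\<forall>\<^sub>F y in at_top. 0 < y \<and> norm (recip M (\<i> * of_real y) - \<i> * of_real y) \<le> 1 / (2 * t) * y"
      using asymp[of "1 / (2 * t)"] t eventually_gt_at_top[of "0::real"] by (intro eventually_conj) auto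
    then obtain y where y: "0 < y" "norm (recip M (\<i> * of_real y) - \<i> * of_real y) \<le> 1 / (2 * t) * y"
      unfolding eventually_at_top_linorder by blast
    have "0 < y / (2 * t)" using y t by simp
    then have "0 < Im (\<i> * of_real y - of_real c * recip M (\<i> * of_real y))"
      using Im_near[OF y(1) order_refl y(2)] by linarith
    then show thesis using subordination_exists[OF c(1), of "\<i> * of_real y"] y(1) that by auto
  qed
  define \<omega> where "\<omega> z = \<Omega> (z / of_real t)" for z
  have scale: "0 < Im (z / of_real t)" if "0 < Im z" for z
    using that t by simp
  have Im_\<omega>: "0 < Im (\<omega> z)" and eq_\<omega>: "\<omega> z - of_real c * recip M (\<omega> z) = z / of_real t" if "0 < Im z" for z
    using \<Omega>[OF scale[OF that]] by (auto simp: \<omega>_def)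
  have hol_\<omega>: "\<omega> holomorphic_on upper"
    unfolding \<omega>_def using t
    by (intro holomorphic_on_compose_gen[OF _ hol, unfolded o_def] holomorphic_intros) auto
  have \<omega>_asymp: "\<forall>\<^sub>F y in at_top. norm (\<omega> (\<i> * of_real y) - \<i> * of_real y) \<le> \<epsilon> * y" if \<epsilon>: "0 < \<epsilon>" for \<epsilon>
  proof -
    \<comment> \<open>The first bound keeps the imaginary part of \<open>?z\<close> below at least \<open>y / (2 t)\<close>. The second one
      compensates the factor \<open>4 t\<close> that then comes out of \<open>subordination_stable\<close>.\<close>
    define \<delta> where "\<delta> = min (1 / (2 * t)) (\<epsilon> / (4 * t))"
    have \<delta>: "0 < \<delta>" "\<delta> \<le> 1 / (2 * t)" "\<delta> \<le> \<epsilon> / (4 * t)" using t \<epsilon> by (auto simp: \<delta>_def)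
    show ?thesis
      using asymp[OF \<delta>(1)] eventually_gt_at_top[of "0::real"]
    proof eventually_elim
      case (elim y)
      let ?w = "\<i> * of_real y"
      let ?z = "?w - of_real c * recip M ?w"
      have Im_z: "y / (2 * t) \<le> Im ?z" using Im_near[OF elim(2) \<delta>(2) elim(1)] .
      have pos: "0 < y / (2 * t)" using elim t by simp
      have "norm (?w - \<omega> ?w) * (y / (2 * t)) \<le> norm (?w - \<omega> ?w) * Im ?z"
        using Im_z by (intro mult_left_mono) auto
      also have "\<dots> \<le> 2 * norm (?z - ?w / of_real t) * Im ?w"
      proof (rule subordination_stable[OF _ _ c(1) refl eq_\<omega>])
        show "0 < Im ?z" using pos Im_z by linarith
        show "0 < Im (\<omega> ?w)" using elim by (intro Im_\<omega>) auto
      qed (use elim t in auto)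
      also have "\<dots> \<le> 2 * (\<delta> * y) * y"
        using near[OF elim(1)] elim(2) \<delta>(1) by (intro mult_mono) auto
      finally have "norm (?w - \<omega> ?w) \<le> 4 * t * \<delta> * y"
        using elim(2) t by (simp add: field_simps)
      also have "\<dots> \<le> \<epsilon> * y" using \<delta>(3) elim(2) t by (intro mult_right_mono) (auto simp: field_simps)
      finally show ?case by (simp add: norm_minus_commute)
    qed
  qed
  obtain N where N: "real_distribution N" "\<And>z. 0 < Im z \<Longrightarrow> cauchy N z = cauchy M (\<omega> z)"
  proof (rule cauchy_transform_criterion)
    show "(\<lambda>z. cauchy M (\<omega> z)) holomorphic_on upper"
      using Im_\<omega> by (intro holomorphic_on_compose_gen[OF hol_\<omega> holomorphic_cauchy, unfolded o_def]) auto
    show "Im (cauchy M (\<omega> z)) < 0" if "0 < Im z" for z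
      using Im_\<omega>[OF that] poisson_pos[of "\<omega> z"] by (simp add: Im_cauchy)
    show "((\<lambda>y. \<i> * of_real y * cauchy M (\<omega> (\<i> * of_real y))) \<longlongrightarrow> 1) at_top"
      by (rule tendsto_mult_cauchy[OF \<omega>_asymp])
  qed (rule that)
  show thesis by (rule that[OF N(1) Im_\<omega> eq_\<omega>[unfolded c_def] N(2)])
qed

end

section \<open>Measures on the real line inside the sphere\<close>

definition on_sphere :: "real measure \<Rightarrow> sphere measure" where
  "on_sphere M = distr M sphere_borel (\<lambda>x. Some (complex_of_real x))"

lemma measurable_Some_of_real [measurable]: "(\<lambda>x. Some (complex_of_real x)) \<in> borel \<rightarrow>\<^sub>M sphere_borel"
proof (rule measurableI)
  fix A assume "A \<in> sets sphere_borel"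
  then have [measurable]: "Some -` A \<in> sets borel" by (simp add: sets_sphere_borel_iff)
  have "(\<lambda>x. Some (complex_of_real x)) -` A = complex_of_real -` (Some -` A)" by auto
  also have "\<dots> \<inter> space borel \<in> sets borel" by measurable
  finally show "(\<lambda>x. Some (complex_of_real x)) -` A \<inter> space borel \<in> sets borel" by simp
qed simp

lemma measurable_case_sphere:
  assumes "f \<in> borel \<rightarrow>\<^sub>M N" "c \<in> space N"
  shows "(\<lambda>x. case x of None \<Rightarrow> c | Some w \<Rightarrow> f w) \<in> sphere_borel \<rightarrow>\<^sub>M N"
proof (rule measurableI)
  fix A assume "A \<in> sets N"
  then have "f -` A \<in> sets borel" using measurable_sets[OF assms(1)] by simp
  moreover have "Some -` ((\<lambda>x. case x of None \<Rightarrow> c | Some w \<Rightarrow> f w) -` A) = f -` A" by auto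
  ultimately show "(\<lambda>x. case x of None \<Rightarrow> c | Some w \<Rightarrow> f w) -` A \<inter> space sphere_borel \<in> sets sphere_borel"
    by (simp add: sets_sphere_borel_iff)
qed (use measurable_space[OF assms(1)] assms(2) in \<open>auto split: option.split\<close>)

lemma real_line_in_sets: "real_line \<in> sets sphere_borel"
  using real_line_measurable[of None None] by (simp add: real_line_def image_iff)

context real_distribution
begin

lemma measurable_on_sphere [measurable]: "(\<lambda>x. Some (complex_of_real x)) \<in> M \<rightarrow>\<^sub>M sphere_borel"
  using measurable_Some_of_real by simp

lemma sets_on_sphere [simp]: "sets (on_sphere M) = sets sphere_borel"
  by (simp add: on_sphere_def)

lemma prob_space_on_sphere: "prob_space (on_sphere M)"
  unfolding on_sphere_def by (rule prob_space_distr) measurable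

lemma AE_on_sphere:
  "{x. P x} \<in> sets sphere_borel \<Longrightarrow> (AE x in on_sphere M. P x) \<longleftrightarrow> (AE x in M. P (Some (complex_of_real x)))"
  unfolding on_sphere_def by (subst AE_distr_iff) auto

lemma on_sphere_in_prob_on: "on_sphere M \<in> prob_on real_line"
  using AE_on_sphere[of "\<lambda>x. x \<in> real_line"] real_line_in_sets prob_space_on_sphere
  by (simp add: prob_on_def) (simp add: real_line_def)

lemma cauchy_transform_on_sphere: "cauchy_transform (on_sphere M) z = cauchy M z"
  unfolding cauchy_transform_def on_sphere_def cauchy_def
  by (subst integral_distr) (auto intro: measurable_case_sphere)

end

lemma prob_on_real_lineE:
  assumes "\<mu> \<in> prob_on real_line"
  obtains M where "real_distribution M" "\<mu> = on_sphere M"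
proof -
  have sets [measurable_cong]: "sets \<mu> = sets sphere_borel" and AE: "AE x in \<mu>. x \<in> real_line"
    using assms by (auto simp: prob_on_def)
  interpret prob_space \<mu> using assms by (simp add: prob_on_def)
  let ?f = "\<lambda>x. case x of None \<Rightarrow> 0 | Some w \<Rightarrow> Re w"
  have [measurable]: "?f \<in> \<mu> \<rightarrow>\<^sub>M borel"
    using measurable_case_sphere[of Re borel 0] sets by (simp cong: measurable_cong_sets)
  define M where "M = distr \<mu> borel ?f"
  have "prob_space M" unfolding M_def by (rule prob_space_distr) measurable
  then have M: "real_distribution M" by (simp add: real_distribution_def real_distribution_axioms_def M_def)
  have "on_sphere M = distr \<mu> sphere_borel (\<lambda>x. Some (complex_of_real (?f x)))"
    unfolding on_sphere_def M_def by (subst distr_distr) (auto simp: o_def)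
  also have "\<dots> = distr \<mu> \<mu> (\<lambda>x. x)"
  proof (rule distr_cong_AE)
    show "AE x in \<mu>. Some (complex_of_real (?f x)) = x"
      using AE by eventually_elim (auto simp: real_line_def)
  qed (use sets in auto)
  finally show thesis using that[OF M] by (simp add: distr_id)
qed

section \<open>Inverses of Cauchy transforms near infinity\<close>

lemma stolz_mono: "\<beta> \<le> \<beta>' \<Longrightarrow> stolz \<alpha> \<beta>' \<subseteq> stolz \<alpha> \<beta>"
  by (auto simp: stolz_def)

lemma norm_stolz: "z \<in> stolz 1 \<beta> \<Longrightarrow> norm z \<le> 2 * Im z"
  using cmod_le[of z] by (auto simp: stolz_def)

text \<open>
  In the cone of aperture \<open>1/2\<close> the norm of \<open>\<zeta>\<close> is at most \<open>3/2 Im \<zeta>\<close>, so a perturbation by one eighth of it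
  changes the real and the imaginary part by at most \<open>3/16 Im \<zeta>\<close>. The result stays in the cone of aperture \<open>1\<close>.
\<close>

lemma near_stolz:
  assumes \<zeta>: "\<zeta> \<in> stolz (1/2) \<beta>" and \<beta>: "0 < \<beta>" and z: "norm (z - \<zeta>) \<le> 1/8 * norm \<zeta>"
  shows "z \<in> stolz 1 (\<beta> / 2)"
proof -
  have "\<beta> < Im \<zeta>" "\<bar>Re \<zeta>\<bar> < 1/2 * Im \<zeta>" using \<zeta> by (auto simp: stolz_def)
  moreover from this have "norm \<zeta> \<le> 3/2 * Im \<zeta>" using cmod_le[of \<zeta>] \<beta> by auto
  moreover have "\<bar>Re z - Re \<zeta>\<bar> \<le> norm (z - \<zeta>)" "\<bar>Im z - Im \<zeta>\<bar> \<le> norm (z - \<zeta>)"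
    using abs_Re_le_cmod[of "z - \<zeta>"] abs_Im_le_cmod[of "z - \<zeta>"] by auto
  ultimately show ?thesis using z \<beta> unfolding stolz_def by simp linarith
qed

context real_distribution
begin

lemma cauchy_inj_on_stolz:
  obtains \<beta> where "0 < \<beta>" "inj_on (cauchy M) (stolz 1 \<beta>)"
proof (rule cone_kernel_product[of "1/2" 2])
  show "0 < (1/2 :: real)" by simp
  fix \<beta> assume \<beta>: "0 < \<beta>" "\<And>z w. \<lbrakk>\<beta> < Im z; \<beta> < Im w; norm z \<le> 2 * Im z; norm w \<le> 2 * Im w\<rbrakk> \<Longrightarrow>
      norm ((LINT x|M. z / (z - complex_of_real x) * (w / (w - complex_of_real x))) - 1) \<le> 1/2"
  show thesis
  proof (rule that[OF \<beta>(1)], rule inj_onI)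
    fix z w assume z: "z \<in> stolz 1 \<beta>" and w: "w \<in> stolz 1 \<beta>" and eq: "cauchy M z = cauchy M w"
    have Im: "\<beta> < Im z" "\<beta> < Im w" using z w by (auto simp: stolz_def)
    define I where "I = (LINT x|M. 1 / (z - complex_of_real x) * (1 / (w - complex_of_real x)))"
    have "(LINT x|M. z / (z - complex_of_real x) * (w / (w - complex_of_real x)))
        = (LINT x|M. (z * w) * (1 / (z - complex_of_real x) * (1 / (w - complex_of_real x))))"
      by (intro Bochner_Integration.integral_cong) auto
    also have "\<dots> = z * w * I" by (simp only: integral_mult_right_zero I_def)
    finally have "norm (z * w * I - 1) \<le> 1/2"
      using \<beta>(2)[OF Im norm_stolz[OF z] norm_stolz[OF w]] by simp
    then have "I \<noteq> 0" by auto
    moreover have "(w - z) * I = 0" using cauchy_diff[of z w] Im \<beta>(1) eq by (simp add: I_def)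
    ultimately show "z = w" by simp
  qed
qed

text \<open>
  The cones are nested, so the value of \<open>cauchy_inverse\<close> can be found on any single cone of injectivity.
\<close>

lemma cauchy_inverse_eq:
  assumes \<beta>: "0 < \<beta>" "inj_on (cauchy M) (stolz 1 \<beta>)" and z: "z \<in> stolz 1 \<beta>"
  shows "cauchy_inverse (on_sphere M) (cauchy M z) = z"
proof -
  have eta: "cauchy_transform (on_sphere M) = cauchy M" using cauchy_transform_on_sphere by auto
  show ?thesis
    unfolding cauchy_inverse_def eta
  proof (rule the_equality)
    show "\<exists>\<beta>>0. inj_on (cauchy M) (stolz 1 \<beta>) \<and> z \<in> stolz 1 \<beta> \<and> cauchy M z = cauchy M z"
      using assms by blast
    fix u assume "\<exists>\<beta>>0. inj_on (cauchy M) (stolz 1 \<beta>) \<and> u \<in> stolz 1 \<beta> \<and> cauchy M u = cauchy M z"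
    then obtain \<gamma> where \<gamma>: "inj_on (cauchy M) (stolz 1 \<gamma>)" "u \<in> stolz 1 \<gamma>" "cauchy M u = cauchy M z"
      by blast
    show "u = z"
    proof (cases "\<beta> \<le> \<gamma>")
      case True
      then show ?thesis using stolz_mono[OF True] \<beta>(2) z \<gamma> by (auto dest: inj_onD)
    next
      case False
      then have "stolz 1 \<beta> \<subseteq> stolz 1 \<gamma>" by (intro stolz_mono) simp
      then show ?thesis using z \<gamma> by (auto dest: inj_onD)
    qed
  qed
qed

text \<open>
  On a small ball around \<open>\<zeta>\<close> the map \<open>z \<mapsto> \<zeta> - (F(z) - z)\<close> takes values in the same ball, because \<open>F(z) - z\<close>
  is small compared with \<open>z\<close>. A fixed point solves \<open>F(z) = \<zeta>\<close>.
\<close>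

lemma recip_surj_stolz:
  assumes \<gamma>: "0 < \<gamma>"
  obtains \<beta> where "0 < \<beta>"
    "\<And>\<zeta>. \<zeta> \<in> stolz (1/2) \<beta> \<Longrightarrow> \<exists>z\<in>stolz 1 \<gamma>. recip M z = \<zeta> \<and> norm (z - \<zeta>) \<le> 1/8 * norm \<zeta>"
proof -
  obtain \<beta>\<^sub>0 where \<beta>\<^sub>0: "0 < \<beta>\<^sub>0"
    "\<And>z. \<lbrakk>\<beta>\<^sub>0 < Im z; norm z \<le> 2 * Im z\<rbrakk> \<Longrightarrow> norm (recip M z - z) \<le> 1/16 * norm z"
    by (rule cone_recip[of "1/16" 2]) (simp, blast)
  define \<beta> where "\<beta> = 2 * max \<beta>\<^sub>0 \<gamma>"
  show thesis
  proof (rule that[of \<beta>])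
    show "0 < \<beta>" using \<gamma> by (simp add: \<beta>_def)
    fix \<zeta> assume \<zeta>: "\<zeta> \<in> stolz (1/2) \<beta>"
    define r where "r = 1/8 * norm \<zeta>"
    have "\<zeta> \<noteq> 0" using \<zeta> \<open>0 < \<beta>\<close> by (auto simp: stolz_def)
    then have r: "0 < r" by (simp add: r_def)
    have in_stolz: "z \<in> stolz 1 (\<beta> / 2)" if "z \<in> cball \<zeta> r" for z
      using near_stolz[OF \<zeta> \<open>0 < \<beta>\<close>, of z] that by (simp add: dist_norm r_def norm_minus_commute)
    then have Im: "\<beta>\<^sub>0 < Im z" if "z \<in> cball \<zeta> r" for z
      using in_stolz[OF that] by (auto simp: stolz_def \<beta>_def)
    let ?\<phi> = "\<lambda>z. \<zeta> - (recip M z - z)"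
    have cont: "continuous_on (cball \<zeta> r) ?\<phi>"
      using Im \<beta>\<^sub>0(1)
      by (intro continuous_intros continuous_on_subset[OF holomorphic_on_imp_continuous_on[OF holomorphic_recip]])
         force
    have maps: "?\<phi> \<in> cball \<zeta> r \<rightarrow> cball \<zeta> r"
    proof
      fix z assume z: "z \<in> cball \<zeta> r"
      have "norm (recip M z - z) \<le> 1/16 * norm z"
        by (rule \<beta>\<^sub>0(2)[OF Im[OF z] norm_stolz[OF in_stolz[OF z]]])
      moreover have "norm z \<le> norm \<zeta> + r"
        using z norm_triangle_ineq[of \<zeta> "z - \<zeta>"] by (simp add: dist_norm norm_minus_commute)
      moreover have "r \<le> norm \<zeta>" by (simp add: r_def)
      ultimately have "norm (recip M z - z) \<le> r" unfolding r_def by linarith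
      then show "?\<phi> z \<in> cball \<zeta> r" by (simp add: dist_norm)
    qed
    obtain z where z: "z \<in> cball \<zeta> r" "?\<phi> z = z" using brouwer_ball[OF r cont maps] .
    then have "recip M z = \<zeta>" by (simp add: algebra_simps)
    moreover have "z \<in> stolz 1 \<gamma>"
      using in_stolz[OF z(1)] stolz_mono[of \<gamma> "\<beta> / 2" 1] by (auto simp: \<beta>_def)
    ultimately show "\<exists>z\<in>stolz 1 \<gamma>. recip M z = \<zeta> \<and> norm (z - \<zeta>) \<le> 1/8 * norm \<zeta>"
      using z(1) by (auto simp: dist_norm norm_minus_commute r_def)
  qed
qed

end

section \<open>The fractional power in terms of subordination\<close>

text \<open>
  For two measures on the line equality of the inverses near \<open>0\<close> gives equality of the Cauchy transforms
  high up on the imaginary axis, and so everywhere by analytic continuation.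
\<close>

lemma R_transform_unique:
  assumes M: "real_distribution M" and N: "real_distribution N" and \<beta>: "0 < \<beta>"
    and eq: "\<And>w. 1 / w \<in> stolz (1/2) \<beta> \<Longrightarrow> R_transform (on_sphere M) w = R_transform (on_sphere N) w"
  shows "M = N"
proof -
  interpret M: real_distribution M by fact
  interpret N: real_distribution N by fact
  obtain \<gamma> where \<gamma>: "0 < \<gamma>" "inj_on (cauchy M) (stolz 1 \<gamma>)" using M.cauchy_inj_on_stolz .
  obtain \<gamma>' where \<gamma>': "0 < \<gamma>'" "inj_on (cauchy N) (stolz 1 \<gamma>')" using N.cauchy_inj_on_stolz .
  obtain \<beta>' where \<beta>': "0 < \<beta>'"
    "\<And>\<zeta>. \<zeta> \<in> stolz (1/2) \<beta>' \<Longrightarrow> \<exists>z\<in>stolz 1 \<gamma>. recip M z = \<zeta> \<and> norm (z - \<zeta>) \<le> 1/8 * norm \<zeta>"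
    using M.recip_surj_stolz[OF \<gamma>(1)] by blast
  obtain \<beta>\<^sub>0 where \<beta>\<^sub>0: "0 < \<beta>\<^sub>0"
    "\<And>z. \<lbrakk>\<beta>\<^sub>0 < Im z; norm z \<le> 1 * Im z\<rbrakk> \<Longrightarrow> norm (recip N z - z) \<le> 1/4 * norm z"
    by (rule N.cone_recip[of "1/4" 1]) (simp, blast)
  define Y where "Y = max (max \<beta>\<^sub>0 \<gamma>') (2 * max \<beta> \<beta>')"
  have Y: "0 < Y" using \<beta>\<^sub>0(1) by (simp add: Y_def)
  have high: "cauchy M (\<i> * of_real y) = cauchy N (\<i> * of_real y)" if y: "Y < y" for y
  proof -
    let ?z = "\<i> * complex_of_real y"
    let ?\<zeta> = "recip N ?z"
    have y0: "0 < y" using Y y by simp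
    have near: "norm (?\<zeta> - ?z) \<le> 1/4 * y" using \<beta>\<^sub>0(2)[of ?z] y y0 by (simp add: Y_def norm_mult)
    have "\<bar>Re ?\<zeta>\<bar> \<le> 1/4 * y" "\<bar>Im ?\<zeta> - y\<bar> \<le> 1/4 * y"
      using abs_Re_le_cmod[of "?\<zeta> - ?z"] abs_Im_le_cmod[of "?\<zeta> - ?z"] near by auto
    then have "?\<zeta> \<in> stolz (1/2) (y / 2)" using y0 unfolding stolz_def mem_Collect_eq by (intro conjI) linarith+
    moreover have "\<beta> \<le> y / 2" "\<beta>' \<le> y / 2" using y by (auto simp: Y_def)
    ultimately have \<zeta>: "?\<zeta> \<in> stolz (1/2) \<beta>" "?\<zeta> \<in> stolz (1/2) \<beta>'"
      using stolz_mono by blast+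
    let ?w = "cauchy N ?z"
    have w: "1 / ?w = ?\<zeta>" by (simp add: recip_def)
    have "?z \<in> stolz 1 \<gamma>'" using y y0 by (simp add: stolz_def Y_def)
    then have invN: "cauchy_inverse (on_sphere N) ?w = ?z" by (rule N.cauchy_inverse_eq[OF \<gamma>'])
    obtain u where u: "u \<in> stolz 1 \<gamma>" "recip M u = ?\<zeta>" using \<beta>'(2)[OF \<zeta>(2)] by blast
    then have "cauchy M u = ?w" by (simp add: recip_def)
    then have "cauchy_inverse (on_sphere M) ?w = u" using M.cauchy_inverse_eq[OF \<gamma> u(1)] by simp
    moreover have "cauchy_inverse (on_sphere M) ?w = cauchy_inverse (on_sphere N) ?w"
      using eq[of ?w] \<zeta>(1) unfolding w by (simp add: R_transform_def)
    ultimately have "u = ?z" using invN by simp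
    then show ?thesis using \<open>cauchy M u = ?w\<close> by simp
  qed
  have all: "cauchy M z - cauchy N z = 0" if "0 < Im z" for z
  proof (rule analytic_continuation[where f = "\<lambda>z. cauchy M z - cauchy N z" and S = upper])
    show "(\<lambda>z. cauchy M z - cauchy N z) holomorphic_on upper"
      by (intro holomorphic_intros M.holomorphic_cauchy N.holomorphic_cauchy)
    let ?U = "{\<i> * complex_of_real y | y. Y < y}" and ?\<xi> = "\<i> * complex_of_real (Y + 1)"
    show "?U \<subseteq> upper" using Y by auto
    show "?\<xi> \<in> upper" using Y by simp
    show "?\<xi> islimpt ?U"
      unfolding islimpt_approachable
    proof (intro allI impI)
      fix e :: real assume "0 < e"
      have "dist (\<i> * complex_of_real (Y + 1 + e / 2)) ?\<xi> = e / 2"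
        using \<open>0 < e\<close> unfolding dist_norm
        by (simp add: norm_mult flip: right_diff_distrib of_real_diff of_real_add)
      then show "\<exists>u\<in>?U. u \<noteq> ?\<xi> \<and> dist u ?\<xi> < e"
        using \<open>0 < e\<close> by (intro bexI[of _ "\<i> * complex_of_real (Y + 1 + e / 2)"]) (auto simp: complex_eq_iff)
    qed
    show "cauchy M u - cauchy N u = 0" if "u \<in> ?U" for u using that high by auto
  qed (use that open_upper connected_upper in auto)
  show "M = N"
    by (rule cauchy_unique[OF M N]) (use all in auto)
qed

text \<open>
  If \<open>z\<close> is the value at \<open>w\<close> of the inverse of \<open>G\<^sub>N\<close>, then \<open>z\<close> is near \<open>1 / w\<close>. The point \<open>\<omega>(z)\<close> is a convex
  combination of \<open>z\<close> and \<open>1 / w\<close>, so it lies in the cone on which \<open>G\<^sub>M\<close> is injective. Hence it is the value at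
  \<open>w\<close> of the inverse of \<open>G\<^sub>M\<close>, and the equation of \<open>\<omega>\<close> becomes the relation between the R-transforms.
\<close>

theorem free_power_on_sphere:
  assumes M: "real_distribution M" and t: "1 \<le> t"
  obtains N \<omega> where "real_distribution N" "free_power (on_sphere M) t = on_sphere N"
    "\<And>z. 0 < Im z \<Longrightarrow> 0 < Im (\<omega> z)"
    "\<And>z. 0 < Im z \<Longrightarrow> \<omega> z - of_real (1 - 1 / t) * recip M (\<omega> z) = z / of_real t"
    "\<And>z. 0 < Im z \<Longrightarrow> cauchy N z = cauchy M (\<omega> z)"
proof -
  interpret M: real_distribution M by fact
  obtain N \<omega> where N: "real_distribution N"
    and \<omega>: "\<And>z. 0 < Im z \<Longrightarrow> 0 < Im (\<omega> z)"
    "\<And>z. 0 < Im z \<Longrightarrow> \<omega> z - of_real (1 - 1 / t) * recip M (\<omega> z) = z / of_real t"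
    "\<And>z. 0 < Im z \<Longrightarrow> cauchy N z = cauchy M (\<omega> z)"
    using M.free_power_on_line[OF t] by blast
  interpret N: real_distribution N by fact
  obtain \<gamma> where \<gamma>: "0 < \<gamma>" "inj_on (cauchy M) (stolz 1 \<gamma>)" using M.cauchy_inj_on_stolz .
  obtain \<gamma>' where \<gamma>': "0 < \<gamma>'" "inj_on (cauchy N) (stolz 1 \<gamma>')" using N.cauchy_inj_on_stolz .
  obtain \<beta>\<^sub>0 where \<beta>\<^sub>0: "0 < \<beta>\<^sub>0"
    "\<And>\<zeta>. \<zeta> \<in> stolz (1/2) \<beta>\<^sub>0 \<Longrightarrow> \<exists>z\<in>stolz 1 \<gamma>'. recip N z = \<zeta> \<and> norm (z - \<zeta>) \<le> 1/8 * norm \<zeta>"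
    using N.recip_surj_stolz[OF \<gamma>'(1)] by blast
  define \<beta> where "\<beta> = max \<beta>\<^sub>0 (2 * \<gamma>)"
  have \<beta>: "0 < \<beta>" using \<gamma>(1) by (simp add: \<beta>_def)
  have R: "R_transform (on_sphere N) w = of_real t * R_transform (on_sphere M) w"
    if w: "1 / w \<in> stolz (1/2) \<beta>" for w
  proof -
    have w0: "w \<noteq> 0" using w \<beta> by (auto simp: stolz_def)
    have "1 / w \<in> stolz (1/2) \<beta>\<^sub>0" using w stolz_mono[of \<beta>\<^sub>0 \<beta>] by (auto simp: \<beta>_def)
    then obtain z where z: "z \<in> stolz 1 \<gamma>'" "recip N z = 1 / w" "norm (z - 1 / w) \<le> 1/8 * norm (1 / w)"
      using \<beta>\<^sub>0(2) by blast
    have Im_z: "0 < Im z" using z(1) \<gamma>'(1) by (auto simp: stolz_def)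
    have Nz: "cauchy N z = w" using z(2) w0 by (simp add: recip_def)
    have invN: "cauchy_inverse (on_sphere N) w = z" using N.cauchy_inverse_eq[OF \<gamma>' z(1)] Nz by simp
    have "recip M (\<omega> z) = 1 / w" using \<omega>(3)[OF Im_z] Nz by (simp add: recip_def)
    then have \<omega>z: "\<omega> z = z / of_real t + of_real (1 - 1 / t) * (1 / w)"
      using \<omega>(2)[OF Im_z] by (simp add: algebra_simps)
    then have diff: "\<omega> z - 1 / w = (z - 1 / w) / of_real t" using t by (simp add: algebra_simps diff_divide_distrib)
    then have "norm (\<omega> z - 1 / w) = norm (z - 1 / w) / t" using t by (simp add: norm_divide)
    also have "\<dots> \<le> norm (z - 1 / w) / 1" using t by (intro divide_left_mono) auto
    finally have "norm (\<omega> z - 1 / w) \<le> 1/8 * norm (1 / w)" using z(3) by simp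
    then have "\<omega> z \<in> stolz 1 (\<beta> / 2)" by (rule near_stolz[OF w \<beta>])
    moreover have "\<gamma> \<le> \<beta> / 2" by (simp add: \<beta>_def)
    ultimately have "\<omega> z \<in> stolz 1 \<gamma>" using stolz_mono by blast
    then have "cauchy_inverse (on_sphere M) w = \<omega> z"
      using M.cauchy_inverse_eq[OF \<gamma>, of "\<omega> z"] \<omega>(3)[OF Im_z] Nz by simp
    then show ?thesis
      using t diff by (simp add: R_transform_def invN)
  qed
  have "free_power (on_sphere M) t = on_sphere N"
    unfolding free_power_def
  proof (rule the_equality)
    show "on_sphere N \<in> prob_on real_line \<and> (\<exists>\<beta>>0. \<forall>w. 1 / w \<in> stolz (1/2) \<beta> \<longrightarrow>
        R_transform (on_sphere N) w = of_real t * R_transform (on_sphere M) w)"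
      using N.on_sphere_in_prob_on R \<beta> by blast
    fix \<nu> assume \<nu>: "\<nu> \<in> prob_on real_line \<and> (\<exists>\<beta>>0. \<forall>w. 1 / w \<in> stolz (1/2) \<beta> \<longrightarrow>
        R_transform \<nu> w = of_real t * R_transform (on_sphere M) w)"
    then obtain N' where N': "real_distribution N'" "\<nu> = on_sphere N'" using prob_on_real_lineE by blast
    obtain \<beta>' where \<beta>': "0 < \<beta>'" "\<And>w. 1 / w \<in> stolz (1/2) \<beta>' \<Longrightarrow>
        R_transform (on_sphere N') w = of_real t * R_transform (on_sphere M) w"
      using \<nu> N'(2) by blast
    have "N' = N"
    proof (rule R_transform_unique[OF N'(1) N])
      show "0 < max \<beta> \<beta>'" using \<beta> by simp
      fix w assume "1 / w \<in> stolz (1/2) (max \<beta> \<beta>')"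
      then have "1 / w \<in> stolz (1/2) \<beta>" "1 / w \<in> stolz (1/2) \<beta>'"
        using stolz_mono[of \<beta> "max \<beta> \<beta>'" "1/2"] stolz_mono[of \<beta>' "max \<beta> \<beta>'" "1/2"] by auto
      then show "R_transform (on_sphere N') w = R_transform (on_sphere N) w"
        using R \<beta>'(2) by simp
    qed
    then show "\<nu> = on_sphere N" using N'(2) by simp
  qed
  then show thesis using that[OF N _ \<omega>] by blast
qed

section \<open>The flow on the line and the conformal barycentre\<close>

text \<open>
  The point \<open>k = barycentre M z\<close> solves \<open>\<integral> (x - k) / (z - x) dM(x) = 0\<close>: the Moebius transformation that
  sends \<open>z\<close> to infinity maps \<open>k\<close> to the mean of the image of \<open>M\<close>. Hence \<open>k\<close> is Moebius covariant. It is
  also the quantity that subordination preserves.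
\<close>

definition barycentre :: "real measure \<Rightarrow> complex \<Rightarrow> complex" where
  "barycentre M z = z - recip M z"

context real_distribution
begin

lemma recip_nonzero: "Im z \<noteq> 0 \<Longrightarrow> recip M z \<noteq> 0"
  using cauchy_nonzero by (simp add: recip_def)

lemma barycentre_cnj: "barycentre M (cnj z) = cnj (barycentre M z)"
  by (simp add: barycentre_def recip_def cauchy_cnj)

lemma Im_barycentre_le: "0 < Im z \<Longrightarrow> Im (barycentre M z) \<le> 0"
  using Im_recip_ge[of z] by (simp add: barycentre_def)

text \<open>
  Along a non-tangential sequence \<open>(w - \<alpha>) / (w - x)\<close> is bounded by \<open>B\<close>, and it tends to the indicator of \<open>\<alpha>\<close>.
\<close>

lemma atom_limit:
  fixes w :: "nat \<Rightarrow> complex"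
  assumes w: "w \<longlonglongrightarrow> of_real \<alpha>" "\<And>n. 0 < Im (w n)" and B: "\<And>n. norm (w n - of_real \<alpha>) \<le> B * Im (w n)"
  shows "(\<lambda>n. (w n - of_real \<alpha>) * cauchy M (w n)) \<longlonglongrightarrow> of_real (measure M {\<alpha>})"
proof -
  let ?q = "\<lambda>n x. (w n - of_real \<alpha>) * (1 / (w n - complex_of_real x))"
  have "(\<lambda>n. LINT x|M. ?q n x) \<longlonglongrightarrow> (LINT x|M. complex_of_real (indicator {\<alpha>} x))"
  proof (rule integral_dominated_convergence[where w="\<lambda>_. B"])
    show "AE x in M. (\<lambda>n. ?q n x) \<longlonglongrightarrow> complex_of_real (indicator {\<alpha>} x)"
    proof (rule AE_I2)
      fix x
      show "(\<lambda>n. ?q n x) \<longlonglongrightarrow> complex_of_real (indicator {\<alpha>} x)"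
      proof (cases "x = \<alpha>")
        case True
        have "?q n x = 1" for n using diff_of_real_nonzero[of "w n" x] w(2)[of n] True by simp
        then show ?thesis using True by simp
      next
        case False
        then have "(\<lambda>n. ?q n x) \<longlonglongrightarrow> (of_real \<alpha> - of_real \<alpha>) * (1 / (of_real \<alpha> - complex_of_real x))"
          by (intro tendsto_intros w) auto
        then show ?thesis using False by simp
      qed
    qed
    show "AE x in M. norm (?q n x) \<le> B" for n
    proof (rule AE_I2)
      fix x
      have "norm (?q n x) \<le> (B * Im (w n)) * (1 / Im (w n))"
        unfolding norm_mult using B[of n] norm_kernel_le[of "w n" x] w(2)[of n]
          order_trans[OF norm_ge_zero B[of n]]
        by (intro mult_mono) auto
      then show "norm (?q n x) \<le> B" using w(2)[of n] by simp
    qed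
  qed auto
  moreover have "(LINT x|M. ?q n x) = (w n - of_real \<alpha>) * cauchy M (w n)" for n
    by (simp only: integral_mult_right_zero cauchy_def)
  moreover have "(LINT x|M. complex_of_real (indicator {\<alpha>} x)) = of_real (measure M {\<alpha>})" by simp
  ultimately show ?thesis by (simp only:)
qed

end

lemma measurable_map_option_sphere:
  assumes [measurable]: "f \<in> borel_measurable borel"
  shows "map_option f \<in> sphere_borel \<rightarrow>\<^sub>M sphere_borel"
proof (rule measurableI)
  fix A assume "A \<in> sets sphere_borel"
  then have [measurable]: "Some -` A \<in> sets borel" by (simp add: sets_sphere_borel_iff)
  have "Some -` (map_option f -` A) = f -` (Some -` A) \<inter> space borel" by auto
  also have "\<dots> \<in> sets borel" by measurable
  finally show "map_option f -` A \<inter> space sphere_borel \<in> sets sphere_borel"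
    by (simp add: sets_sphere_borel_iff)
qed simp

text \<open>
  After the rescaling in \<open>F_real\<close> the subordination equation reads \<open>W = z + (t - 1) F\<^sub>N(z)\<close> together with
  \<open>F\<^sub>M(W) = t F\<^sub>N(z)\<close>. Thus \<open>z\<close> and \<open>W\<close> have the same barycentre \<open>k\<close>, and \<open>W\<close> is the image of \<open>z\<close> under
  the dilation with centre \<open>k\<close> and ratio \<open>t\<close>.
\<close>

lemma F_real_on_sphere:
  assumes M: "real_distribution M" and t: "1 \<le> t"
  obtains N where "real_distribution N" "F_real t (on_sphere M) = on_sphere N"
    "\<And>z. 0 < Im z \<Longrightarrow> \<exists>W. 0 < Im W \<and> barycentre M W = barycentre N z \<and>
      W - barycentre N z = of_real t * (z - barycentre N z)"
    "\<And>z W. \<lbrakk>0 < Im z; 0 < Im W; W - barycentre M W = of_real t * (z - barycentre M W)\<rbrakk> \<Longrightarrow>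
      barycentre N z = barycentre M W"
proof -
  interpret M: real_distribution M by fact
  obtain N' \<omega> where N': "real_distribution N'" and eq: "free_power (on_sphere M) t = on_sphere N'"
    and \<omega>: "\<And>z. 0 < Im z \<Longrightarrow> 0 < Im (\<omega> z)"
    "\<And>z. 0 < Im z \<Longrightarrow> \<omega> z - of_real (1 - 1 / t) * recip M (\<omega> z) = z / of_real t"
    "\<And>z. 0 < Im z \<Longrightarrow> cauchy N' z = cauchy M (\<omega> z)"
    using free_power_on_sphere[OF M t] by blast
  interpret N': real_distribution N' by fact
  define N where "N = distr N' borel (\<lambda>x. x / t)"
  have "prob_space N" unfolding N_def by (rule N'.prob_space_distr) simp
  then have N: "real_distribution N" by (simp add: real_distribution_def real_distribution_axioms_def N_def)
  interpret N: real_distribution N by fact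
  have "F_real t (on_sphere M) = distr N' sphere_borel (map_option (\<lambda>x. x / of_real t) \<circ> (\<lambda>x. Some (complex_of_real x)))"
    unfolding F_real_def eq unfolding on_sphere_def
    by (rule distr_distr) (auto intro: measurable_map_option_sphere)
  also have "\<dots> = distr N' sphere_borel ((\<lambda>x. Some (complex_of_real x)) \<circ> (\<lambda>x. x / t))"
    by (simp add: o_def)
  also have "\<dots> = on_sphere N"
    unfolding on_sphere_def N_def by (rule distr_distr[symmetric]) auto
  finally have F: "F_real t (on_sphere M) = on_sphere N" .
  have cauchy_N: "cauchy N z = of_real t * cauchy M (\<omega> (of_real t * z))" if z: "0 < Im z" for z
  proof -
    have "cauchy N z = (LINT x|N'. 1 / (z - complex_of_real (x / t)))"
      unfolding cauchy_def N_def by (subst integral_distr) auto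
    also have "\<dots> = (LINT x|N'. of_real t * (1 / (of_real t * z - complex_of_real x)))"
    proof (intro Bochner_Integration.integral_cong refl)
      fix x
      have "z - complex_of_real (x / t) = (of_real t * z - complex_of_real x) / of_real t"
        using t by (simp add: field_simps)
      then show "1 / (z - complex_of_real (x / t)) = of_real t * (1 / (of_real t * z - complex_of_real x))"
        by simp
    qed
    also have "\<dots> = of_real t * cauchy N' (of_real t * z)"
      by (simp only: integral_mult_right_zero cauchy_def)
    finally show ?thesis using \<omega>(3)[of "of_real t * z"] z t by simp
  qed
  have scale: "of_real (1 - 1 / t) * (of_real t * r) = of_real (t - 1) * r" for r :: complex
    using t by (simp add: field_simps)
  have W: "0 < Im (\<omega> (of_real t * z)) \<and> recip M (\<omega> (of_real t * z)) = of_real t * recip N z \<and>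
      \<omega> (of_real t * z) = z + of_real (t - 1) * recip N z" if z: "0 < Im z" for z
  proof -
    have tz: "0 < Im (of_real t * z)" using z t by simp
    have r: "recip M (\<omega> (of_real t * z)) = of_real t * recip N z"
      using t by (simp add: recip_def cauchy_N[OF z])
    have "\<omega> (of_real t * z) = z + of_real (1 - 1 / t) * (of_real t * recip N z)"
      using \<omega>(2)[OF tz] t unfolding r by (simp add: algebra_simps)
    then have "\<omega> (of_real t * z) = z + of_real (t - 1) * recip N z" by (simp only: scale)
    then show ?thesis using \<omega>(1)[OF tz] r by simp
  qed
  show thesis
  proof (rule that[OF N F])
    fix z :: complex assume z: "0 < Im z"
    show "\<exists>W. 0 < Im W \<and> barycentre M W = barycentre N z \<and> W - barycentre N z = of_real t * (z - barycentre N z)"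
      using W[OF z] by (intro exI[of _ "\<omega> (of_real t * z)"]) (auto simp: barycentre_def algebra_simps)
    fix V assume V: "0 < Im V" "V - barycentre M V = of_real t * (z - barycentre M V)"
    let ?W = "\<omega> (of_real t * z)"
    have eq_W: "?W - of_real (1 - 1 / t) * recip M ?W = z"
    proof -
      have W': "recip M ?W = of_real t * recip N z" "?W = z + of_real (t - 1) * recip N z"
        using W[OF z] by auto
      have "?W - of_real (1 - 1 / t) * recip M ?W = ?W - of_real (t - 1) * recip N z"
        by (simp only: W'(1) scale)
      then show ?thesis using W'(2) by simp
    qed
    have eq_V: "V - of_real (1 - 1 / t) * recip M V = z"
    proof -
      have "of_real t * (V - z) = of_real (t - 1) * recip M V"
        using V(2) by (simp add: barycentre_def algebra_simps)
      then show ?thesis using t by (simp add: field_simps)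
    qed
    have "V = ?W"
      by (rule M.subordination_unique[OF V(1) _ _ z eq_V eq_W]) (use W[OF z] t in auto)
    then show "barycentre N z = barycentre M V"
      using W[OF z] by (simp add: barycentre_def algebra_simps)
  qed
qed

text \<open>
  If \<open>N\<close> had mass \<open>m > 0\<close> at \<open>\<alpha>\<close>, then \<open>F\<^sub>N(\<alpha> + \<i> y)\<close> would be asymptotic to \<open>\<i> y / m\<close> as \<open>y\<close> tends to \<open>0\<close>.
  Hence \<open>W\<close> would tend to \<open>\<alpha>\<close> non-tangentially, and the identity \<open>t (W - \<alpha>) G\<^sub>M(W) = (z - \<alpha>) G\<^sub>N(z) + t - 1\<close>
  would give the mass \<open>(m + t - 1) / t > 0\<close> to \<open>M\<close> at \<open>\<alpha>\<close>.
\<close>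

lemma flow_creates_no_atom:
  assumes M: "real_distribution M" and N: "real_distribution N" and t: "1 \<le> t"
    and flow: "\<And>z. 0 < Im z \<Longrightarrow> \<exists>W. 0 < Im W \<and> barycentre M W = barycentre N z \<and>
      W - barycentre N z = of_real t * (z - barycentre N z)"
    and no_atom: "measure M {\<alpha>} = 0"
  shows "measure N {\<alpha>} = 0"
proof (rule ccontr)
  interpret M: real_distribution M by fact
  interpret N: real_distribution N by fact
  define m where "m = measure N {\<alpha>}"
  assume "measure N {\<alpha>} \<noteq> 0"
  then have m: "0 < m" by (simp add: m_def zero_less_measure_iff)
  define y where "y n = 1 / real (Suc n)" for n
  define z where "z n = complex_of_real \<alpha> + \<i> * of_real (y n)" for n
  have y: "0 < y n" for n by (simp add: y_def)
  have y_lim: "y \<longlonglongrightarrow> 0" unfolding y_def by real_asymp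
  have Im_z: "0 < Im (z n)" for n using y by (simp add: z_def)
  from flow[OF Im_z] obtain W where W: "\<And>n. 0 < Im (W n)" "\<And>n. barycentre M (W n) = barycentre N (z n)"
    "\<And>n. W n - barycentre N (z n) = of_real t * (z n - barycentre N (z n))" by metis
  let ?g = "\<lambda>n. cauchy N (z n)"
  have g0: "?g n \<noteq> 0" "cauchy M (W n) \<noteq> 0" for n
    using N.cauchy_nonzero[of "z n"] M.cauchy_nonzero[of "W n"] Im_z[of n] W(1)[of n] by auto
  have W_eq: "W n = z n + of_real (t - 1) / ?g n" for n
    using W(3)[of n] by (simp add: barycentre_def recip_def algebra_simps add_divide_distrib diff_divide_distrib)
  have g_eq: "?g n = of_real t * cauchy M (W n)" for n
  proof -
    have "recip M (W n) = of_real t * recip N (z n)"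
      using W(2,3)[of n] by (simp add: barycentre_def algebra_simps)
    then show ?thesis using g0[of n] t by (simp add: recip_def field_simps)
  qed
  have z_lim: "z \<longlonglongrightarrow> of_real \<alpha>"
  proof -
    have "z \<longlonglongrightarrow> complex_of_real \<alpha> + \<i> * of_real 0" unfolding z_def by (intro tendsto_intros y_lim)
    then show ?thesis by simp
  qed
  have lim_N: "(\<lambda>n. (z n - of_real \<alpha>) * ?g n) \<longlonglongrightarrow> of_real m"
    unfolding m_def using y[THEN less_imp_le]
    by (intro N.atom_limit[where B=1] z_lim Im_z) (simp add: z_def norm_mult)
  define q where "q n = 1 + of_real (t - 1) / ((z n - of_real \<alpha>) * ?g n)" for n
  define \<rho> where "\<rho> = 1 + (t - 1) / m"
  have \<rho>: "0 < \<rho>" using m t by (simp add: \<rho>_def add_pos_nonneg)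
  have q_lim: "q \<longlonglongrightarrow> of_real \<rho>"
  proof -
    have "q \<longlonglongrightarrow> 1 + of_real (t - 1) / of_real m"
      unfolding q_def using m by (intro tendsto_intros lim_N) auto
    then show ?thesis by (simp add: \<rho>_def)
  qed
  have Wq: "W n - of_real \<alpha> = \<i> * of_real (y n) * q n" for n
    using y[of n] g0(1)[of n] by (simp add: W_eq q_def z_def field_simps)
  have Im_W: "Im (W n) = y n * Re (q n)" for n
    using arg_cong[OF Wq[of n], of Im] by simp
  have Re_q: "0 < Re (q n)" for n
    using W(1)[of n] y[of n] by (simp add: Im_W zero_less_mult_iff)
  have "(\<lambda>n. norm (q n) / Re (q n)) \<longlonglongrightarrow> norm (complex_of_real \<rho>) / Re (of_real \<rho>)"
    using \<rho> by (intro tendsto_intros q_lim) auto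
  then obtain B where B: "\<And>n. norm (norm (q n) / Re (q n)) \<le> B"
    using convergent_imp_Bseq[of "\<lambda>n. norm (q n) / Re (q n)"] by (auto simp: convergent_def Bseq_def)
  have "(\<lambda>n. (W n - of_real \<alpha>) * cauchy M (W n)) \<longlonglongrightarrow> of_real (measure M {\<alpha>})"
  proof (rule M.atom_limit[OF _ W(1)])
    have "(\<lambda>n. of_real \<alpha> + \<i> * of_real (y n) * q n) \<longlonglongrightarrow> of_real \<alpha> + \<i> * of_real 0 * of_real \<rho>"
      by (intro tendsto_intros y_lim q_lim)
    then show "W \<longlonglongrightarrow> of_real \<alpha>" by (simp flip: Wq)
    fix n
    have "norm (q n) \<le> B * Re (q n)" using B[of n] Re_q[of n] by (simp add: field_simps)
    then show "norm (W n - of_real \<alpha>) \<le> B * Im (W n)"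
      using y[of n] by (simp add: Wq Im_W norm_mult mult.left_commute)
  qed
  then have "(\<lambda>n. of_real t * ((W n - of_real \<alpha>) * cauchy M (W n))) \<longlonglongrightarrow> of_real t * 0"
    unfolding no_atom by (intro tendsto_mult tendsto_const) simp
  moreover have "of_real t * ((W n - of_real \<alpha>) * cauchy M (W n)) = (z n - of_real \<alpha>) * ?g n + of_real (t - 1)" for n
  proof -
    have "of_real t * ((W n - of_real \<alpha>) * cauchy M (W n)) = (W n - of_real \<alpha>) * ?g n"
      by (simp add: g_eq)
    also have "\<dots> = (z n - of_real \<alpha>) * ?g n + of_real (t - 1)"
      using g0(1)[of n] by (simp add: W_eq field_simps)
    finally show ?thesis .
  qed
  moreover have "(\<lambda>n. (z n - of_real \<alpha>) * ?g n + of_real (t - 1)) \<longlonglongrightarrow> of_real m + of_real (t - 1)"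
    by (intro tendsto_intros lim_N)
  ultimately have "complex_of_real m + of_real (t - 1) = of_real t * 0"
    using LIMSEQ_unique by fastforce
  then have "m + (t - 1) = 0" by (simp add: complex_eq_iff)
  then show False using m t by linarith
qed

section \<open>Moebius conjugation\<close>

text \<open>
  In the coordinate \<open>1 / (z - k)\<close> the point \<open>a\<close> of the extended line becomes \<open>pole a k\<close>. The transformations
  with the fixed points \<open>a\<close> and \<open>k\<close> become the dilations with centre \<open>pole a k\<close>.
\<close>

definition pole :: "sphere \<Rightarrow> complex \<Rightarrow> complex" where
  "pole a k = (case a of None \<Rightarrow> 0 | Some c \<Rightarrow> 1 / (c - k))"

definition dilated :: "sphere \<Rightarrow> real \<Rightarrow> complex \<Rightarrow> complex \<Rightarrow> complex \<Rightarrow> bool" where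
  "dilated a t k z W \<longleftrightarrow> of_real t * (1 / (W - k) - pole a k) = 1 / (z - k) - pole a k"

text \<open>
  This relation says that \<open>N\<close> arises from \<open>M\<close> by the flow with base point \<open>a\<close> and time \<open>t\<close>. The second part
  identifies the barycentre at \<open>z\<close> by the mere existence of a suitable point \<open>W\<close>.
\<close>

definition subordinate :: "sphere \<Rightarrow> real \<Rightarrow> real measure \<Rightarrow> real measure \<Rightarrow> bool" where
  "subordinate a t M N \<longleftrightarrow>
    (\<forall>z. 0 < Im z \<longrightarrow> (\<exists>W. 0 < Im W \<and> barycentre M W = barycentre N z \<and> dilated a t (barycentre N z) z W)) \<and>
    (\<forall>z W. 0 < Im z \<longrightarrow> 0 < Im W \<longrightarrow> dilated a t (barycentre M W) z W \<longrightarrow> barycentre N z = barycentre M W)"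

lemma dilated_None:
  assumes "z \<noteq> k" "W \<noteq> k"
  shows "dilated None t k z W \<longleftrightarrow> W - k = of_real t * (z - k)"
  using assms by (auto simp: dilated_def pole_def field_simps)

lemma dilated_Some:
  assumes "z \<noteq> k" "W \<noteq> k" "z \<noteq> c" "W \<noteq> c" "k \<noteq> c"
  shows "dilated (Some c) t k z W \<longleftrightarrow>
    1 / (W - c) - 1 / (k - c) = of_real t * (1 / (z - c) - 1 / (k - c))"
proof -
  have "1 / (W - k) - 1 / (c - k) = (c - W) / ((W - k) * (c - k))"
    "1 / (z - k) - 1 / (c - k) = (c - z) / ((z - k) * (c - k))"
    "1 / (W - c) - 1 / (k - c) = (k - W) / ((W - c) * (k - c))"
    "1 / (z - c) - 1 / (k - c) = (k - z) / ((z - c) * (k - c))"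
    using assms by (simp_all add: divide_simps)
  then have "dilated (Some c) t k z W \<longleftrightarrow> of_real t * ((c - W) / ((W - k) * (c - k))) = (c - z) / ((z - k) * (c - k))"
    and "(1 / (W - c) - 1 / (k - c) = of_real t * (1 / (z - c) - 1 / (k - c))) \<longleftrightarrow>
      (k - W) / ((W - c) * (k - c)) = of_real t * ((k - z) / ((z - c) * (k - c)))"
    by (simp_all add: dilated_def pole_def)
  moreover have "of_real t * ((c - W) / ((W - k) * (c - k))) = (c - z) / ((z - k) * (c - k)) \<longleftrightarrow>
      of_real t * (W - c) * (z - k) = (z - c) * (W - k)"
    using assms by (simp add: divide_simps) (auto simp: algebra_simps)
  moreover have "(k - W) / ((W - c) * (k - c)) = of_real t * ((k - z) / ((z - c) * (k - c))) \<longleftrightarrow>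
      of_real t * (W - c) * (z - k) = (z - c) * (W - k)"
    using assms by (simp add: divide_simps) (auto simp: algebra_simps)
  ultimately show ?thesis by simp
qed

context real_distribution
begin

lemma barycentre_neq: "Im z \<noteq> 0 \<Longrightarrow> z \<noteq> barycentre M z"
  using recip_nonzero[of z] by (auto simp: barycentre_def)

text \<open>
  If \<open>\<alpha>\<close> is the barycentre of \<open>z\<close>, then \<open>(x - \<alpha>) / (z - x)\<close> has the integral \<open>0\<close>. Its imaginary and real part,
  suitably combined, give the integral of \<open>(x - \<alpha>)\<^sup>2 / norm (z - x) ^ 2\<close>, so that \<open>M\<close> is a point mass at \<open>\<alpha>\<close>.
\<close>

lemma barycentre_neq_real:
  assumes z: "Im z \<noteq> 0" and no_atom: "AE x in M. x \<noteq> \<alpha>"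
  shows "barycentre M z \<noteq> of_real \<alpha>"
proof
  assume "barycentre M z = of_real \<alpha>"
  then have 1: "(z - of_real \<alpha>) * cauchy M z = 1"
    using cauchy_nonzero[OF z] by (simp add: barycentre_def recip_def field_simps)
  let ?h = "\<lambda>x. (of_real x - of_real \<alpha>) * (1 / (z - complex_of_real x))"
  have h_eq: "?h x = (z - of_real \<alpha>) * (1 / (z - complex_of_real x)) - 1" for x
    using diff_of_real_nonzero[OF z, of x] by (simp add: field_simps)
  have int_h: "integrable M ?h"
    unfolding h_eq
    by (intro Bochner_Integration.integrable_diff integrable_mult_right integrable_kernel[OF z] integrable_const)
  have "(LINT x|M. ?h x) = (LINT x|M. (z - of_real \<alpha>) * (1 / (z - complex_of_real x))) - (LINT x|M. 1)"
    unfolding h_eq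
    by (intro Bochner_Integration.integral_diff integrable_mult_right integrable_kernel[OF z] integrable_const)
  also have "\<dots> = (z - of_real \<alpha>) * cauchy M z - 1"
    by (simp only: integral_mult_right_zero cauchy_def) (simp add: prob_space[simplified])
  finally have 0: "(LINT x|M. ?h x) = 0" using 1 by simp
  define u where "u = Re z - \<alpha>"
  have key: "(x - \<alpha>)\<^sup>2 * (1 / norm (z - complex_of_real x) ^ 2) = - Re (?h x) - u / Im z * Im (?h x)" for x
  proof -
    define n where "n = norm (z - complex_of_real x) ^ 2"
    have n: "n \<noteq> 0" using diff_of_real_nonzero[OF z, of x] by (simp add: n_def)
    have Re: "Re (?h x) = (x - \<alpha>) * ((Re z - x) / n)" and Im: "Im (?h x) = (x - \<alpha>) * (- Im z / n)"
      by (simp_all add: n_def Re_divide Im_divide cmod_power2)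
    have "- Re (?h x) - u / Im z * Im (?h x) = (x - \<alpha>) * (u - (Re z - x)) / n"
      unfolding Re Im using z n by (simp add: field_simps)
    also have "u - (Re z - x) = x - \<alpha>" by (simp add: u_def)
    finally show ?thesis by (simp add: n_def power2_eq_square)
  qed
  have int: "integrable M (\<lambda>x. (x - \<alpha>)\<^sup>2 * (1 / norm (z - complex_of_real x) ^ 2))"
    unfolding key using int_h by (intro Bochner_Integration.integrable_diff integrable_mult_right integrable_minus integrable_Re integrable_Im) auto
  have "(LINT x|M. (x - \<alpha>)\<^sup>2 * (1 / norm (z - complex_of_real x) ^ 2)) = - Re (LINT x|M. ?h x) - u / Im z * Im (LINT x|M. ?h x)"
    unfolding key using int_h integrable_Re[OF int_h] integrable_Im[OF int_h]
    by (simp only: Bochner_Integration.integral_diff integrable_mult_right integrable_minus integral_mult_right_zero integral_minus integral_Re integral_Im simp_thms)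
  then have "(LINT x|M. (x - \<alpha>)\<^sup>2 * (1 / norm (z - complex_of_real x) ^ 2)) = 0" using 0 by simp
  then have "AE x in M. (x - \<alpha>)\<^sup>2 * (1 / norm (z - complex_of_real x) ^ 2) = 0"
    using integral_nonneg_eq_0_iff_AE[OF int] by simp
  then have "AE x in M. False"
    using no_atom
  proof eventually_elim
    case (elim x)
    then show ?case using diff_of_real_nonzero[OF z, of x] by simp
  qed
  then show False by (simp add: AE_False prob_space)
qed

end

text \<open>
  The covariance of the barycentre. The images of \<open>z\<close> and of the barycentre have to be finite, which holds
  because \<open>z\<close> is not real and by the previous lemma.
\<close>

lemma barycentre_Moebius:
  assumes M: "real_distribution M" and z: "Im z \<noteq> 0"
    and no_atom: "AE x in M. x \<noteq> \<alpha>" and distr: "M' = distr M borel (\<lambda>x. 1 / (x - \<alpha>))"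
  shows "barycentre M' (1 / (z - of_real \<alpha>)) = 1 / (barycentre M z - of_real \<alpha>)"
proof -
  interpret M: real_distribution M by fact
  let ?c = "complex_of_real \<alpha>" and ?k = "barycentre M z"
  have zc: "z - ?c \<noteq> 0" using diff_of_real_nonzero[OF z] .
  have kc: "?k - ?c \<noteq> 0" using M.barycentre_neq_real[OF z no_atom] by simp
  have zk: "z - ?k \<noteq> 0" using M.barycentre_neq[OF z] by simp
  have G: "cauchy M z = 1 / (z - ?k)" by (simp add: barycentre_def recip_def)
  have "cauchy M' (1 / (z - ?c)) = (LINT x|M. 1 / (1 / (z - ?c) - complex_of_real (1 / (x - \<alpha>))))"
    unfolding cauchy_def distr by (subst integral_distr) auto
  also have "\<dots> = (LINT x|M. (z - ?c) - (z - ?c)\<^sup>2 * (1 / (z - complex_of_real x)))"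
  proof (rule integral_cong_AE)
    show "AE x in M. 1 / (1 / (z - ?c) - complex_of_real (1 / (x - \<alpha>))) = (z - ?c) - (z - ?c)\<^sup>2 * (1 / (z - complex_of_real x))"
      using no_atom
    proof eventually_elim
      case (elim x)
      let ?x = "complex_of_real x"
      have nz: "?x - ?c \<noteq> 0" "z - ?x \<noteq> 0" using elim diff_of_real_nonzero[OF z, of x] by auto
      have "1 / (z - ?c) - complex_of_real (1 / (x - \<alpha>)) = (?x - z) / ((z - ?c) * (?x - ?c))"
        using zc nz by (simp add: divide_simps)
      then have "1 / (1 / (z - ?c) - complex_of_real (1 / (x - \<alpha>))) = ((z - ?c) * (?x - ?c)) / (?x - z)" by simp
      also have "\<dots> = (z - ?c) - (z - ?c)\<^sup>2 * (1 / (z - ?x))"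
      proof -
        have "?x - z \<noteq> 0" using nz by auto
        then show ?thesis using nz by (simp add: divide_simps) (simp add: algebra_simps power2_eq_square)
      qed
      finally show ?case .
    qed
  qed auto
  also have "\<dots> = (z - ?c) - (z - ?c)\<^sup>2 * cauchy M z"
    using M.integrable_kernel[OF z] M.prob_space
    by (subst Bochner_Integration.integral_diff) (simp_all only: integral_mult_right_zero cauchy_def integrable_mult_right, simp_all)
  also have "\<dots> = (z - ?c) * (?c - ?k) / (z - ?k)"
    unfolding G using zk by (simp add: field_simps power2_eq_square)
  finally have "recip M' (1 / (z - ?c)) = (z - ?k) / ((z - ?c) * (?c - ?k))" by (simp add: recip_def)
  moreover have "1 / (z - ?c) - (z - ?k) / ((z - ?c) * (?c - ?k)) = 1 / (?k - ?c)"
  proof -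
    have "?c - ?k \<noteq> 0" using kc by auto
    then show ?thesis using zc kc by (simp add: divide_simps) (simp add: algebra_simps)
  qed
  ultimately show ?thesis by (simp add: barycentre_def)
qed

section \<open>The flows with an arbitrary base point\<close>

lemma (in real_distribution) AE_neq_iff: "(AE x in M. x \<noteq> \<alpha>) \<longleftrightarrow> measure M {\<alpha>} = 0"
  by (subst AE_iff_measurable[where N="{\<alpha>}"]) (auto simp: emeasure_eq_measure)

lemma distr_on_sphere:
  assumes M: "real_distribution M" and [measurable]: "f \<in> sphere_borel \<rightarrow>\<^sub>M sphere_borel" "g \<in> borel_measurable borel"
    and AE: "AE x in M. f (Some (complex_of_real x)) = Some (complex_of_real (g x))"
  shows "distr (on_sphere M) sphere_borel f = on_sphere (distr M borel g)"
proof -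
  interpret real_distribution M by fact
  have "distr (on_sphere M) sphere_borel f = distr M sphere_borel (\<lambda>x. f (Some (complex_of_real x)))"
    unfolding on_sphere_def by (subst distr_distr) (auto simp: o_def)
  also have "\<dots> = distr M sphere_borel (\<lambda>x. Some (complex_of_real (g x)))"
    by (rule distr_cong_AE) (use AE in auto)
  also have "\<dots> = on_sphere (distr M borel g)"
    unfolding on_sphere_def by (subst distr_distr) (auto simp: o_def)
  finally show ?thesis .
qed

lemma inv_moebius_to_inf:
  "inv (moebius_to_inf (Some c)) = (\<lambda>x. case x of None \<Rightarrow> Some c | Some w \<Rightarrow> if w = 0 then None else Some (c + 1 / w))"
proof (rule inv_unique_comp)
  show "moebius_to_inf (Some c) \<circ> (\<lambda>x. case x of None \<Rightarrow> Some c | Some w \<Rightarrow> if w = 0 then None else Some (c + 1 / w)) = id"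
    by (auto simp: fun_eq_iff split: option.split)
  show "(\<lambda>x. case x of None \<Rightarrow> Some c | Some w \<Rightarrow> if w = 0 then None else Some (c + 1 / w)) \<circ> moebius_to_inf (Some c) = id"
  proof
    show "((\<lambda>x. case x of None \<Rightarrow> Some c | Some w \<Rightarrow> if w = 0 then None else Some (c + 1 / w)) \<circ> moebius_to_inf (Some c)) x = id x" for x
      by (cases x) auto
  qed
qed

lemma measurable_inv_moebius_to_inf: "inv (moebius_to_inf (Some c)) \<in> sphere_borel \<rightarrow>\<^sub>M sphere_borel"
proof (rule measurableI)
  fix A assume "A \<in> sets sphere_borel"
  then have [measurable]: "Some -` A \<in> sets borel" by (simp add: sets_sphere_borel_iff)
  have "Some -` (inv (moebius_to_inf (Some c)) -` A) =
      (if None \<in> A then {0} else {}) \<union> {w. w \<noteq> 0 \<and> c + 1 / w \<in> Some -` A}"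
    by (auto simp: inv_moebius_to_inf split: if_splits)
  also have "\<dots> \<in> sets borel" by measurable
  finally show "inv (moebius_to_inf (Some c)) -` A \<inter> space sphere_borel \<in> sets sphere_borel"
    by (simp add: sets_sphere_borel_iff)
qed simp

lemma F_inf_on_sphere:
  assumes M: "real_distribution M" and N: "F_real t (on_sphere M) = on_sphere N"
  shows "F_inf t (on_sphere M) = on_sphere N"
proof -
  interpret M: real_distribution M by fact
  interpret S: prob_space "on_sphere M" by (rule M.prob_space_on_sphere)
  have "Some -` (- {None}) = (UNIV :: complex set)" "Some -` {None} = ({} :: complex set)" by auto
  then have meas: "- {None} \<in> sets sphere_borel" "{None} \<in> sets sphere_borel"
    by (simp_all add: sets_sphere_borel_iff)
  have AE: "AE x in on_sphere M. x \<in> - {None}"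
    by (subst M.AE_on_sphere) (simp_all only: Collect_mem_eq meas, simp)
  then have "emeasure (on_sphere M) (- {None}) = 1"
    using S.emeasure_eq_1_AE meas by simp
  then have uni: "uniform_measure (on_sphere M) (- {None}) = on_sphere M"
  proof -
    assume one: "emeasure (on_sphere M) (- {None}) = 1"
    show ?thesis
    proof (rule measure_eqI)
      fix A assume "A \<in> sets (uniform_measure (on_sphere M) (- {None}))"
      then have A: "A \<in> sets (on_sphere M)" by simp
      have "emeasure (on_sphere M) (- {None} \<inter> A) = emeasure (on_sphere M) A"
        using AE A meas by (intro emeasure_eq_AE) (auto elim: eventually_mono)
      then show "emeasure (uniform_measure (on_sphere M) (- {None})) A = emeasure (on_sphere M) A"
        using A meas one by (simp add: divide_ennreal_def)
    qed simp
  qed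
  have "measure (on_sphere M) {None} = 0"
    using S.prob_eq_0[of "{None}"] AE meas by simp
  then have "F_inf t (on_sphere M) = mixture 0 delta_inf (on_sphere N)"
    by (simp add: F_inf_def uni N)
  also have "\<dots> = on_sphere N"
  proof (rule measure_eqI)
    show sets: "sets (mixture 0 delta_inf (on_sphere N)) = sets (on_sphere N)"
      by (simp add: delta_inf_def on_sphere_def)
    show "emeasure (mixture 0 delta_inf (on_sphere N)) A = emeasure (on_sphere N) A"
      if "A \<in> sets (mixture 0 delta_inf (on_sphere N))" for A
      using that sets by (subst emeasure_mixture) auto
  qed
  finally show ?thesis .
qed

text \<open>
  For a real base point the flow is the flow on the line in the coordinate \<open>1 / (x - \<alpha>)\<close>. A point mass at \<open>\<alpha>\<close>
  would be sent to infinity and one at infinity to \<open>0\<close>. Both are excluded, so every measure involved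
  lives on the line, and the barycentres can be compared.
\<close>

theorem F_at_on_sphere:
  assumes M: "real_distribution M" and t: "1 \<le> t" and c: "c \<in> ext_real_line"
    and avoid: "AE x in M. Some (complex_of_real x) \<noteq> c"
  obtains N where "real_distribution N" "F_at c t (on_sphere M) = on_sphere N" "subordinate c t M N"
    "\<And>d. \<lbrakk>d \<in> ext_real_line; AE x in M. Some (complex_of_real x) \<noteq> d\<rbrakk> \<Longrightarrow> AE x in N. Some (complex_of_real x) \<noteq> d"
proof (cases c)
  case None
  interpret M: real_distribution M by fact
  obtain N where N: "real_distribution N" and F: "F_real t (on_sphere M) = on_sphere N"
    and flow: "\<And>z. 0 < Im z \<Longrightarrow> \<exists>W. 0 < Im W \<and> barycentre M W = barycentre N z \<and>
      W - barycentre N z = of_real t * (z - barycentre N z)"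
      "\<And>z W. \<lbrakk>0 < Im z; 0 < Im W; W - barycentre M W = of_real t * (z - barycentre M W)\<rbrakk> \<Longrightarrow>
      barycentre N z = barycentre M W"
    using F_real_on_sphere[OF M t] by blast
  interpret N: real_distribution N by fact
  have id: "distr (on_sphere L) sphere_borel (\<lambda>x. x) = on_sphere L" for L
    by (rule distr_id2) (simp add: on_sphere_def)
  have "moebius_to_inf None = (\<lambda>x. x)" by auto
  then have "F_at None t (on_sphere M) = F_inf t (on_sphere M)"
    using id F_inf_on_sphere[OF M F] by (simp add: F_at_def inv_id[unfolded id_def])
  then have 1: "F_at c t (on_sphere M) = on_sphere N" using F_inf_on_sphere[OF M F] None by simp
  have 2: "subordinate c t M N"
    unfolding subordinate_def None
  proof (intro conjI allI impI)
    fix z assume z: "0 < Im z"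
    then obtain W where W: "0 < Im W" "barycentre M W = barycentre N z"
      "W - barycentre N z = of_real t * (z - barycentre N z)" using flow(1) by blast
    then show "\<exists>W. 0 < Im W \<and> barycentre M W = barycentre N z \<and> dilated None t (barycentre N z) z W"
      using N.barycentre_neq[of z] M.barycentre_neq[of W] z by (intro exI[of _ W]) (simp add: dilated_None)
  next
    fix z W assume zW: "0 < Im z" "0 < Im W" "dilated None t (barycentre M W) z W"
    have "z \<noteq> barycentre M W" using M.Im_barycentre_le[OF zW(2)] zW(1) by auto
    then have "W - barycentre M W = of_real t * (z - barycentre M W)"
      using zW M.barycentre_neq[of W] by (simp add: dilated_None)
    then show "barycentre N z = barycentre M W" using flow(2) zW by blast
  qed
  have 3: "AE x in N. Some (complex_of_real x) \<noteq> d"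
    if d: "d \<in> ext_real_line" "AE x in M. Some (complex_of_real x) \<noteq> d" for d
  proof (cases d)
    case (Some w)
    then obtain \<delta> where \<delta>: "d = Some (complex_of_real \<delta>)"
      using d(1) by (auto simp: ext_real_line_def real_line_def elim: Reals_cases)
    then have "measure M {\<delta>} = 0" using d(2) M.AE_neq_iff by simp
    then have "measure N {\<delta>} = 0" using flow_creates_no_atom[OF M N t flow(1)] by simp
    then show ?thesis using \<delta> N.AE_neq_iff by simp
  qed simp
  show thesis by (rule that[OF N 1 2 3])
next
  case (Some w)
  interpret M: real_distribution M by fact
  obtain \<alpha> where \<alpha>: "c = Some (complex_of_real \<alpha>)"
    using c Some by (auto simp: ext_real_line_def real_line_def elim: Reals_cases)
  let ?a = "complex_of_real \<alpha>"
  have M_\<alpha>: "AE x in M. x \<noteq> \<alpha>" using avoid \<alpha> by simp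
  \<comment> \<open>The primed measures are the images under the coordinate change that moves the base point to infinity.\<close>
  define M' where "M' = distr M borel (\<lambda>x. 1 / (x - \<alpha>))"
  have M': "real_distribution M'" unfolding M'_def by (rule M.real_distribution_distr) simp
  interpret M': real_distribution M' by fact
  obtain N' where N': "real_distribution N'" and F: "F_real t (on_sphere M') = on_sphere N'"
    and flow: "\<And>z. 0 < Im z \<Longrightarrow> \<exists>W. 0 < Im W \<and> barycentre M' W = barycentre N' z \<and>
      W - barycentre N' z = of_real t * (z - barycentre N' z)"
      "\<And>z W. \<lbrakk>0 < Im z; 0 < Im W; W - barycentre M' W = of_real t * (z - barycentre M' W)\<rbrakk> \<Longrightarrow>
      barycentre N' z = barycentre M' W"
    using F_real_on_sphere[OF M' t] by blast
  interpret N': real_distribution N' by fact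
  define N where "N = distr N' borel (\<lambda>y. \<alpha> + 1 / y)"
  have N: "real_distribution N" unfolding N_def by (rule N'.real_distribution_distr) simp
  interpret N: real_distribution N by fact
  have no_atom: "AE y in N'. y \<noteq> \<delta>" if "AE y in M'. y \<noteq> \<delta>" for \<delta>
    using that flow_creates_no_atom[OF M' N' t flow(1)] by (simp add: M'.AE_neq_iff N'.AE_neq_iff)
  have "AE y in M'. y \<noteq> 0"
    unfolding M'_def using M_\<alpha> by (subst AE_distr_iff) auto
  then have N'0: "AE y in N'. y \<noteq> 0" by (rule no_atom)
  have N_\<alpha>: "AE x in N. x \<noteq> \<alpha>"
    unfolding N_def using N'0 by (subst AE_distr_iff) auto
  have N'_eq: "N' = distr N borel (\<lambda>x. 1 / (x - \<alpha>))"
    unfolding N_def by (subst distr_distr) (auto simp: o_def intro!: distr_id2[symmetric])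
  have "distr (on_sphere M) sphere_borel (moebius_to_inf c) = on_sphere M'"
    unfolding M'_def
  proof (rule distr_on_sphere[OF M measurable_moebius_to_inf])
    show "AE x in M. moebius_to_inf c (Some (complex_of_real x)) = Some (complex_of_real (1 / (x - \<alpha>)))"
      using M_\<alpha> by eventually_elim (simp add: \<alpha>)
  qed simp
  moreover have "distr (on_sphere N') sphere_borel (inv (moebius_to_inf c)) = on_sphere N"
    unfolding N_def \<alpha>
  proof (rule distr_on_sphere[OF N' measurable_inv_moebius_to_inf])
    show "AE y in N'. inv (moebius_to_inf (Some ?a)) (Some (complex_of_real y)) = Some (complex_of_real (\<alpha> + 1 / y))"
      using N'0 by eventually_elim (simp add: inv_moebius_to_inf)
  qed simp
  ultimately have 1: "F_at c t (on_sphere M) = on_sphere N"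
    by (simp add: F_at_def F_inf_on_sphere[OF M' F])
  have bary_M: "barycentre M' (1 / (W - ?a)) = 1 / (barycentre M W - ?a)" if "Im W \<noteq> 0" for W
    by (rule barycentre_Moebius[OF M that M_\<alpha> M'_def])
  have bary_N: "barycentre N' (1 / (z - ?a)) = 1 / (barycentre N z - ?a)" if "Im z \<noteq> 0" for z
    by (rule barycentre_Moebius[OF N that N_\<alpha> N'_eq])
  \<comment> \<open>The coordinate change exchanges the half-planes; a conjugation undoes this.\<close>
  have Im_coord: "0 < Im (cnj (1 / (z - ?a)))" if "0 < Im z" for z
  proof -
    have "0 < (Re z - \<alpha>)\<^sup>2 + (Im z)\<^sup>2" using that by (intro add_nonneg_pos) auto
    then show ?thesis using that by (simp add: Im_divide)
  qed
  have neq: "z \<noteq> ?a" if "0 < Im z" for z using that by auto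
  have 2: "subordinate c t M N"
    unfolding subordinate_def \<alpha>
  proof (intro conjI allI impI)
    fix z assume z: "0 < Im z"
    let ?k = "barycentre N z" and ?z' = "1 / (z - ?a)"
    obtain U where U: "0 < Im U" "barycentre M' U = barycentre N' (cnj ?z')"
      "U - barycentre N' (cnj ?z') = of_real t * (cnj ?z' - barycentre N' (cnj ?z'))"
      using flow(1)[OF Im_coord[OF z]] by blast
    define V where "V = cnj U"
    have Vk: "barycentre M' V = 1 / (?k - ?a)" "V - 1 / (?k - ?a) = of_real t * (?z' - 1 / (?k - ?a))"
      using arg_cong[OF U(2), of cnj] arg_cong[OF U(3), of cnj] bary_N[of z] z
      unfolding N'.barycentre_cnj V_def M'.barycentre_cnj by simp_all
    define W where "W = ?a + 1 / V"
    have V0: "V \<noteq> 0" using U(1) by (auto simp: V_def)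
    have "0 < (Re U)\<^sup>2 + (Im U)\<^sup>2" using U(1) by (intro add_nonneg_pos) auto
    then have Im_W: "0 < Im W" using U(1) by (simp add: W_def V_def Im_divide)
    have V: "V = 1 / (W - ?a)" using V0 by (simp add: W_def)
    have "1 / (barycentre M W - ?a) = 1 / (?k - ?a)"
      using bary_M[of W] Im_W Vk(1) unfolding V by simp
    then have k: "barycentre M W = ?k"
      by (metis diff_add_cancel div_by_1 divide_divide_eq_right mult_1)
    have "dilated (Some ?a) t ?k z W"
      using Vk(2) neq[OF z] neq[OF Im_W] N.barycentre_neq[of z] M.barycentre_neq[of W] k z Im_W
        N.barycentre_neq_real[OF _ N_\<alpha>, of z]
      unfolding V by (subst dilated_Some) auto
    then show "\<exists>W. 0 < Im W \<and> barycentre M W = ?k \<and> dilated (Some ?a) t ?k z W"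
      using Im_W k by blast
  next
    fix z W assume z: "0 < Im z" and W: "0 < Im W" and dil: "dilated (Some ?a) t (barycentre M W) z W"
    let ?k = "barycentre M W" and ?z' = "1 / (z - ?a)" and ?V = "1 / (W - ?a)"
    have "z \<noteq> ?k" using M.Im_barycentre_le[OF W] z by auto
    then have "?V - 1 / (?k - ?a) = of_real t * (?z' - 1 / (?k - ?a))"
      using dil neq[OF z] neq[OF W] M.barycentre_neq[of W] W M.barycentre_neq_real[OF _ M_\<alpha>, of W]
      by (subst (asm) dilated_Some) auto
    then have "?V - barycentre M' ?V = of_real t * (?z' - barycentre M' ?V)"
      using bary_M[of W] W by simp
    from arg_cong[OF this, of cnj]
    have "cnj ?V - barycentre M' (cnj ?V) = of_real t * (cnj ?z' - barycentre M' (cnj ?V))"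
      unfolding M'.barycentre_cnj
      by (simp only: complex_cnj_diff complex_cnj_mult complex_cnj_complex_of_real)
    then have "barycentre N' (cnj ?z') = barycentre M' (cnj ?V)"
      using flow(2)[OF Im_coord[OF z] Im_coord[OF W]] by blast
    then have "barycentre N' ?z' = barycentre M' ?V"
      unfolding N'.barycentre_cnj M'.barycentre_cnj by (simp only: complex_cnj_cancel_iff)
    then have "1 / (barycentre N z - ?a) = 1 / (?k - ?a)"
      using bary_M[of W] bary_N[of z] z W by simp
    then show "barycentre N z = ?k"
      by (metis diff_add_cancel div_by_1 divide_divide_eq_right mult_1)
  qed
  have 3: "AE x in N. Some (complex_of_real x) \<noteq> d"
    if d: "d \<in> ext_real_line" "AE x in M. Some (complex_of_real x) \<noteq> d" for d
  proof (cases d)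
    case (Some w)
    then obtain \<delta> where \<delta>: "d = Some (complex_of_real \<delta>)"
      using d(1) by (auto simp: ext_real_line_def real_line_def elim: Reals_cases)
    have "AE x in M. x \<noteq> \<delta>" using d(2) \<delta> by simp
    with M_\<alpha> have "AE x in M. 1 / (x - \<alpha>) \<noteq> 1 / (\<delta> - \<alpha>)"
      by eventually_elim auto
    then have "AE y in M'. y \<noteq> 1 / (\<delta> - \<alpha>)"
      unfolding M'_def by (subst AE_distr_iff) auto
    then have "AE y in N'. y \<noteq> 1 / (\<delta> - \<alpha>)" by (rule no_atom)
    with N'0 have "AE y in N'. \<alpha> + 1 / y \<noteq> \<delta>"
      by eventually_elim auto
    then have "AE x in N. x \<noteq> \<delta>"
      unfolding N_def by (subst AE_distr_iff) auto
    then show ?thesis by (simp add: \<delta>)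
  qed simp
  show thesis by (rule that[OF N 1 2 3])
qed

section \<open>The commutation relation\<close>

text \<open>
  In the coordinate \<open>v = 1 / (z - k)\<close> with \<open>\<kappa> = - Im k \<ge> 0\<close> the upper half-plane becomes the set
  \<open>Im v + \<kappa> (norm v)\<^sup>2 < 0\<close>. This is convex, and \<open>pole a k\<close> lies on its boundary. So the inverse dilations
  with centre \<open>pole a k\<close> preserve the upper half-plane.
\<close>

lemma dilated_point_exists:
  assumes z: "0 < Im z" and k: "Im k \<le> 0" and s: "1 \<le> s" and a: "a \<in> ext_real_line"
  obtains W where "0 < Im W" "W \<noteq> k" "dilated a s k z W"
proof -
  define \<phi> where "\<phi> v = Im v - Im k * ((Re v)\<^sup>2 + (Im v)\<^sup>2)" for v
  let ?p = "pole a k" and ?q = "1 / (z - k)"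
  define \<theta> where "\<theta> = 1 / s"
  have \<theta>: "0 < \<theta>" "\<theta> \<le> 1" using s by (auto simp: \<theta>_def)
  define v where "v = of_real (1 - \<theta>) * ?p + of_real \<theta> * ?q"
  have zk: "0 < (Re z - Re k)\<^sup>2 + (Im z - Im k)\<^sup>2" using z k by (intro add_nonneg_pos) auto
  have inv: "\<phi> (1 / u) = (- Im u - Im k) / ((Re u)\<^sup>2 + (Im u)\<^sup>2)" for u
  proof (cases "u = 0")
    case False
    then have "(Re u)\<^sup>2 + (Im u)\<^sup>2 \<noteq> 0" by (simp add: complex_eq_iff sum_power2_eq_zero_iff)
    moreover have "(Re (1 / u))\<^sup>2 + (Im (1 / u))\<^sup>2 = 1 / ((Re u)\<^sup>2 + (Im u)\<^sup>2)"
      by (simp add: cmod_power2[symmetric] norm_divide power_divide)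
    moreover have "Im (1 / u) = - Im u / ((Re u)\<^sup>2 + (Im u)\<^sup>2)" by (simp add: Im_divide)
    ultimately show ?thesis by (simp add: \<phi>_def diff_divide_distrib)
  qed (simp add: \<phi>_def)
  have "\<phi> ?q = (- Im z) / ((Re (z - k))\<^sup>2 + (Im (z - k))\<^sup>2)" unfolding inv by simp
  then have \<phi>_q: "\<phi> ?q < 0" using z zk by (simp add: divide_neg_pos)
  have \<phi>_p: "\<phi> ?p = 0"
  proof (cases a)
    case (Some c)
    then have "Im c = 0" using a by (auto simp: ext_real_line_def real_line_def complex_is_Real_iff)
    then show ?thesis using Some inv[of "c - k"] by (simp add: pole_def)
  qed (simp add: pole_def \<phi>_def)
  have "\<phi> (of_real (1 - \<theta>) * p + of_real \<theta> * q) = (1 - \<theta>) * \<phi> p + \<theta> * \<phi> q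
      + Im k * (\<theta> * (1 - \<theta>)) * ((Re p - Re q)\<^sup>2 + (Im p - Im q)\<^sup>2)" for p q
    unfolding \<phi>_def by (simp add: power2_eq_square algebra_simps)
  from this[of ?p ?q]
  have "\<phi> v = (1 - \<theta>) * \<phi> ?p + \<theta> * \<phi> ?q
      + Im k * (\<theta> * (1 - \<theta>)) * ((Re ?p - Re ?q)\<^sup>2 + (Im ?p - Im ?q)\<^sup>2)"
    unfolding v_def .
  moreover have "\<theta> * \<phi> ?q < 0" using \<theta>(1) \<phi>_q by (rule mult_pos_neg)
  moreover have "Im k * (\<theta> * (1 - \<theta>)) * ((Re ?p - Re ?q)\<^sup>2 + (Im ?p - Im ?q)\<^sup>2) \<le> 0"
    using k \<theta> by (intro mult_nonpos_nonneg mult_nonneg_nonneg) auto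
  ultimately have \<phi>_v: "\<phi> v < 0" using \<phi>_p by simp
  then have v0: "v \<noteq> 0" by (auto simp: \<phi>_def)
  define W where "W = k + 1 / v"
  have "0 < (Re v)\<^sup>2 + (Im v)\<^sup>2"
    using v0 by (simp add: complex_eq_iff sum_power2_gt_zero_iff)
  then have "0 < Im W" using \<phi>_v by (simp add: W_def Im_divide \<phi>_def field_simps)
  moreover have "W \<noteq> k" using v0 by (simp add: W_def)
  moreover have "dilated a s k z W"
  proof -
    have "1 / (W - k) = v" using v0 by (simp add: W_def)
    then have "1 / (W - k) - ?p = of_real \<theta> * (?q - ?p)"
      unfolding v_def by (simp add: algebra_simps)
    moreover have "of_real s * of_real \<theta> = (1 :: complex)" using s by (simp add: \<theta>_def)
    ultimately show ?thesis by (simp only: dilated_def mult.assoc[symmetric] mult_1)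
  qed
  ultimately show thesis by (rule that)
qed

text \<open>
  All four flows act on the same barycentre \<open>k\<close>, and in the coordinate \<open>1 / (z - k)\<close> they act by dilations.
  The relations between the times say that the two compositions of dilations agree.
\<close>

lemma subordinate_commute:
  assumes N': "real_distribution N'"
    and sub: "subordinate b t M L" "subordinate a s L N" "subordinate a t' M L'" "subordinate b s' L' N'"
    and a: "a \<in> ext_real_line" and times: "1 \<le> s" "s * t = s' * t'" "s + s' = 1 + s * t"
    and z: "0 < Im z"
  shows "barycentre N z = barycentre N' z"
proof -
  interpret N': real_distribution N' by fact
  let ?k = "barycentre N' z"
  let ?a = "pole a ?k" and ?b = "pole b ?k"
  obtain W\<^sub>1 where W\<^sub>1: "0 < Im W\<^sub>1" "barycentre L' W\<^sub>1 = ?k" "dilated b s' ?k z W\<^sub>1"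
    using sub(4) z unfolding subordinate_def by blast
  then obtain W\<^sub>2 where W\<^sub>2: "0 < Im W\<^sub>2" "barycentre M W\<^sub>2 = ?k" "dilated a t' ?k W\<^sub>1 W\<^sub>2"
    using sub(3) unfolding subordinate_def by metis
  obtain V where V: "0 < Im V" "dilated a s ?k z V"
    using dilated_point_exists[OF z N'.Im_barycentre_le[OF z] times(1) a] by blast
  have "dilated b t ?k V W\<^sub>2"
  proof -
    define x where "x = 1 / (z - ?k)"
    define v where "v = 1 / (V - ?k)"
    define w\<^sub>1 where "w\<^sub>1 = 1 / (W\<^sub>1 - ?k)"
    define w\<^sub>2 where "w\<^sub>2 = 1 / (W\<^sub>2 - ?k)"
    have eqs: "of_real s' * (w\<^sub>1 - ?b) = x - ?b" "of_real t' * (w\<^sub>2 - ?a) = w\<^sub>1 - ?a" "of_real s * (v - ?a) = x - ?a"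
      using W\<^sub>1(3) W\<^sub>2(3) V(2) by (simp_all add: dilated_def x_def v_def w\<^sub>1_def w\<^sub>2_def)
    have times': "complex_of_real s * of_real t = of_real s' * of_real t'"
      "complex_of_real s' = 1 + of_real s * of_real t - of_real s"
      using times(2,3) by (simp_all add: complex_eq_iff)
    have "of_real s * (of_real t * (w\<^sub>2 - ?b)) = of_real s * (v - ?b)"
      using eqs times' by algebra
    then have "of_real t * (w\<^sub>2 - ?b) = v - ?b" using times(1) by simp
    then show ?thesis by (simp add: dilated_def v_def w\<^sub>2_def)
  qed
  then have "barycentre L V = ?k"
    using sub(1) V(1) W\<^sub>2(1,2) unfolding subordinate_def by metis
  then show ?thesis using sub(2) V z unfolding subordinate_def by metis
qed

theorem theorem1p2:
  fixes s t s' t' :: real and a b :: sphere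
  assumes "s \<ge> 1" and "t \<ge> 1"
    and "a \<in> ext_real_line" and "b \<in> ext_real_line"
    and "s' \<ge> 1" and "t' \<ge> 1"
    and "s * t = s' * t'" and "s + s' = 1 + s * t"
  shows "\<forall>\<mu> \<in> prob_on (real_line - {a, b}).
           F_at a s (F_at b t \<mu>) = F_at b s' (F_at a t' \<mu>) \<and>
           F_at a s (F_at b t \<mu>) \<in> prob_on (real_line - {a, b})"
proof
  fix \<mu> assume \<mu>: "\<mu> \<in> prob_on (real_line - {a, b})"
  then have "\<mu> \<in> prob_on real_line" by (auto simp: prob_on_def elim: eventually_mono)
  then obtain M where M: "real_distribution M" and \<mu>_eq: "\<mu> = on_sphere M" by (rule prob_on_real_lineE)
  have in_prob_on: "on_sphere N \<in> prob_on (real_line - {a, b}) \<longleftrightarrow>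
      (AE x in N. Some (complex_of_real x) \<noteq> a) \<and> (AE x in N. Some (complex_of_real x) \<noteq> b)"
    if "real_distribution N" for N
  proof -
    interpret real_distribution N by fact
    have "(AE x in on_sphere N. x \<in> real_line - {a, b}) \<longleftrightarrow>
        (AE x in N. Some (complex_of_real x) \<in> real_line - {a, b})"
      by (rule AE_on_sphere) (simp only: Collect_mem_eq real_line_measurable)
    also have "\<dots> \<longleftrightarrow> (AE x in N. Some (complex_of_real x) \<noteq> a) \<and> (AE x in N. Some (complex_of_real x) \<noteq> b)"
      by (simp add: real_line_def)
    finally show ?thesis using prob_space_on_sphere by (simp add: prob_on_def)
  qed
  have M_avoids: "AE x in M. Some (complex_of_real x) \<noteq> a" "AE x in M. Some (complex_of_real x) \<noteq> b"
    using \<mu> in_prob_on[OF M] by (auto simp: \<mu>_eq)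
  obtain L where L: "real_distribution L" "F_at b t (on_sphere M) = on_sphere L" "subordinate b t M L"
    and L_avoids: "\<And>d. \<lbrakk>d \<in> ext_real_line; AE x in M. Some (complex_of_real x) \<noteq> d\<rbrakk> \<Longrightarrow> AE x in L. Some (complex_of_real x) \<noteq> d"
    using F_at_on_sphere[OF M assms(2,4) M_avoids(2)] by blast
  obtain N where N: "real_distribution N" "F_at a s (on_sphere L) = on_sphere N" "subordinate a s L N"
    and N_avoids: "\<And>d. \<lbrakk>d \<in> ext_real_line; AE x in L. Some (complex_of_real x) \<noteq> d\<rbrakk> \<Longrightarrow> AE x in N. Some (complex_of_real x) \<noteq> d"
    using F_at_on_sphere[OF L(1) assms(1,3) L_avoids[OF assms(3) M_avoids(1)]] by blast
  obtain L' where L': "real_distribution L'" "F_at a t' (on_sphere M) = on_sphere L'" "subordinate a t' M L'"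
    and L'_avoids: "\<And>d. \<lbrakk>d \<in> ext_real_line; AE x in M. Some (complex_of_real x) \<noteq> d\<rbrakk> \<Longrightarrow> AE x in L'. Some (complex_of_real x) \<noteq> d"
    using F_at_on_sphere[OF M assms(6,3) M_avoids(1)] by blast
  obtain N' where N': "real_distribution N'" "F_at b s' (on_sphere L') = on_sphere N'" "subordinate b s' L' N'"
    using F_at_on_sphere[OF L'(1) assms(5,4) L'_avoids[OF assms(4) M_avoids(2)]] by blast
  have "N = N'"
  proof (rule cauchy_unique[OF N(1) N'(1)])
    fix z assume "0 < Im z"
    then have "barycentre N z = barycentre N' z"
      using subordinate_commute[OF N'(1) L(3) N(3) L'(3) N'(3) assms(3)] assms by simp
    then show "cauchy N z = cauchy N' z" by (simp add: barycentre_def recip_def)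
  qed
  then show "F_at a s (F_at b t \<mu>) = F_at b s' (F_at a t' \<mu>) \<and> F_at a s (F_at b t \<mu>) \<in> prob_on (real_line - {a, b})"
    using in_prob_on[OF N(1)] N_avoids L_avoids M_avoids assms(3,4) L N L' N' by (simp add: \<mu>_eq)
qed

end
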